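(* Let $d\in\mathbb{R}$ with $d^2\ge4$. Unitary fiber functors on the C*-tensor category $\mathcal{O}_d$ are parametrized, up to unitary monoidal natural equivalence, by positive eigenvalue lists (finite unordered lists, with multiplicities, of positive real numbers, of arbitrary length $n\ge1$) $\{\mu_1,\dots,\mu_n\}$ satisfying $$\sum_j\mu_j^2=|d|=\sum_j\mu_j^{-2}.$$
   Context: A Kauffman diagram of type $(m,n)$ is a planar isotopy class (boundary fixed) of $(m+n)/2$ pairwise disjoint strings (arcs, no closed loops) in a rectangle, joining in pairs $m$ points on the upper edge and $n$ points on the lower edge. An oriented Kauffman diagram is one in which every string is oriented. Label an upper vertex by $X$ if a string starts there and by $X^*$ if a string ends there; label a lower vertex by $X$ if a string ends there and by $X^*$ if a string starts there. Reading labels from left to right gives an upper word $w$ and a lower word $w'$ in the letters $X,X^*$; the diagram is of type $(w,w')$. Let $K_{w,w'}$ be the set of oriented Kauffman diagrams of type $(w,w')$. $\mathcal{O}_d$ is the strict $\mathbb{C}$-linear tensor category whose objects are the symbols $X^w$ for finite (possibly empty) words $w$ in $X,X^*$, with $\mathrm{Hom}(X^w,X^{w'})=\mathbb{C}[K_{w,w'}]$ (the vector space with basis $K_{w,w'}$). Composition is the bilinear extension of vertical concatenation (first map on top), each resulting closed loop being replaced by the scalar $d$. The tensor product is concatenation of words and horizontal juxtaposition of diagrams; the unit object is $I=X^\emptyset$. The basic arcs $\epsilon_X:X\otimes X^*\to I$ and $\epsilon_{X^*}:X^*\otimes X\to I$ are the unique diagrams of these types. For $d\in\mathbb{R}$,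 $d^2\ge4$, $\mathcal{O}_d$ is a C*-tensor category with the conjugate-linear $*$-operation $D^*=(d/|d|)^{\sharp(D)}D'$ on diagrams, where $\sharp(D)$ is the number of strings of $D$ joining two upper vertices minus the number joining two lower vertices, and $D'$ is obtained from $D$ by reflecting in a horizontal line and reversing all orientations. A unitary fiber functor is a $\mathbb{C}$-linear (strictly) monoidal functor $\Phi$ from $\mathcal{O}_d$ to the C*-tensor category of finite-dimensional Hilbert spaces with $\Phi(f^* )=\Phi(f)^*$ for all morphisms $f$. Two of them are equivalent if related by a monoidal natural isomorphism consisting of unitary maps. The parametrization: choosing orthonormal bases $\{v_i\}_{i=1}^n$ of $\Phi(X)$ and $\{w_j\}_{j=1}^n$ of $\Phi(X^* )$, the list attached to $\Phi$ consists of the eigenvalues $\mu_1,\dots,\mu_n$ of $(BB^* )^{1/2}$, where $B=(b_{ji})$ with $b_{ji}=\Phi(\epsilon_{X^*})(w_j\otimes v_i)$. *)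

theory Defs
  imports "Jordan_Normal_Form.Schur_Decomposition" "HOL-Library.Function_Algebras"
begin

section \<open>Oriented Kauffman diagrams\<close>

datatype letter = LX | LXstar

type_synonym word = "letter list"

text \<open>Vertices are numbered from left to right, starting with 0, on each edge of the rectangle.\<close>

datatype vertex = Up nat | Lo nat

text \<open>
  A planar isotopy class of pairwise disjoint oriented strings is determined by the set of pairs
  (starting vertex, end vertex) of its strings; the sets that occur are the perfect matchings
  without crossings.
\<close>

type_synonym diagram = "(vertex \<times> vertex) set"

definition vertices :: "nat \<Rightarrow> nat \<Rightarrow> vertex set" where
  "vertices m n = Up ` {..<m} \<union> Lo ` {..<n}"

text \<open>
  The order in which the vertices are met when the boundary is traversed counterclockwise, starting
  at its right edge: the upper vertices from right to left, then the lower ones from left to right.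
\<close>

fun pos :: "vertex \<Rightarrow> int" where
  "pos (Up i) = - int i - 1"
| "pos (Lo j) = int j"

definition left_end :: "vertex \<times> vertex \<Rightarrow> int" where
  "left_end s = min (pos (fst s)) (pos (snd s))"

definition right_end :: "vertex \<times> vertex \<Rightarrow> int" where
  "right_end s = max (pos (fst s)) (pos (snd s))"

definition crosses :: "vertex \<times> vertex \<Rightarrow> vertex \<times> vertex \<Rightarrow> bool" where
  "crosses s t \<longleftrightarrow>
     left_end s < left_end t \<and> left_end t < right_end s \<and> right_end s < right_end t \<or>
     left_end t < left_end s \<and> left_end s < right_end t \<and> right_end t < right_end s"

definition oriented_kauffman :: "nat \<Rightarrow> nat \<Rightarrow> diagram set" where
  "oriented_kauffman m n =
     {D. D \<subseteq> vertices m n \<times> vertices m n \<and>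
         (\<forall>s\<in>D. fst s \<noteq> snd s) \<and>
         (\<forall>p\<in>vertices m n. \<exists>!s. s \<in> D \<and> (p = fst s \<or> p = snd s)) \<and>
         (\<forall>s\<in>D. \<forall>t\<in>D. \<not> crosses s t)}"

definition upper_word :: "nat \<Rightarrow> diagram \<Rightarrow> word" where
  "upper_word m D = map (\<lambda>i. if Up i \<in> fst ` D then LX else LXstar) [0..<m]"

definition lower_word :: "nat \<Rightarrow> diagram \<Rightarrow> word" where
  "lower_word n D = map (\<lambda>j. if Lo j \<in> snd ` D then LX else LXstar) [0..<n]"

definition kauffman :: "word \<Rightarrow> word \<Rightarrow> diagram set" where
  "kauffman u v = {D \<in> oriented_kauffman (length u) (length v).
              upper_word (length u) D = u \<and> lower_word (length v) D = v}"

lemma finite_kauffman: "finite (kauffman u v)"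
proof -
  have "finite (vertices (length u) (length v))"
    by (simp add: vertices_def)
  then have "finite (Pow (vertices (length u) (length v) \<times> vertices (length u) (length v)))"
    by simp
  then show ?thesis
    by (rule rev_finite_subset) (auto simp: kauffman_def oriented_kauffman_def)
qed

definition id_diagram :: "word \<Rightarrow> diagram" where
  "id_diagram w =
     (\<lambda>i. if w ! i = LX then (Up i, Lo i) else (Lo i, Up i)) ` {..<length w}"

text \<open>
  Vertical concatenation. The strings of the upper diagram \<open>D\<close> and of the lower diagram \<open>E\<close> are the
  edges of a directed graph in which the lower vertices of \<open>D\<close> are identified with the upper vertices
  of \<open>E\<close>. For composable diagrams every middle vertex has exactly one incoming and one outgoing
  edge, so that the strings of the concatenation are the maximal paths and the closed loops are the
  directed cycles.
\<close>

datatype node = Top nat | Mid nat | Bot nat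

fun upper_node :: "vertex \<Rightarrow> node" where
  "upper_node (Up i) = Top i"
| "upper_node (Lo j) = Mid j"

fun lower_node :: "vertex \<Rightarrow> node" where
  "lower_node (Up i) = Mid i"
| "lower_node (Lo j) = Bot j"

fun outer_node :: "vertex \<Rightarrow> node" where
  "outer_node (Up i) = Top i"
| "outer_node (Lo j) = Bot j"

definition glue :: "diagram \<Rightarrow> diagram \<Rightarrow> (node \<times> node) set" where
  "glue D E = map_prod upper_node upper_node ` D \<union> map_prod lower_node lower_node ` E"

definition stack :: "diagram \<Rightarrow> diagram \<Rightarrow> diagram" where
  "stack D E = {(p, q). (outer_node p, outer_node q) \<in> (glue D E)\<^sup>+}"

definition loops :: "diagram \<Rightarrow> diagram \<Rightarrow> nat" where
  "loops D E = card {(glue D E)\<^sup>+ `` {p} | p. (p, p) \<in> (glue D E)\<^sup>+}"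

text \<open>Horizontal juxtaposition, where \<open>m\<close> and \<open>n\<close> are the numbers of upper and lower vertices of the
  left-hand diagram.\<close>

fun shift :: "nat \<Rightarrow> nat \<Rightarrow> vertex \<Rightarrow> vertex" where
  "shift m n (Up i) = Up (m + i)"
| "shift m n (Lo j) = Lo (n + j)"

definition juxtapose :: "nat \<Rightarrow> nat \<Rightarrow> diagram \<Rightarrow> diagram \<Rightarrow> diagram" where
  "juxtapose m n D E = D \<union> map_prod (shift m n) (shift m n) ` E"

fun flip :: "vertex \<Rightarrow> vertex" where
  "flip (Up i) = Lo i"
| "flip (Lo i) = Up i"

definition reflect :: "diagram \<Rightarrow> diagram" where
  "reflect D = {(flip q, flip p) | p q. (p, q) \<in> D}"

lemma flip_flip [simp]: "flip (flip p) = p"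
  by (cases p) auto

lemma reflect_reflect [simp]: "reflect (reflect D) = D"
proof -
  have "(p, q) \<in> reflect (reflect D)" if "(p, q) \<in> D" for p q
  proof -
    have "(flip q, flip p) \<in> reflect D"
      using that by (auto simp: reflect_def)
    then have "(flip (flip p), flip (flip q)) \<in> reflect (reflect D)"
      unfolding reflect_def[of "reflect D"] by blast
    then show ?thesis by simp
  qed
  then show ?thesis
    by (auto simp: reflect_def)
qed

definition sharp :: "diagram \<Rightarrow> int" where
  "sharp D = int (card {s \<in> D. \<exists>i j. s = (Up i, Up j)}) - int (card {s \<in> D. \<exists>i j. s = (Lo i, Lo j)})"


section \<open>The tensor category\<close>

text \<open>
  The object \<open>X\<^sup>w\<close> is represented by the word \<open>w\<close>; the tensor product of objects is concatenation
  of words and the unit object is the empty word. A morphism is a function of coefficients on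
  diagrams. The morphism operations below take as first arguments the words between which their
  arguments run.
\<close>

type_synonym morphism = "diagram \<Rightarrow> complex"

definition Hom :: "word \<Rightarrow> word \<Rightarrow> morphism set" where
  "Hom u v = {f. \<forall>D. D \<notin> kauffman u v \<longrightarrow> f D = 0}"

definition of_diagram :: "diagram \<Rightarrow> morphism" where
  "of_diagram D = (\<lambda>E. if E = D then 1 else 0)"

definition id_mor :: "word \<Rightarrow> morphism" where
  "id_mor w = of_diagram (id_diagram w)"

text \<open>\<open>comp_mor d u v w f g\<close> is the composition of first \<open>f \<in> Hom u v\<close>, then \<open>g \<in> Hom v w\<close>.\<close>

definition comp_mor :: "real \<Rightarrow> word \<Rightarrow> word \<Rightarrow> word \<Rightarrow> morphism \<Rightarrow> morphism \<Rightarrow> morphism" where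
  "comp_mor d u v w f g =
     (\<lambda>F. \<Sum>D\<in>kauffman u v. \<Sum>E\<in>kauffman v w.
        f D * g E * complex_of_real d ^ loops D E * of_diagram (stack D E) F)"

definition tensor_mor :: "word \<Rightarrow> word \<Rightarrow> word \<Rightarrow> word \<Rightarrow> morphism \<Rightarrow> morphism \<Rightarrow> morphism" where
  "tensor_mor u u' v v' f g =
     (\<lambda>F. \<Sum>D\<in>kauffman u u'. \<Sum>E\<in>kauffman v v'.
        f D * g E * of_diagram (juxtapose (length u) (length u') D E) F)"

definition star_mor :: "real \<Rightarrow> word \<Rightarrow> word \<Rightarrow> morphism \<Rightarrow> morphism" where
  "star_mor d u v f =
     (\<lambda>F. \<Sum>D\<in>kauffman u v.
        cnj (f D) * complex_of_real ((d / \<bar>d\<bar>) powi sharp D) * of_diagram (reflect D) F)"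

definition eps_Xstar :: morphism where
  "eps_Xstar = of_diagram {(Up 1, Up 0)}"

lemma kauffman_eps_Xstar: "kauffman [LXstar, LX] [] = {{(Up 1, Up 0)}}"
proof
  have v: "vertices (length [LXstar, LX]) (length ([] :: word)) = {Up 0, Up 1}"
    by (auto simp: vertices_def lessThan_Suc)
  show "kauffman [LXstar, LX] [] \<subseteq> {{(Up 1, Up 0)}}"
  proof
    fix D assume "D \<in> kauffman [LXstar, LX] []"
    then have D: "D \<subseteq> {Up 0, Up 1} \<times> {Up 0, Up 1}" "\<forall>s\<in>D. fst s \<noteq> snd s"
      "upper_word 2 D = [LXstar, LX]"
      using v by (auto simp: kauffman_def oriented_kauffman_def numeral_2_eq_2)
    from D(3) have "Up 0 \<notin> fst ` D" "Up 1 \<in> fst ` D"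
      by (auto simp: upper_word_def numeral_2_eq_2 split: if_splits)
    then have "D = {(Up 1, Up 0)}"
      using D(1,2) by force
    then show "D \<in> {{(Up 1, Up 0)}}" by simp
  qed
  have "{(Up 1, Up 0)} \<in> oriented_kauffman (length [LXstar, LX]) (length ([] :: word))"
    unfolding oriented_kauffman_def v by (auto simp: crosses_def)
  then show "{{(Up 1, Up 0)}} \<subseteq> kauffman [LXstar, LX] []"
    by (auto simp: kauffman_def upper_word_def lower_word_def)
qed


section \<open>Finite-dimensional Hilbert spaces\<close>

text \<open>
  A Hilbert space is given by a linear subspace \<open>vecs\<close> of an ambient complex vector space (which may
  be infinite-dimensional and carries no inner product of its own) together with an inner product on
  this subspace, linear in its first argument.
\<close>

record 'a hilb =
  scl :: "complex \<Rightarrow> 'a \<Rightarrow> 'a"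
  vecs :: "'a set"
  ip :: "'a \<Rightarrow> 'a \<Rightarrow> complex"

definition fd_hilbert :: "'a::ab_group_add hilb \<Rightarrow> bool" where
  "fd_hilbert H \<longleftrightarrow>
     vector_space (scl H) \<and>
     module.subspace (scl H) (vecs H) \<and>
     (\<exists>B. finite B \<and> module.span (scl H) B = vecs H) \<and>
     (\<forall>x\<in>vecs H. \<forall>y\<in>vecs H. \<forall>z\<in>vecs H. ip H (x + y) z = ip H x z + ip H y z) \<and>
     (\<forall>c. \<forall>x\<in>vecs H. \<forall>y\<in>vecs H. ip H (scl H c x) y = c * ip H x y) \<and>
     (\<forall>x\<in>vecs H. \<forall>y\<in>vecs H. ip H y x = cnj (ip H x y)) \<and>
     (\<forall>x\<in>vecs H. x \<noteq> 0 \<longrightarrow> Re (ip H x x) > 0)"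

definition linear_map :: "'a::ab_group_add hilb \<Rightarrow> 'b::ab_group_add hilb \<Rightarrow> ('a \<Rightarrow> 'b) \<Rightarrow> bool" where
  "linear_map H L T \<longleftrightarrow>
     (\<forall>x\<in>vecs H. T x \<in> vecs L) \<and>
     (\<forall>x\<in>vecs H. \<forall>y\<in>vecs H. T (x + y) = T x + T y) \<and>
     (\<forall>c. \<forall>x\<in>vecs H. T (scl H c x) = scl L c (T x))"

definition unitary_map :: "'a::ab_group_add hilb \<Rightarrow> 'b::ab_group_add hilb \<Rightarrow> ('a \<Rightarrow> 'b) \<Rightarrow> bool" where
  "unitary_map H L T \<longleftrightarrow>
     linear_map H L T \<and> T ` vecs H = vecs L \<and>
     (\<forall>x\<in>vecs H. \<forall>y\<in>vecs H. ip L (T x) (T y) = ip H x y)"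

text \<open>\<open>is_tensor H L M t\<close>: the Hilbert space \<open>M\<close>, with \<open>t x y\<close> as the elementary tensor of \<open>x\<close>
  and \<open>y\<close>, is the tensor product of \<open>H\<close> and \<open>L\<close>.\<close>

definition is_tensor ::
    "'a::ab_group_add hilb \<Rightarrow> 'a hilb \<Rightarrow> 'a hilb \<Rightarrow> ('a \<Rightarrow> 'a \<Rightarrow> 'a) \<Rightarrow> bool" where
  "is_tensor H L M t \<longleftrightarrow>
     (\<forall>y\<in>vecs L. linear_map H M (\<lambda>x. t x y)) \<and>
     (\<forall>x\<in>vecs H. linear_map L M (t x)) \<and>
     (\<forall>x\<in>vecs H. \<forall>x'\<in>vecs H. \<forall>y\<in>vecs L. \<forall>y'\<in>vecs L.
        ip M (t x y) (t x' y') = ip H x x' * ip L y y') \<and>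
     module.span (scl M) {t x y | x y. x \<in> vecs H \<and> y \<in> vecs L} = vecs M"

definition orthonormal_basis :: "'a::ab_group_add hilb \<Rightarrow> nat \<Rightarrow> (nat \<Rightarrow> 'a) \<Rightarrow> bool" where
  "orthonormal_basis H n v \<longleftrightarrow>
     (\<forall>i<n. v i \<in> vecs H) \<and>
     (\<forall>i<n. \<forall>j<n. ip H (v i) (v j) = (if i = j then 1 else 0)) \<and>
     module.span (scl H) (v ` {..<n}) = vecs H"


section \<open>Unitary fiber functors\<close>

text \<open>
  A functor consists of its values on objects and on morphisms (as a linear map relevant on the
  Hilbert space of the source object only) together with the elementary tensors
  \<open>ten \<Phi> u v x y\<close> by which \<open>obj \<Phi> (u @ v)\<close> is the tensor product of \<open>obj \<Phi> u\<close> and \<open>obj \<Phi> v\<close>,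
  and the unit vector \<open>vac \<Phi>\<close> by which \<open>obj \<Phi> []\<close> is the one-dimensional Hilbert space of
  complex numbers. Strictness amounts to these tensors being associative and unital on the nose.
\<close>

record 'a fiber =
  obj :: "word \<Rightarrow> 'a hilb"
  mor :: "word \<Rightarrow> word \<Rightarrow> morphism \<Rightarrow> 'a \<Rightarrow> 'a"
  ten :: "word \<Rightarrow> word \<Rightarrow> 'a \<Rightarrow> 'a \<Rightarrow> 'a"
  vac :: 'a

definition linear_functor :: "real \<Rightarrow> 'a::ab_group_add fiber \<Rightarrow> bool" where
  "linear_functor d \<Phi> \<longleftrightarrow>
     (\<forall>w. fd_hilbert (obj \<Phi> w)) \<and>
     (\<forall>u v. \<forall>f\<in>Hom u v. linear_map (obj \<Phi> u) (obj \<Phi> v) (mor \<Phi> u v f)) \<and>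
     (\<forall>u v. \<forall>f\<in>Hom u v. \<forall>g\<in>Hom u v. \<forall>x\<in>vecs (obj \<Phi> u).
        mor \<Phi> u v (\<lambda>D. f D + g D) x = mor \<Phi> u v f x + mor \<Phi> u v g x) \<and>
     (\<forall>u v c. \<forall>f\<in>Hom u v. \<forall>x\<in>vecs (obj \<Phi> u).
        mor \<Phi> u v (\<lambda>D. c * f D) x = scl (obj \<Phi> v) c (mor \<Phi> u v f x)) \<and>
     (\<forall>w. \<forall>x\<in>vecs (obj \<Phi> w). mor \<Phi> w w (id_mor w) x = x) \<and>
     (\<forall>u v w. \<forall>f\<in>Hom u v. \<forall>g\<in>Hom v w. \<forall>x\<in>vecs (obj \<Phi> u).
        mor \<Phi> u w (comp_mor d u v w f g) x = mor \<Phi> v w g (mor \<Phi> u v f x))"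

definition monoidal_functor :: "'a::ab_group_add fiber \<Rightarrow> bool" where
  "monoidal_functor \<Phi> \<longleftrightarrow>
     (\<forall>u v. is_tensor (obj \<Phi> u) (obj \<Phi> v) (obj \<Phi> (u @ v)) (ten \<Phi> u v)) \<and>
     vecs (obj \<Phi> []) = module.span (scl (obj \<Phi> [])) {vac \<Phi>} \<and>
     ip (obj \<Phi> []) (vac \<Phi>) (vac \<Phi>) = 1 \<and>
     (\<forall>u v w. \<forall>x\<in>vecs (obj \<Phi> u). \<forall>y\<in>vecs (obj \<Phi> v). \<forall>z\<in>vecs (obj \<Phi> w).
        ten \<Phi> (u @ v) w (ten \<Phi> u v x y) z = ten \<Phi> u (v @ w) x (ten \<Phi> v w y z)) \<and>
     (\<forall>w. \<forall>x\<in>vecs (obj \<Phi> w). ten \<Phi> [] w (vac \<Phi>) x = x \<and> ten \<Phi> w [] x (vac \<Phi>) = x) \<and>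
     (\<forall>u u' v v'. \<forall>f\<in>Hom u u'. \<forall>g\<in>Hom v v'. \<forall>x\<in>vecs (obj \<Phi> u). \<forall>y\<in>vecs (obj \<Phi> v).
        mor \<Phi> (u @ v) (u' @ v') (tensor_mor u u' v v' f g) (ten \<Phi> u v x y)
          = ten \<Phi> u' v' (mor \<Phi> u u' f x) (mor \<Phi> v v' g y))"

definition star_preserving :: "real \<Rightarrow> 'a::ab_group_add fiber \<Rightarrow> bool" where
  "star_preserving d \<Phi> \<longleftrightarrow>
     (\<forall>u v. \<forall>f\<in>Hom u v. \<forall>x\<in>vecs (obj \<Phi> u). \<forall>y\<in>vecs (obj \<Phi> v).
        ip (obj \<Phi> u) x (mor \<Phi> v u (star_mor d u v f) y) = ip (obj \<Phi> v) (mor \<Phi> u v f x) y)"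

definition unitary_fiber_functor :: "real \<Rightarrow> 'a::ab_group_add fiber \<Rightarrow> bool" where
  "unitary_fiber_functor d \<Phi> \<longleftrightarrow>
     linear_functor d \<Phi> \<and> monoidal_functor \<Phi> \<and> star_preserving d \<Phi>"

definition unitarily_equivalent :: "'a::ab_group_add fiber \<Rightarrow> 'b::ab_group_add fiber \<Rightarrow> bool" where
  "unitarily_equivalent \<Phi> \<Psi> \<longleftrightarrow>
     (\<exists>U :: word \<Rightarrow> 'a \<Rightarrow> 'b.
        (\<forall>w. unitary_map (obj \<Phi> w) (obj \<Psi> w) (U w)) \<and>
        (\<forall>u v. \<forall>f\<in>Hom u v. \<forall>x\<in>vecs (obj \<Phi> u).
           U v (mor \<Phi> u v f x) = mor \<Psi> u v f (U u x)) \<and>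
        (\<forall>u v. \<forall>x\<in>vecs (obj \<Phi> u). \<forall>y\<in>vecs (obj \<Phi> v).
           U (u @ v) (ten \<Phi> u v x y) = ten \<Psi> u v (U u x) (U v y)) \<and>
        U [] (vac \<Phi>) = vac \<Psi>)"


section \<open>Eigenvalue lists\<close>

text \<open>The value of \<open>\<Phi>(\<epsilon>)\<close> lies in \<open>obj \<Phi> []\<close>; its inner product with \<open>vac \<Phi>\<close> is the complex number
  with which it is identified.\<close>

definition pairing_matrix ::
    "'a::ab_group_add fiber \<Rightarrow> nat \<Rightarrow> (nat \<Rightarrow> 'a) \<Rightarrow> (nat \<Rightarrow> 'a) \<Rightarrow> complex mat" where
  "pairing_matrix \<Phi> n v w =
     mat n n (\<lambda>(j, i). ip (obj \<Phi> [])
       (mor \<Phi> [LXstar, LX] [] eps_Xstar (ten \<Phi> [LXstar] [LX] (w j) (v i))) (vac \<Phi>))"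

definition psd_sqrt :: "complex mat \<Rightarrow> complex mat \<Rightarrow> bool" where
  "psd_sqrt A P \<longleftrightarrow>
     P \<in> carrier_mat (dim_row A) (dim_row A) \<and> mat_adjoint P = P \<and>
     (\<forall>x\<in>carrier_vec (dim_row A). Re ((P *\<^sub>v x) \<bullet>c x) \<ge> 0) \<and> P * P = A"

definition eigenvalue_list :: "'a::ab_group_add fiber \<Rightarrow> real multiset \<Rightarrow> bool" where
  "eigenvalue_list \<Phi> \<mu> \<longleftrightarrow>
     (\<exists>n v w P. orthonormal_basis (obj \<Phi> [LX]) n v \<and> orthonormal_basis (obj \<Phi> [LXstar]) n w \<and>
        psd_sqrt (pairing_matrix \<Phi> n v w * mat_adjoint (pairing_matrix \<Phi> n v w)) P \<and>
        image_mset complex_of_real \<mu> = proots (char_poly P))"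

definition positive_lists :: "real \<Rightarrow> real multiset set" where
  "positive_lists d =
     {\<mu>. \<mu> \<noteq> {#} \<and> (\<forall>x\<in>#\<mu>. x > 0) \<and>
         (\<Sum>x\<in>#\<mu>. x ^ 2) = \<bar>d\<bar> \<and> (\<Sum>x\<in>#\<mu>. x powi (-2)) = \<bar>d\<bar>}"

end

theory Submission
  imports Defs
begin

text \<open>
  A fiber functor is determined by its pairing \<open>\<epsilon>\<close> on \<open>X\<^sup>* \<otimes> X\<close>: the snake identities force the
  pairing on \<open>X \<otimes> X\<^sup>*\<close> to be its inverse up to conjugation and the sign of \<open>d\<close>, and every diagram
  arises from the empty one by adding cups, bending the leftmost vertex around the edge, and
  reflecting. In suitable orthonormal bases the pairing is diagonal with entries \<open>\<mu>\<^sub>i\<close> (singular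
  values), and the values of the two closed loops give the two sum conditions.

  Conversely, a list \<open>\<mu>\<close> defines a functor by a state sum: a string in state \<open>k\<close> is weighted by
  \<open>c\<^sub>k\<close> to the power of its rotation, where \<open>c\<^sub>k\<close> is \<open>\<mu>\<^sub>k\<close> up to a root of unity. In a vertical
  concatenation the middle vertices are contracted one at a time from right to left. Each contraction
  joins two ends that are neighbours on the boundary, so the absence of crossings makes the rotation
  additive; a loop that closes has rotation \<open>\<plusminus>2\<close> and contributes the sum over \<open>k\<close> of \<open>c\<^sub>k\<close> to the
  power \<open>\<plusminus>2\<close>, which is \<open>d\<close>.
\<close>

section \<open>Diagrams as matchings and graph contraction\<close>

text \<open>The root of unity reconciles two signs. Loops must have the value \<open>d\<close>,
  while the list only provides sums equal to \<open>|d|\<close>; dividing the weights by a number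
  whose square is the sign of \<open>d\<close> corrects the powers 2 and -2 at once. This spoils the
  positivity of the pairing, which is restored by one factor \<open>root_sign d\<close>, a square
  root of that number, for each upper vertex and its inverse for each lower vertex. Conjugation of
  these numbers then produces exactly the sign in the star operation.

  In the uniqueness part the star structure enters through reflection: a family of unitary maps that
  commutes with a diagram commutes with its adjoint, so cups need no check once caps are settled.
  Concatenation is needed there only for bending, which closes no loop; no general composite has to
  be analysed. Conversely, nothing about generators is used for the state sum, whose functoriality
  is proved for arbitrary pairs of diagrams.\<close>

lemma letter_neq_iff [simp]: "a \<noteq> LX \<longleftrightarrow> a = LXstar" "a \<noteq> LXstar \<longleftrightarrow> a = LX"
  "LX \<noteq> a \<longleftrightarrow> a = LXstar" "LXstar \<noteq> a \<longleftrightarrow> a = LX"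
  by (cases a; simp)+

fun dual :: "letter \<Rightarrow> letter" where
  "dual LX = LXstar"
| "dual LXstar = LX"

lemma dual_dual [simp]: "dual (dual a) = a"
  by (cases a) auto

lemma dual_eq [simp]: "dual a = LX \<longleftrightarrow> a = LXstar" "dual a = LXstar \<longleftrightarrow> a = LX"
  by (cases a; simp)+

section \<open>Diagrams as bijections from starting vertices to end vertices\<close>

definition sources :: "word \<Rightarrow> word \<Rightarrow> vertex set" where
  "sources u v = Up ` {i. i < length u \<and> u ! i = LX} \<union> Lo ` {j. j < length v \<and> v ! j = LXstar}"

definition targets :: "word \<Rightarrow> word \<Rightarrow> vertex set" where
  "targets u v = Up ` {i. i < length u \<and> u ! i = LXstar} \<union> Lo ` {j. j < length v \<and> v ! j = LX}"

lemma mem_sources [simp]: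
  "Up i \<in> sources u v \<longleftrightarrow> i < length u \<and> u ! i = LX"
  "Lo j \<in> sources u v \<longleftrightarrow> j < length v \<and> v ! j = LXstar"
  by (auto simp: sources_def)

lemma mem_targets [simp]:
  "Up i \<in> targets u v \<longleftrightarrow> i < length u \<and> u ! i = LXstar"
  "Lo j \<in> targets u v \<longleftrightarrow> j < length v \<and> v ! j = LX"
  by (auto simp: targets_def)

text \<open>Reversal of all orientations exchanges starting and end vertices; this transfers facts
  about \<open>sources\<close> to \<open>targets\<close>.\<close>

lemma targets_eq_sources_dual: "targets u v = sources (map dual u) (map dual v)"
  by (auto simp: sources_def targets_def)

lemma finite_sources [simp]: "finite (sources u v)" and finite_targets [simp]: "finite (targets u v)"
  by (auto simp: sources_def targets_def)

lemma sources_targets_disjoint: "sources u v \<inter> targets u v = {}"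
  by (auto simp: sources_def targets_def)

lemma sources_Un_targets: "sources u v \<union> targets u v = vertices (length u) (length v)"
  by (auto simp: sources_def targets_def vertices_def image_iff)

text \<open>Crossing in terms of four bare integers, so that it applies to the ports of a glued
  graph as well as to \<open>pos\<close>.\<close>

definition int_cross :: "int \<Rightarrow> int \<Rightarrow> int \<Rightarrow> int \<Rightarrow> bool" where
  "int_cross a b c d \<longleftrightarrow>
     min a b < min c d \<and> min c d < max a b \<and> max a b < max c d \<or>
     min c d < min a b \<and> min a b < max c d \<and> max c d < max a b"

lemma crosses_iff_int_cross:
  "crosses s t \<longleftrightarrow> int_cross (pos (fst s)) (pos (snd s)) (pos (fst t)) (pos (snd t))"
  by (simp add: crosses_def int_cross_def left_end_def right_end_def)

text \<open>The words fix which vertices start a string and which end one, so a perfect matching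
  with these words amounts to a bijection between the two sets. Later constructions of diagrams are
  checked in this form.\<close>

lemma kauffman_iff:
  "D \<in> kauffman u v \<longleftrightarrow>
     single_valued D \<and> single_valued (D\<inverse>) \<and> Domain D = sources u v \<and> Range D = targets u v \<and>
     (\<forall>s\<in>D. \<forall>t\<in>D. \<not> crosses s t)"
proof
  assume "D \<in> kauffman u v"
  then have D: "D \<subseteq> vertices (length u) (length v) \<times> vertices (length u) (length v)"
      "\<forall>s\<in>D. fst s \<noteq> snd s"
      "\<forall>p\<in>vertices (length u) (length v). \<exists>!s. s \<in> D \<and> (p = fst s \<or> p = snd s)"
      "\<forall>s\<in>D. \<forall>t\<in>D. \<not> crosses s t"
    and up: "upper_word (length u) D = u" and lo: "lower_word (length v) D = v"
    unfolding kauffman_def oriented_kauffman_def mem_Collect_eq by blast+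
  note sub = D(1) and ne = bspec[OF D(2)] and ex1 = bspec[OF D(3)] and nc = D(4)
  have uniq: "s = t" if "s \<in> D" "t \<in> D" "p = fst s \<or> p = snd s" "p = fst t \<or> p = snd t" for p s t
  proof -
    have "p \<in> vertices (length u) (length v)" using that sub by auto
    from ex1[OF this] that show ?thesis by blast
  qed
  have sv: "single_valued D" "single_valued (D\<inverse>)"
  proof (rule_tac [!] single_valuedI)
    fix x y z assume "(x, y) \<in> D" "(x, z) \<in> D"
    from uniq[OF this, of x] show "y = z" by simp
  next
    fix x y z assume "(x, y) \<in> D\<inverse>" "(x, z) \<in> D\<inverse>"
    then have "(y, x) \<in> D" "(z, x) \<in> D" by simp_all
    from uniq[OF this, of x] show "y = z" by simp
  qed
  have upi: "Up i \<in> Domain D \<longleftrightarrow> u ! i = LX" if "i < length u" for i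
    using arg_cong[OF up, of "\<lambda>w. w ! i"] that
    by (auto simp: upper_word_def Domain_fst split: if_splits)
  have loj: "Lo j \<in> Range D \<longleftrightarrow> v ! j = LX" if "j < length v" for j
    using arg_cong[OF lo, of "\<lambda>w. w ! j"] that
    by (auto simp: lower_word_def Range_snd split: if_splits)
  have xor: "p \<in> Domain D \<longleftrightarrow> p \<notin> Range D" if p: "p \<in> vertices (length u) (length v)" for p
  proof
    assume "p \<in> Domain D"
    then obtain q where q: "(p, q) \<in> D" by blast
    show "p \<notin> Range D"
    proof
      assume "p \<in> Range D"
      then obtain r where r: "(r, p) \<in> D" by blast
      then have "(p, q) = (r, p)" using uniq[OF q r, of p] by simp
      then show False using ne[OF q] by simp
    qed
  next
    assume "p \<notin> Range D"
    then show "p \<in> Domain D" using ex1[OF p] by (metis DomainI RangeI prod.collapse)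
  qed
  have subD: "Domain D \<subseteq> vertices (length u) (length v)" "Range D \<subseteq> vertices (length u) (length v)"
    using sub by auto
  have mem: "(p \<in> Domain D \<longleftrightarrow> p \<in> sources u v) \<and> (p \<in> Range D \<longleftrightarrow> p \<in> targets u v)"
    if "p \<in> vertices (length u) (length v)" for p
  proof (cases p)
    case (Up i)
    with that have "i < length u" by (auto simp: vertices_def)
    then show ?thesis using upi[of i] xor[OF that] Up
      by (auto simp: sources_def targets_def simp del: Domain_iff Range_iff)
  next
    case (Lo j)
    with that have "j < length v" by (auto simp: vertices_def)
    then show ?thesis using loj[of j] xor[OF that] Lo
      by (auto simp: sources_def targets_def simp del: Domain_iff Range_iff)
  qed
  have "Domain D = sources u v" "Range D = targets u v"
    using subD mem sources_Un_targets[of u v] by blast+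
  then show "single_valued D \<and> single_valued (D\<inverse>) \<and> Domain D = sources u v \<and> Range D = targets u v \<and>
     (\<forall>s\<in>D. \<forall>t\<in>D. \<not> crosses s t)"
    using sv nc by blast
next
  assume A: "single_valued D \<and> single_valued (D\<inverse>) \<and> Domain D = sources u v \<and> Range D = targets u v \<and>
     (\<forall>s\<in>D. \<forall>t\<in>D. \<not> crosses s t)"
  note un = sources_Un_targets[of u v] and dis = sources_targets_disjoint[of u v]
  have io: "p \<in> sources u v" "q \<in> targets u v" if "(p, q) \<in> D" for p q
    using A that by auto
  have sub: "D \<subseteq> vertices (length u) (length v) \<times> vertices (length u) (length v)"
    using io un by auto
  have ne: "\<forall>s\<in>D. fst s \<noteq> snd s"
    using io dis by fastforce
  have ex1: "\<exists>!s. s \<in> D \<and> (p = fst s \<or> p = snd s)" if p: "p \<in> vertices (length u) (length v)" for p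
  proof (cases "p \<in> sources u v")
    case True
    then have np: "p \<notin> targets u v" using dis by auto
    obtain q where q: "(p, q) \<in> D" using True A by blast
    show ?thesis
    proof (rule ex1I[of _ "(p, q)"])
      fix s assume "s \<in> D \<and> (p = fst s \<or> p = snd s)"
      then show "s = (p, q)" using q np io A by (cases s) (auto simp: single_valued_def)
    qed (use q in auto)
  next
    case False
    then have "p \<in> targets u v" using p un by auto
    then obtain q where q: "(q, p) \<in> D" using A by blast
    show ?thesis
    proof (rule ex1I[of _ "(q, p)"])
      fix s assume "s \<in> D \<and> (p = fst s \<or> p = snd s)"
      then show "s = (q, p)" using q False io A by (cases s) (auto simp: single_valued_def)
    qed (use q in auto)
  qed
  have "upper_word (length u) D = u"
  proof (rule nth_equalityI)
    fix i assume "i < length (upper_word (length u) D)"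
    then have i: "i < length u" by (simp add: upper_word_def)
    then have "Up i \<in> fst ` D \<longleftrightarrow> u ! i = LX"
      using A by (auto simp: Domain_fst[symmetric] sources_def)
    then show "upper_word (length u) D ! i = u ! i"
      using i by (cases "u ! i") (auto simp: upper_word_def)
  qed (simp add: upper_word_def)
  moreover have "lower_word (length v) D = v"
  proof (rule nth_equalityI)
    fix i assume "i < length (lower_word (length v) D)"
    then have i: "i < length v" by (simp add: lower_word_def)
    then have "Lo i \<in> snd ` D \<longleftrightarrow> v ! i = LX"
      using A by (auto simp: Range_snd[symmetric] targets_def)
    then show "lower_word (length v) D ! i = v ! i"
      using i by (cases "v ! i") (auto simp: lower_word_def)
  qed (simp add: lower_word_def)
  ultimately show "D \<in> kauffman u v"
    using sub ne ex1 A by (simp add: kauffman_def oriented_kauffman_def)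
qed

lemma kauffman_source_target:
  assumes "D \<in> kauffman u v" "(p, q) \<in> D"
  shows "p \<in> sources u v" "q \<in> targets u v"
  using assms by (auto simp: kauffman_iff)

lemma finite_diagram: "D \<in> kauffman u v \<Longrightarrow> finite D"
  by (rule finite_subset[of _ "sources u v \<times> targets u v"]) (auto dest: kauffman_source_target)

text \<open>Both are graphs of functions with the same domain. This spares one inclusion when a
  concatenation is identified.\<close>

lemma kauffman_subset_eq:
  assumes "D \<in> kauffman u v" "E \<in> kauffman u v" "D \<subseteq> E"
  shows "D = E"
proof
  show "E \<subseteq> D"
  proof clarify
    fix p q assume pq: "(p, q) \<in> E"
    then have "p \<in> Domain D" using assms(1,2) by (auto simp: kauffman_iff)
    then obtain q' where "(p, q') \<in> D" by blast
    then show "(p, q) \<in> D" using pq assms kauffman_iff by (metis single_valuedD subsetD)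
  qed
qed fact

section \<open>Contraction of a vertex in a directed graph\<close>

definition contract :: "'n \<Rightarrow> ('n \<times> 'n) set \<Rightarrow> ('n \<times> 'n) set" where
  "contract x G = {(a, b). a \<noteq> x \<and> b \<noteq> x \<and> ((a, b) \<in> G \<or> (a, x) \<in> G \<and> (x, b) \<in> G)}"

text \<open>A path between other vertices can only pass through \<open>x\<close>, and each passage
  is replaced by a shortcut edge.\<close>

lemma trancl_contract:
  assumes "a \<noteq> x" "b \<noteq> x"
  shows "(a, b) \<in> (contract x G)\<^sup>+ \<longleftrightarrow> (a, b) \<in> G\<^sup>+"
proof
  assume "(a, b) \<in> (contract x G)\<^sup>+"
  then show "(a, b) \<in> G\<^sup>+"
    by (induction rule: trancl_induct)
      (auto simp: contract_def intro: trancl_into_trancl trancl_trans r_into_trancl)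
next
  assume "(a, b) \<in> G\<^sup>+"
  \<comment> \<open>A path may currently end in \<open>x\<close>; the last vertex \<open>c\<close>
    before \<open>x\<close> is then remembered for the next step. It may be \<open>a\<close> itself,
    hence the reflexive closure.\<close>
  then have "(b \<noteq> x \<longrightarrow> (a, b) \<in> (contract x G)\<^sup>+) \<and>
    (b = x \<longrightarrow> (\<exists>c. c \<noteq> x \<and> (c, x) \<in> G \<and> (a, c) \<in> (contract x G)\<^sup>*))"
  proof (induction rule: trancl_induct)
    case (base y)
    then show ?case using assms(1) by (auto simp: contract_def)
  next
    case (step y z)
    show ?case
    proof (cases "y = x")
      case True
      then obtain c where c: "c \<noteq> x" "(c, x) \<in> G" "(a, c) \<in> (contract x G)\<^sup>*"
        using step by auto
      have "(c, z) \<in> contract x G" if "z \<noteq> x"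
        using c step(2) True that by (auto simp: contract_def)
      then show ?thesis using c by (meson rtrancl_into_trancl1)
    next
      case False
      then have ay: "(a, y) \<in> (contract x G)\<^sup>+" using step by auto
      have "(y, z) \<in> contract x G" if "z \<noteq> x"
        using False step(2) that by (auto simp: contract_def)
      then show ?thesis using ay False step(2) by (meson trancl_into_rtrancl trancl_into_trancl)
    qed
  qed
  then show "(a, b) \<in> (contract x G)\<^sup>+" using assms(2) by blast
qed

text \<open>With unique successors, the set reached from a point of a cycle is the vertex set of
  that cycle.\<close>

definition cycles :: "('n \<times> 'n) set \<Rightarrow> 'n set set" where
  "cycles G = (\<lambda>p. G\<^sup>+ `` {p}) ` {p. (p, p) \<in> G\<^sup>+}"

lemma loops_eq_card_cycles: "loops D E = card (cycles (glue D E))"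
  unfolding loops_def cycles_def by (rule arg_cong[where f = card]) auto

text \<open>With unique successors every path from \<open>p\<close> runs along the cycle through
  \<open>p\<close>, so it can be continued back to \<open>p\<close>.\<close>

lemma trancl_return:
  assumes sv: "single_valued G" and p: "(p, p) \<in> G\<^sup>+" and q: "(p, q) \<in> G\<^sup>+"
  shows "(q, p) \<in> G\<^sup>+"
  using q
proof (induction rule: trancl_induct)
  case (base y)
  from p obtain z where "(p, z) \<in> G" "(z, p) \<in> G\<^sup>*" by (meson tranclD)
  then have "(y, p) \<in> G\<^sup>*" using base sv by (auto simp: single_valued_def)
  then show ?case using p by auto
next
  case (step y y')
  from step.IH obtain z where "(y, z) \<in> G" "(z, p) \<in> G\<^sup>*" by (meson tranclD)
  then have "(y', p) \<in> G\<^sup>*" using step sv by (auto simp: single_valued_def)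
  then show ?case using p by auto
qed

lemma trancl_Image_eq:
  assumes "single_valued G" "(p, p) \<in> G\<^sup>+" "(p, q) \<in> G\<^sup>+"
  shows "G\<^sup>+ `` {q} = G\<^sup>+ `` {p}"
  using trancl_return[OF assms] assms(3) by (auto intro: trancl_trans)

lemma single_valued_contract:
  assumes "single_valued G" shows "single_valued (contract x G)"
  using assms unfolding contract_def single_valued_def by blast

lemma converse_contract: "(contract x G)\<inverse> = contract x (G\<inverse>)"
  by (auto simp: contract_def)

lemma finite_cycles: assumes "finite G" shows "finite (cycles G)"
proof -
  have "{p. (p, p) \<in> G\<^sup>+} \<subseteq> Domain (G\<^sup>+)" by blast
  moreover have "finite (Domain (G\<^sup>+))" using assms by (simp add: finite_Domain)
  ultimately show ?thesis unfolding cycles_def by (blast intro: finite_imageI finite_subset)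
qed

text \<open>Every cycle other than a loop at \<open>x\<close> survives with \<open>x\<close>
  removed; contraction forgets nothing but such a loop.\<close>

lemma card_cycles_contract:
  assumes sv: "single_valued G" and svc: "single_valued (G\<inverse>)" and fin: "finite G"
  shows "card (cycles G) = card (cycles (contract x G)) + (if (x, x) \<in> G then 1 else 0)"
proof -
  let ?C = "contract x G"
  have img: "?C\<^sup>+ `` {p} = G\<^sup>+ `` {p} - {x}" if "p \<noteq> x" for p
  proof -
    have "x \<notin> Range ?C" by (auto simp: contract_def)
    then have "x \<notin> ?C\<^sup>+ `` {p}" by (metis ImageE RangeI trancl_range)
    then have "y \<in> ?C\<^sup>+ `` {p} \<longleftrightarrow> y \<in> G\<^sup>+ `` {p} - {x}" for y
      using trancl_contract[OF that, of y G] by (cases "y = x") auto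
    then show ?thesis by blast
  qed
  have cC: "cycles ?C = (\<lambda>c. c - {x}) ` (\<lambda>p. G\<^sup>+ `` {p}) ` {p. p \<noteq> x \<and> (p, p) \<in> G\<^sup>+}"
  proof -
    have "x \<notin> Range ?C" by (auto simp: contract_def)
    then have "(x, x) \<notin> ?C\<^sup>+" by (metis RangeI trancl_range)
    then have "{p. (p, p) \<in> ?C\<^sup>+} = {p. p \<noteq> x \<and> (p, p) \<in> G\<^sup>+}"
      using trancl_contract[of _ x _ G] by (metis (lifting))
    then show ?thesis unfolding cycles_def image_image
      by (auto simp: img intro!: image_cong)
  qed
  let ?S = "(\<lambda>p. G\<^sup>+ `` {p}) ` {p. p \<noteq> x \<and> (p, p) \<in> G\<^sup>+}"
  \<comment> \<open>The base point of a cycle in \<open>?S\<close> differs from \<open>x\<close>, so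
    two cycles that agree outside \<open>x\<close> share a point.\<close>
  have inj: "inj_on (\<lambda>c. c - {x}) ?S"
  proof (rule inj_onI, clarify)
    fix p q assume p: "p \<noteq> x" "(p, p) \<in> G\<^sup>+" and q: "q \<noteq> x" "(q, q) \<in> G\<^sup>+"
      and eq: "G\<^sup>+ `` {p} - {x} = G\<^sup>+ `` {q} - {x}"
    then have "(q, p) \<in> G\<^sup>+" by blast
    then show "G\<^sup>+ `` {p} = G\<^sup>+ `` {q}" using trancl_Image_eq[OF sv q(2)] by blast
  qed
  have S: "card (cycles ?C) = card ?S" unfolding cC by (rule card_image[OF inj])
  show ?thesis
  proof (cases "(x, x) \<in> G")
    case True
    have Gx: "G\<^sup>+ `` {x} = {x}"
    proof -
      have "y = x" if "(x, y) \<in> G\<^sup>+" for y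
        using that by (induction rule: trancl_induct) (use True sv in \<open>auto simp: single_valued_def\<close>)
      then show ?thesis using True by auto
    qed
    have "{x} \<notin> ?S" by auto
    moreover have "cycles G = insert {x} ?S"
      using True Gx unfolding cycles_def by auto
    moreover have "finite ?S" using finite_cycles[OF fin] unfolding cycles_def
      by (rule rev_finite_subset) auto
    ultimately show ?thesis using S True by simp
  next
    case False
    have "cycles G = ?S"
    proof
      show "cycles G \<subseteq> ?S"
      proof
        fix c assume "c \<in> cycles G"
        then obtain p where p: "(p, p) \<in> G\<^sup>+" "c = G\<^sup>+ `` {p}" by (auto simp: cycles_def)
        show "c \<in> ?S"
        proof (cases "p = x")
          case True
          \<comment> \<open>Without a loop at \<open>x\<close> the successor of \<open>x\<close> is
            another base point of the same cycle.\<close>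
          from p(1) obtain y where y: "(p, y) \<in> G" "(y, p) \<in> G\<^sup>*" by (meson tranclD)
          then have "y \<noteq> x" using False True by auto
          moreover have py: "(p, y) \<in> G\<^sup>+" using y by auto
          moreover have "(y, y) \<in> G\<^sup>+" using y by (metis rtrancl_into_trancl1)
          ultimately show ?thesis using p trancl_Image_eq[OF sv p(1) py] by blast
        qed (use p in auto)
      qed
    qed (auto simp: cycles_def)
    then show ?thesis using S False by simp
  qed
qed

section \<open>State sums of glued diagrams\<close>

text \<open>
  The strings of two glued diagrams are drawn as arcs below a line, on which the vertices of the upper
  diagram are followed by those of the lower one, each traversed as in \<open>pos\<close>. A middle vertex \<open>j\<close>
  occurs there twice, as \<open>j\<close> and as \<open>2m - 1 - j\<close> where \<open>m\<close> is the length of the middle word; its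
  letter decides at which of the two places the string arrives and at which it leaves.
\<close>

fun out_port :: "word \<Rightarrow> node \<Rightarrow> int" where
  "out_port v (Top i) = - int i - 1"
| "out_port v (Mid j) = (if v ! j = LX then 2 * int (length v) - 1 - int j else int j)"
| "out_port v (Bot k) = 2 * int (length v) + int k"

fun in_port :: "word \<Rightarrow> node \<Rightarrow> int" where
  "in_port v (Top i) = - int i - 1"
| "in_port v (Mid j) = (if v ! j = LX then int j else 2 * int (length v) - 1 - int j)"
| "in_port v (Bot k) = 2 * int (length v) + int k"

fun level :: "vertex \<Rightarrow> int" where
  "level (Up i) = 0"
| "level (Lo j) = - 1"

fun out_level :: "word \<Rightarrow> node \<Rightarrow> int" where
  "out_level v (Top i) = 0"
| "out_level v (Mid j) = (if v ! j = LX then 0 else - 1)"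
| "out_level v (Bot k) = - 1"

fun in_level :: "word \<Rightarrow> node \<Rightarrow> int" where
  "in_level v (Top i) = 0"
| "in_level v (Mid j) = (if v ! j = LX then - 1 else 0)"
| "in_level v (Bot k) = - 1"

text \<open>
  The rotation of a string in units of a half turn. Its first term is the rotation of the arc on the
  line; the levels correct for the lower vertices, which have been turned round to lie on that line.
\<close>

definition rot :: "vertex \<Rightarrow> vertex \<Rightarrow> int" where
  "rot p q = sgn (pos q - pos p) + level q - level p"

definition node_rot :: "word \<Rightarrow> node \<Rightarrow> node \<Rightarrow> int" where
  "node_rot v a b = sgn (in_port v b - out_port v a) + in_level v b - out_level v a"

text \<open>A string carries one state along its whole length, so unequal end states contribute
  zero.\<close>

definition arc :: "(nat \<Rightarrow> complex) \<Rightarrow> int \<Rightarrow> nat \<Rightarrow> nat \<Rightarrow> complex" where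
  "arc c r i j = (if i = j then c i powi r else 0)"

definition weight :: "(nat \<Rightarrow> complex) \<Rightarrow> diagram \<Rightarrow> (vertex \<Rightarrow> nat) \<Rightarrow> complex" where
  "weight c D s = (\<Prod>(p, q)\<in>D. arc c (rot p q) (s p) (s q))"

definition node_weight ::
    "(nat \<Rightarrow> complex) \<Rightarrow> word \<Rightarrow> (node \<times> node) set \<Rightarrow> (node \<Rightarrow> nat) \<Rightarrow> complex" where
  "node_weight c v G s = (\<Prod>(a, b)\<in>G. arc c (node_rot v a b) (s a) (s b))"

fun vertex_state :: "nat list \<Rightarrow> nat list \<Rightarrow> vertex \<Rightarrow> nat" where
  "vertex_state I J (Up i) = I ! i"
| "vertex_state I J (Lo j) = J ! j"

fun node_state :: "nat list \<Rightarrow> nat list \<Rightarrow> nat list \<Rightarrow> node \<Rightarrow> nat" where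
  "node_state I L K (Top i) = I ! i"
| "node_state I L K (Mid j) = L ! j"
| "node_state I L K (Bot k) = K ! k"

definition tuples :: "nat \<Rightarrow> nat \<Rightarrow> nat list set" where
  "tuples n k = {L. set L \<subseteq> {..<n} \<and> length L = k}"

lemma finite_tuples [simp]: "finite (tuples n k)"
  unfolding tuples_def by (rule finite_lists_length_eq) simp

lemma tuples_0 [simp]: "tuples n 0 = {[]}"
  by (auto simp: tuples_def)

text \<open>The last entry is split off because the rightmost middle vertex is contracted
  first.\<close>

lemma sum_tuples_snoc: "(\<Sum>L\<in>tuples n (Suc k). f L) = (\<Sum>L\<in>tuples n k. \<Sum>i<n. f (L @ [i]))"
proof -
  have "tuples n (Suc k) = (\<lambda>(L, i). L @ [i]) ` (tuples n k \<times> {..<n})"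
  proof (intro equalityI subsetI)
    fix L assume "L \<in> tuples n (Suc k)"
    then have L: "set L \<subseteq> {..<n}" "length L = Suc k" by (auto simp: tuples_def)
    then have ne: "L \<noteq> []" by auto
    then have "L = butlast L @ [last L]" by simp
    moreover have "butlast L \<in> tuples n k" "last L < n"
      using L ne by (auto simp: tuples_def dest: in_set_butlastD) (meson last_in_set lessThan_iff subsetD)
    ultimately show "L \<in> (\<lambda>(L, i). L @ [i]) ` (tuples n k \<times> {..<n})"
      by (metis (no_types, lifting) SigmaI case_prod_conv imageI lessThan_iff)
  qed (auto simp: tuples_def)
  moreover have "inj_on (\<lambda>(L, i). L @ [i]) (tuples n k \<times> {..<n})"
    by (auto simp: inj_on_def)
  ultimately show ?thesis
    by (simp add: sum.reindex sum.cartesian_product case_prod_unfold)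
qed

section \<open>Partially contracted glued graphs\<close>

definition node_sources :: "word \<Rightarrow> word \<Rightarrow> nat \<Rightarrow> node set" where
  "node_sources u w t = outer_node ` sources u w \<union> Mid ` {..<t}"

definition node_targets :: "word \<Rightarrow> word \<Rightarrow> nat \<Rightarrow> node set" where
  "node_targets u w t = outer_node ` targets u w \<union> Mid ` {..<t}"

text \<open>The graph left when only the middle vertices below \<open>t\<close> have not been contracted.\<close>

definition glued :: "word \<Rightarrow> word \<Rightarrow> word \<Rightarrow> nat \<Rightarrow> (node \<times> node) set \<Rightarrow> bool" where
  "glued u v w t G \<longleftrightarrow>
     t \<le> length v \<and> single_valued G \<and> single_valued (G\<inverse>) \<and>
     Domain G = node_sources u w t \<and> Range G = node_targets u w t \<and>
     (\<forall>(a, b)\<in>G. \<forall>(a', b')\<in>G. \<not> int_cross (out_port v a) (in_port v b) (out_port v a') (in_port v b'))"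

text \<open>Defined by paths rather than edges, so that contraction of middle vertices does not
  change it.\<close>

definition outer_diagram :: "(node \<times> node) set \<Rightarrow> diagram" where
  "outer_diagram G = {(p, q). (outer_node p, outer_node q) \<in> G\<^sup>+}"

lemma stack_eq_outer_diagram: "stack D E = outer_diagram (glue D E)"
  by (simp add: stack_def outer_diagram_def)

text \<open>No end lies between \<open>k\<close> and \<open>l\<close>, so these two are on the same
  side of the arc from \<open>p\<close> to \<open>q\<close>. If that arc separated \<open>a\<close>
  from \<open>b\<close>, it would separate \<open>a\<close> from \<open>k\<close> or
  \<open>l\<close> from \<open>b\<close>.\<close>

lemma int_cross_merge:
  assumes "k < l" "a < k \<or> l < a" "b < k \<or> l < b" "p < k \<or> l < p" "q < k \<or> l < q"
    and "\<not> int_cross a k p q" "\<not> int_cross l b p q" "\<not> int_cross a k l b"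
  shows "\<not> int_cross a b p q"
  using assms unfolding int_cross_def min_def max_def by (smt (z3))

lemma int_cross_commute: "int_cross a b c d = int_cross c d a b" "int_cross a b c d = int_cross b a c d"
  "int_cross a b c d = int_cross a b d c"
  unfolding int_cross_def by (auto simp: min.commute max.commute)

text \<open>The summand 1 is the sign of the step from \<open>k\<close> up to \<open>l\<close>. If
  \<open>a\<close> and \<open>b\<close> lie on the same side of this gap, the two arcs are nested,
  which forces \<open>b < a\<close>; the case \<open>b < k\<close> and \<open>l < a\<close> is a
  crossing.\<close>

lemma sgn_merge:
  fixes a b k l :: int
  assumes "k < l" "a < k \<or> l < a" "b < k \<or> l < b" "a \<noteq> b" "\<not> int_cross a k l b"
  shows "sgn (k - a) + sgn (b - l) = sgn (b - a) + 1"
  using assms unfolding int_cross_def min_def max_def sgn_if by (smt (z3))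

lemma outer_node_inject [simp]: "outer_node p = outer_node q \<longleftrightarrow> p = q"
  by (cases p; cases q) auto

lemma outer_node_neq_Mid [simp]: "outer_node p \<noteq> Mid j" "Mid j \<noteq> outer_node p"
  by (cases p; simp)+

lemma finite_glued: assumes "glued u v w t G" shows "finite G"
proof (rule finite_subset)
  show "G \<subseteq> node_sources u w t \<times> node_targets u w t"
    using assms by (auto simp: glued_def)
  show "finite (node_sources u w t \<times> node_targets u w t)"
    by (simp add: node_sources_def node_targets_def)
qed

lemma ports_outer: "out_port v (outer_node p) = pos p + (if pos p < 0 then 0 else 2 * int (length v))"
  "in_port v (outer_node p) = pos p + (if pos p < 0 then 0 else 2 * int (length v))"
  by (cases p; simp)+

lemma levels_outer: "out_level v (outer_node p) = level p" "in_level v (outer_node p) = level p"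
  by (cases p; simp)+

lemma pos_inject [simp]: "pos p = pos q \<longleftrightarrow> p = q"
  by (cases p; cases q) auto

lemma node_rot_outer: "node_rot v (outer_node p) (outer_node q) = rot p q"
  unfolding node_rot_def rot_def ports_outer levels_outer by (auto simp: sgn_if)

text \<open>Without middle vertices no edge ends where another one starts, so the graph is
  transitively closed and already a diagram.\<close>

lemma glued_0:
  assumes "glued u v w 0 G"
  shows "outer_diagram G \<in> kauffman u w"
    and "G = map_prod outer_node outer_node ` outer_diagram G"
    and "cycles G = {}"
proof -
  have dis: "Domain G \<inter> Range G = {}"
    using assms sources_targets_disjoint[of u w]
    by (auto simp: glued_def node_sources_def node_targets_def simp del: Domain_iff Range_iff)
  have tr: "G\<^sup>+ = G"
  proof (intro equalityI subsetI)
    fix e assume "e \<in> G\<^sup>+"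
    moreover obtain a b where "e = (a, b)" by force
    ultimately have "(a, b) \<in> G\<^sup>+" by simp
    then have "(a, b) \<in> G"
      by (induction rule: trancl_induct) (use dis in blast)+
    then show "e \<in> G" using \<open>e = (a, b)\<close> by simp
  qed auto
  then show "cycles G = {}" using dis by (auto simp: cycles_def)
  have od: "outer_diagram G = {(p, q). (outer_node p, outer_node q) \<in> G}"
    by (simp add: outer_diagram_def tr)
  have sub: "Domain G = outer_node ` sources u w" "Range G = outer_node ` targets u w"
    using assms by (auto simp: glued_def node_sources_def node_targets_def simp del: Domain_iff Range_iff)
  show "G = map_prod outer_node outer_node ` outer_diagram G"
  proof (intro equalityI subsetI)
    fix e assume "e \<in> G"
    moreover obtain a b where e: "e = (a, b)" by force
    ultimately have "a \<in> outer_node ` sources u w" "b \<in> outer_node ` targets u w"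
      using sub by (metis DomainI RangeI)+
    then show "e \<in> map_prod outer_node outer_node ` outer_diagram G"
      using \<open>e \<in> G\<close> e unfolding od by auto
  qed (auto simp: od)
  have D: "Domain (outer_diagram G) = sources u w"
  proof (intro equalityI subsetI)
    fix p assume "p \<in> Domain (outer_diagram G)"
    then have "outer_node p \<in> Domain G" unfolding od by blast
    then show "p \<in> sources u w" unfolding sub by auto
  next
    fix p assume p: "p \<in> sources u w"
    then have "outer_node p \<in> Domain G" unfolding sub by blast
    then obtain b where b: "(outer_node p, b) \<in> G" by blast
    then have "b \<in> Range G" by blast
    then show "p \<in> Domain (outer_diagram G)" using b unfolding sub od by auto
  qed
  have R: "Range (outer_diagram G) = targets u w"
  proof (intro equalityI subsetI)
    fix p assume "p \<in> Range (outer_diagram G)"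
    then have "outer_node p \<in> Range G" unfolding od by blast
    then show "p \<in> targets u w" unfolding sub by auto
  next
    fix p assume p: "p \<in> targets u w"
    then have "outer_node p \<in> Range G" unfolding sub by blast
    then obtain b where b: "(b, outer_node p) \<in> G" by blast
    then have "b \<in> Domain G" by blast
    then show "p \<in> Range (outer_diagram G)" using b unfolding sub od by auto
  qed
  have sv: "single_valued (outer_diagram G)" "single_valued ((outer_diagram G)\<inverse>)"
    using assms outer_node_inject unfolding od glued_def single_valued_def converse_iff mem_Collect_eq case_prod_conv
    by blast+
  have "\<not> crosses (p, q) (p', q')" if "(p, q) \<in> outer_diagram G" "(p', q') \<in> outer_diagram G" for p q p' q'
  proof -
    have "\<not> int_cross (out_port v (outer_node p)) (in_port v (outer_node q))
        (out_port v (outer_node p')) (in_port v (outer_node q'))"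
      using assms that unfolding glued_def od by blast
    \<comment> \<open>\<open>f\<close> opens the gap that the places of the middle vertices occupied
      on the line; a strictly monotone map preserves crossings.\<close>
    moreover define f where "f x = (x::int) + (if x < 0 then 0 else 2 * int (length v))" for x
    have f: "mono f" "strict_mono f" by (auto simp: f_def mono_def strict_mono_def)
    ultimately show ?thesis
      unfolding ports_outer crosses_iff_int_cross f_def[symmetric] int_cross_def fst_conv snd_conv
        min_of_mono[OF f(1)] max_of_mono[OF f(1)] strict_mono_less[OF f(2)] by blast
  qed
  then show "outer_diagram G \<in> kauffman u w"
    using D R sv unfolding kauffman_iff by fast
qed

text \<open>The pairs of places of the middle vertices are nested, the rightmost vertex being
  innermost. Between the two places of \<open>Mid t\<close> lie only those of vertices to its right,
  which have been contracted.\<close>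

lemma ports_bound:
  assumes "t < length v"
  shows "a \<in> node_sources u w t \<Longrightarrow> out_port v a < int t \<or> 2 * int (length v) - 1 - int t < out_port v a"
    and "a \<in> node_targets u w t \<Longrightarrow> in_port v a < int t \<or> 2 * int (length v) - 1 - int t < in_port v a"
  using assms by (auto simp: node_sources_def node_targets_def sources_def targets_def split: if_splits)

lemma ports_neq:
  assumes "t \<le> length v" "a \<in> node_sources u w t" "b \<in> node_targets u w t"
  shows "out_port v a \<noteq> in_port v b"
  using assms by (auto simp: node_sources_def node_targets_def sources_def targets_def split: if_splits)

lemma glued_noncrossing:
  assumes "glued u v w t G" "(a, b) \<in> G" "(a', b') \<in> G"
  shows "\<not> int_cross (out_port v a) (in_port v b) (out_port v a') (in_port v b')"
  using assms by (auto simp: glued_def)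

lemma glued_ends:
  assumes "glued u v w t G" "(a, b) \<in> G"
  shows "a \<in> node_sources u w t" "b \<in> node_targets u w t"
  using assms by (auto simp: glued_def)

lemma node_sources_Suc: "a \<in> node_sources u w t \<longleftrightarrow> a \<in> node_sources u w (Suc t) \<and> a \<noteq> Mid t"
  and node_targets_Suc: "a \<in> node_targets u w t \<longleftrightarrow> a \<in> node_targets u w (Suc t) \<and> a \<noteq> Mid t"
  by (auto simp: node_sources_def node_targets_def lessThan_Suc)

text \<open>The difference of \<open>in_level\<close> and \<open>out_level\<close> at
  \<open>Mid t\<close> cancels the extra unit of \<open>sgn_merge\<close>.\<close>

lemma glued_merge:
  assumes G: "glued u v w (Suc t) G" and a: "(a, Mid t) \<in> G" "a \<noteq> Mid t" and b: "(Mid t, b) \<in> G" "b \<noteq> Mid t"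
  shows "node_rot v a (Mid t) + node_rot v (Mid t) b = node_rot v a b"
    and "(p, q) \<in> G \<Longrightarrow> p \<noteq> Mid t \<Longrightarrow> q \<noteq> Mid t \<Longrightarrow>
      \<not> int_cross (out_port v a) (in_port v b) (out_port v p) (in_port v q)"
proof -
  have t: "t < length v" using G by (simp add: glued_def)
  let ?k = "int t" and ?l = "2 * int (length v) - 1 - int t"
  have kl: "?k < ?l" using t by simp
  have as: "a \<in> node_sources u w t" and bt: "b \<in> node_targets u w t"
    using glued_ends[OF G] a b node_sources_Suc node_targets_Suc by blast+
  note oa = ports_bound(1)[OF t as] and ob = ports_bound(2)[OF t bt]
  have ab: "out_port v a \<noteq> in_port v b" using ports_neq[OF _ as bt] t by simp
  have nc: "\<not> int_cross (out_port v a) (in_port v (Mid t)) (out_port v (Mid t)) (in_port v b)"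
    by (rule glued_noncrossing[OF G a(1) b(1)])
  show "node_rot v a (Mid t) + node_rot v (Mid t) b = node_rot v a b"
  proof (cases "v ! t = LX")
    case True
    with nc have "\<not> int_cross (out_port v a) ?k ?l (in_port v b)" by simp
    from sgn_merge[OF kl oa ob ab this] show ?thesis using True by (simp add: node_rot_def)
  next
    case False
    \<comment> \<open>For the letter X* the places of arrival and departure are interchanged, so the
      merging lemmas are applied to the reversed arc.\<close>
    with nc have "\<not> int_cross (in_port v b) ?k ?l (out_port v a)" using int_cross_commute by auto
    from sgn_merge[OF kl ob oa ab[symmetric] this] show ?thesis using False
      by (simp add: node_rot_def sgn_if split: if_splits)
  qed
  assume pq: "(p, q) \<in> G" "p \<noteq> Mid t" "q \<noteq> Mid t"
  then have p: "p \<in> node_sources u w t" and q: "q \<in> node_targets u w t"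
    using glued_ends[OF G] node_sources_Suc node_targets_Suc by blast+
  note op = ports_bound(1)[OF t p] and oq = ports_bound(2)[OF t q]
  note n1 = glued_noncrossing[OF G a(1) pq(1)] and n2 = glued_noncrossing[OF G b(1) pq(1)]
  show "\<not> int_cross (out_port v a) (in_port v b) (out_port v p) (in_port v q)"
  proof (cases "v ! t = LX")
    case True
    then show ?thesis using int_cross_merge[OF kl oa ob op oq] n1 n2 nc by simp
  next
    case False
    then have "\<not> int_cross (in_port v b) (out_port v a) (out_port v p) (in_port v q)"
      using int_cross_merge[OF kl ob oa op oq] n1 n2 nc int_cross_commute by auto
    then show ?thesis using int_cross_commute by auto
  qed
qed

lemma glued_contract:
  assumes G: "glued u v w (Suc t) G"
  shows "glued u v w t (contract (Mid t) G)"
proof -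
  let ?x = "Mid t" and ?C = "contract (Mid t) G"
  have sv: "single_valued G" "single_valued (G\<inverse>)" using G by (auto simp: glued_def)
  have D: "Domain G = node_sources u w (Suc t)" and R: "Range G = node_targets u w (Suc t)"
    using G by (auto simp: glued_def simp del: Domain_iff Range_iff)
  have xs: "?x \<in> Domain G" "?x \<in> Range G"
    by (simp_all add: D R node_sources_def node_targets_def del: Domain_iff Range_iff)
  have "Domain ?C = node_sources u w t"
  proof (intro equalityI subsetI)
    fix a assume "a \<in> Domain ?C"
    then have "a \<noteq> ?x" "a \<in> Domain G" by (auto simp: contract_def)
    then show "a \<in> node_sources u w t" using D node_sources_Suc by blast
  next
    fix a assume "a \<in> node_sources u w t"
    then have a: "a \<in> Domain G" "a \<noteq> ?x" using D node_sources_Suc by blast+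
    then obtain b where b: "(a, b) \<in> G" by blast
    show "a \<in> Domain ?C"
    proof (cases "b = ?x")
      case True
      obtain b' where b': "(?x, b') \<in> G" using xs by blast
      \<comment> \<open>A loop at the contracted vertex would give it a second predecessor besides
        \<open>a\<close>.\<close>
      then have "b' \<noteq> ?x" using sv(2) b True a by (auto simp: single_valued_def)
      then show ?thesis using b b' a True by (auto simp: contract_def)
    qed (use a b in \<open>auto simp: contract_def\<close>)
  qed
  moreover have "Range ?C = node_targets u w t"
  proof (intro equalityI subsetI)
    fix a assume "a \<in> Range ?C"
    then have "a \<noteq> ?x" "a \<in> Range G" by (auto simp: contract_def)
    then show "a \<in> node_targets u w t" using R node_targets_Suc by blast
  next
    fix a assume "a \<in> node_targets u w t"
    then have a: "a \<in> Range G" "a \<noteq> ?x" using R node_targets_Suc by blast+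
    then obtain b where b: "(b, a) \<in> G" by blast
    show "a \<in> Range ?C"
    proof (cases "b = ?x")
      case True
      obtain b' where b': "(b', ?x) \<in> G" using xs by blast
      then have "b' \<noteq> ?x" using sv(1) b True a by (auto simp: single_valued_def)
      then show ?thesis using b b' a True by (auto simp: contract_def)
    qed (use a b in \<open>auto simp: contract_def\<close>)
  qed
  moreover have "single_valued ?C" "single_valued (?C\<inverse>)"
    using sv by (simp_all add: single_valued_contract converse_contract)
  moreover have "\<not> int_cross (out_port v a) (in_port v b) (out_port v p) (in_port v q)"
    if ab: "(a, b) \<in> ?C" and pq: "(p, q) \<in> ?C" for a b p q
  proof (cases "(a, b) \<in> G")
    case True
    show ?thesis
    proof (cases "(p, q) \<in> G")
      case True
      then show ?thesis using \<open>(a, b) \<in> G\<close> glued_noncrossing[OF G] by blast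
    next
      case False
      then have "(p, ?x) \<in> G" "p \<noteq> ?x" "(?x, q) \<in> G" "q \<noteq> ?x" "a \<noteq> ?x" "b \<noteq> ?x"
        using ab pq by (auto simp: contract_def)
      then show ?thesis
        using glued_merge(2)[OF G, of p q a b] \<open>(a, b) \<in> G\<close> int_cross_commute(1) by blast
    qed
  next
    case False
    then have 1: "(a, ?x) \<in> G" "a \<noteq> ?x" "(?x, b) \<in> G" "b \<noteq> ?x" "p \<noteq> ?x" "q \<noteq> ?x"
      using ab pq by (auto simp: contract_def)
    show ?thesis
    proof (cases "(p, q) \<in> G")
      case True
      then show ?thesis using 1 glued_merge(2)[OF G] by blast
    next
      case False
      then have "(p, ?x) \<in> G" "(?x, q) \<in> G" using pq by (auto simp: contract_def)
      \<comment> \<open>Only one edge is new, and an edge does not cross itself.\<close>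
      then have "p = a" "q = b" using 1 sv by (auto simp: single_valued_def)
      then show ?thesis by (simp add: int_cross_def)
    qed
  qed
  ultimately show ?thesis using G unfolding glued_def by auto
qed

lemma outer_diagram_contract: "outer_diagram (contract (Mid t) G) = outer_diagram G"
  by (simp add: outer_diagram_def trancl_contract)

lemma node_weight_cong:
  assumes "\<And>a b. (a, b) \<in> G \<Longrightarrow> s a = s' a \<and> s b = s' b"
  shows "node_weight c v G s = node_weight c v G s'"
  unfolding node_weight_def by (rule prod.cong) (use assms in auto)

text \<open>Only the state \<open>k = i\<close> contributes. Integer exponents of opposite signs add
  up only for a nonzero base, whence the condition on \<open>c i\<close>.\<close>

lemma arc_merge:
  assumes "c i \<noteq> 0 \<or> i \<noteq> j" "i < n"
  shows "(\<Sum>k<n. arc c r i k * arc c r' k j) = arc c (r + r') i j"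
proof -
  have "(\<Sum>k<n. arc c r i k * arc c r' k j) = (\<Sum>k<n. if k = i then arc c r i i * arc c r' i j else 0)"
    by (rule sum.cong) (auto simp: arc_def)
  also have "\<dots> = arc c (r + r') i j"
    using assms by (auto simp: arc_def power_int_add)
  finally show ?thesis .
qed

text \<open>Summation over the state of the contracted vertex either merges its two arcs by
  \<open>arc_merge\<close> or, if it carries a loop, evaluates that loop.\<close>

lemma sum_node_weight:
  assumes G: "glued u v w (Suc t) G"
    and c: "\<And>k. k < n \<Longrightarrow> c k \<noteq> 0" "(\<Sum>k<n. c k powi 2) = \<delta>" "(\<Sum>k<n. c k powi (- 2)) = \<delta>"
    and s: "\<And>a. a \<in> node_sources u w t \<Longrightarrow> s a < n"
  shows "(\<Sum>k<n. node_weight c v G (s(Mid t := k))) =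
    (if (Mid t, Mid t) \<in> G then \<delta> else 1) * node_weight c v (contract (Mid t) G) s"
proof -
  let ?x = "Mid t"
  define H where "H = {(a, b) \<in> G. a \<noteq> ?x \<and> b \<noteq> ?x}"
  have finG: "finite G" by (rule finite_glued[OF G])
  then have finH: "finite H" by (rule rev_finite_subset) (auto simp: H_def)
  have sv: "single_valued G" "single_valued (G\<inverse>)" and t: "t < length v"
    using G by (auto simp: glued_def)
  have H: "node_weight c v H (s(?x := k)) = node_weight c v H s" for k
    by (rule node_weight_cong) (auto simp: H_def)
  show ?thesis
  proof (cases "(?x, ?x) \<in> G")
    case True
    then have G': "G = insert (?x, ?x) H" and C: "contract ?x G = H"
      using sv by (auto simp: H_def single_valued_def contract_def)
    have "(?x, ?x) \<notin> H" by (simp add: H_def)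
    then have W: "node_weight c v G (s(?x := k)) = c k powi node_rot v ?x ?x * node_weight c v H s" for k
      unfolding G' H[symmetric, of k] by (simp add: node_weight_def finH arc_def)
    \<comment> \<open>The sign of the arc and the change of level agree, so the loop makes a full
      turn, in a direction given by the letter. Both directions yield the same sum.\<close>
    have "node_rot v ?x ?x = 2 \<or> node_rot v ?x ?x = - 2"
      using t by (auto simp: node_rot_def sgn_if)
    then have "(\<Sum>k<n. c k powi node_rot v ?x ?x) = \<delta>" using c by auto
    then show ?thesis using True by (simp add: W C flip: sum_distrib_right)
  next
    case False
    have "?x \<in> Domain G" "?x \<in> Range G"
      using G by (auto simp: glued_def node_sources_def node_targets_def simp del: Domain_iff Range_iff)
    then obtain a b where ab: "(a, ?x) \<in> G" "(?x, b) \<in> G" by blast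
    then have ne: "a \<noteq> ?x" "b \<noteq> ?x" using False by auto
    have ua: "(p, ?x) \<in> G \<longleftrightarrow> p = a" for p using ab sv by (auto simp: single_valued_def)
    have ub: "(?x, p) \<in> G \<longleftrightarrow> p = b" for p using ab sv by (auto simp: single_valued_def)
    have G': "G = insert (a, ?x) (insert (?x, b) H)"
    proof (rule Set.set_eqI, clarify)
      fix p q show "(p, q) \<in> G \<longleftrightarrow> (p, q) \<in> insert (a, ?x) (insert (?x, b) H)"
        using ne by (cases "p = ?x"; cases "q = ?x") (auto simp: ua ub H_def)
    qed
    have C: "contract ?x G = insert (a, b) H"
      using ne unfolding contract_def H_def by (auto simp: ua ub)
    have nH: "(a, ?x) \<notin> insert (?x, b) H" "(?x, b) \<notin> H" using ne by (auto simp: H_def)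
    have nH': "(a, b) \<notin> H" using ab sv ne by (auto simp: H_def single_valued_def)
    have W: "node_weight c v G (s(?x := k)) =
        (arc c (node_rot v a ?x) (s a) k * arc c (node_rot v ?x b) k (s b)) * node_weight c v H s" for k
      unfolding G' H[symmetric, of k] using nH ne finH by (simp add: node_weight_def)
    have "a \<in> node_sources u w t" using glued_ends[OF G ab(1)] ne node_sources_Suc by blast
    then have "s a < n" by (rule s)
    then have "(\<Sum>k<n. arc c (node_rot v a ?x) (s a) k * arc c (node_rot v ?x b) k (s b)) =
        arc c (node_rot v a b) (s a) (s b)"
      using c(1) arc_merge[of c "s a"] glued_merge(1)[OF G ab(1) ne(1) ab(2) ne(2)] by metis
    moreover have "node_weight c v (contract ?x G) s = arc c (node_rot v a b) (s a) (s b) * node_weight c v H s"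
      unfolding C using nH' finH by (simp add: node_weight_def)
    ultimately show ?thesis using False by (simp add: W flip: sum_distrib_right)
  qed
qed

text \<open>Induction on the number of middle vertices that are left:
  \<open>card_cycles_contract\<close> counts a loop exactly when \<open>sum_node_weight\<close>
  yields a factor \<open>\<delta>\<close>.\<close>

lemma sum_glued:
  assumes c: "\<And>k. k < n \<Longrightarrow> c k \<noteq> 0" "(\<Sum>k<n. c k powi 2) = \<delta>" "(\<Sum>k<n. c k powi (- 2)) = \<delta>"
    and I: "I \<in> tuples n (length u)" and K: "K \<in> tuples n (length w)"
    and G: "glued u v w t G"
  shows "(\<Sum>L\<in>tuples n t. node_weight c v G (node_state I L K)) =
    \<delta> ^ card (cycles G) * weight c (outer_diagram G) (vertex_state I K)"
  using G
proof (induction t arbitrary: G)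
  case 0
  note g = glued_0[OF 0]
  have "node_weight c v G (node_state I [] K) =
      (\<Prod>(a, b)\<in>map_prod outer_node outer_node ` outer_diagram G.
         arc c (node_rot v a b) (node_state I [] K a) (node_state I [] K b))"
    using g(2) unfolding node_weight_def by metis
  also have "\<dots> = weight c (outer_diagram G) (vertex_state I K)"
  proof -
    have "inj_on (map_prod outer_node outer_node) (outer_diagram G)" by (auto simp: inj_on_def)
    moreover have "node_state I [] K (outer_node p) = vertex_state I K p" for p by (cases p) auto
    ultimately show ?thesis
      by (simp add: prod.reindex weight_def case_prod_unfold node_rot_outer)
  qed
  finally show ?case using g(3) by simp
next
  case (Suc t)
  let ?x = "Mid t"
  note C = glued_contract[OF Suc.prems]
  have sv: "single_valued G" "single_valued (G\<inverse>)" using Suc.prems by (auto simp: glued_def)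
  have eq: "(\<Sum>k<n. node_weight c v G (node_state I (L @ [k]) K)) =
      (if (?x, ?x) \<in> G then \<delta> else 1) * node_weight c v (contract ?x G) (node_state I L K)"
    if L: "L \<in> tuples n t" for L
  proof -
    have lenL: "length L = t" using L by (simp add: tuples_def)
    have "node_state I L K a < n" if a: "a \<in> node_sources u w t" for a
    proof -
      have "I ! i < n" if "i < length u" for i
        using I that by (auto simp: tuples_def) (metis nth_mem lessThan_iff subsetD)
      moreover have "K ! i < n" if "i < length w" for i
        using K that by (auto simp: tuples_def) (metis nth_mem lessThan_iff subsetD)
      moreover have "L ! i < n" if "i < t" for i
        using L that by (auto simp: tuples_def) (metis nth_mem lessThan_iff subsetD)
      ultimately show ?thesis using a by (auto simp: node_sources_def sources_def)
    qed
    note S = sum_node_weight[OF Suc.prems c this]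
    have "node_weight c v G (node_state I (L @ [k]) K) = node_weight c v G ((node_state I L K)(?x := k))" for k
    proof (rule node_weight_cong)
      fix a b assume ab: "(a, b) \<in> G"
      have *: "node_state I (L @ [k]) K p = ((node_state I L K)(?x := k)) p"
        if "p \<in> node_sources u w (Suc t) \<union> node_targets u w (Suc t)" for p
      proof (cases p)
        case (Mid j)
        with that have "j < Suc t" by (auto simp: node_sources_def node_targets_def)
        then show ?thesis using Mid lenL by (auto simp: nth_append less_Suc_eq)
      qed auto
      show "node_state I (L @ [k]) K a = ((node_state I L K)(?x := k)) a \<and>
          node_state I (L @ [k]) K b = ((node_state I L K)(?x := k)) b"
        using * glued_ends[OF Suc.prems ab] by blast
    qed
    then show ?thesis using S by simp
  qed
  have "(\<Sum>L\<in>tuples n (Suc t). node_weight c v G (node_state I L K)) =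
      (if (?x, ?x) \<in> G then \<delta> else 1) * (\<Sum>L\<in>tuples n t. node_weight c v (contract ?x G) (node_state I L K))"
    unfolding sum_tuples_snoc by (simp add: eq sum_distrib_left)
  then show ?case
    unfolding Suc.IH[OF C] outer_diagram_contract card_cycles_contract[OF sv finite_glued[OF Suc.prems], of ?x]
    by simp
qed

lemma outer_diagram_glued: "glued u v w t G \<Longrightarrow> outer_diagram G \<in> kauffman u w"
proof (induction t arbitrary: G)
  case 0
  then show ?case by (rule glued_0(1))
next
  case (Suc t)
  from Suc.IH[OF glued_contract[OF Suc.prems]] show ?case by (simp add: outer_diagram_contract)
qed

section \<open>The glued graph of two composable diagrams\<close>

lemma upper_node_inject [simp]: "upper_node p = upper_node q \<longleftrightarrow> p = q"
  and lower_node_inject [simp]: "lower_node p = lower_node q \<longleftrightarrow> p = q"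
  by (cases p; cases q; simp)+

lemma ports_upper:
  "p \<in> sources u v \<Longrightarrow> out_port v (upper_node p) = pos p \<and> out_level v (upper_node p) = level p"
  "q \<in> targets u v \<Longrightarrow> in_port v (upper_node q) = pos q \<and> in_level v (upper_node q) = level q"
  by (auto simp: sources_def targets_def)

lemma ports_lower:
  "p \<in> sources v w \<Longrightarrow>
    out_port v (lower_node p) = 2 * int (length v) + pos p \<and> out_level v (lower_node p) = level p"
  "q \<in> targets v w \<Longrightarrow>
    in_port v (lower_node q) = 2 * int (length v) + pos q \<and> in_level v (lower_node q) = level q"
  by (auto simp: sources_def targets_def)

lemma upper_lower_distinct:
  "p \<in> sources u v \<Longrightarrow> q \<in> sources v w \<Longrightarrow> upper_node p \<noteq> lower_node q"
  "p \<in> targets u v \<Longrightarrow> q \<in> targets v w \<Longrightarrow> upper_node p \<noteq> lower_node q"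
  by (auto simp: sources_def targets_def)

lemma pos_less: "p \<in> sources u v \<union> targets u v \<Longrightarrow> pos p < int (length v)"
  and pos_ge: "p \<in> sources u v \<union> targets u v \<Longrightarrow> - int (length u) \<le> pos p"
  by (auto simp: sources_def targets_def)

lemma Domain_map_prod: "Domain (map_prod f g ` A) = f ` Domain A"
  and Range_map_prod: "Range (map_prod f g ` A) = g ` Range A"
  by force+

text \<open>The upper diagram occupies places below \<open>length v\<close>; the lower one,
  translated by \<open>2 * length v\<close>, occupies places from \<open>length v\<close> on. Hence
  strings of different diagrams do not cross.\<close>

lemma glued_glue:
  assumes D: "D \<in> kauffman u v" and E: "E \<in> kauffman v w"
  shows "glued u v w (length v) (glue D E)"
proof -
  have sv: "single_valued D" "single_valued (D\<inverse>)" "single_valued E" "single_valued (E\<inverse>)"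
    and dom: "Domain D = sources u v" "Range D = targets u v" "Domain E = sources v w" "Range E = targets v w"
    using D E by (auto simp: kauffman_iff simp del: Domain_iff Range_iff)
  note endsD = kauffman_source_target[OF D] and endsE = kauffman_source_target[OF E]
  \<comment> \<open>A middle vertex starts a string of the lower diagram if its letter is X and of
    the upper diagram otherwise; for ends it is the other way round.\<close>
  have split: "{..<length v} = {i. i < length v \<and> v ! i = LX} \<union> {i. i < length v \<and> v ! i = LXstar}"
    by (auto dest: letter_neq_iff(1)[THEN iffD1])
  have "single_valued (glue D E)"
    using upper_lower_distinct(1)[of _ u v _ w] endsD endsE sv unfolding single_valued_def glue_def
    by (fastforce simp: image_iff)
  moreover have "single_valued ((glue D E)\<inverse>)"
    using upper_lower_distinct(2)[of _ u v _ w] endsD endsE sv unfolding single_valued_def glue_def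
    by (fastforce simp: image_iff)
  moreover have "Domain (glue D E) = node_sources u w (length v)"
  proof -
    have "Domain (glue D E) = upper_node ` sources u v \<union> lower_node ` sources v w"
      by (simp add: glue_def Domain_Un_eq Domain_map_prod dom del: Domain_iff)
    also have "\<dots> = node_sources u w (length v)"
      by (simp add: split sources_def node_sources_def image_Un image_image Un_ac)
    finally show ?thesis .
  qed
  moreover have "Range (glue D E) = node_targets u w (length v)"
  proof -
    have "Range (glue D E) = upper_node ` targets u v \<union> lower_node ` targets v w"
      by (simp add: glue_def Range_Un_eq Range_map_prod dom del: Range_iff)
    also have "\<dots> = node_targets u w (length v)"
      by (simp add: split targets_def node_targets_def image_Un image_image Un_ac)
    finally show ?thesis .
  qed
  moreover have "\<not> int_cross (out_port v a) (in_port v b) (out_port v a') (in_port v b')"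
    if "(a, b) \<in> glue D E" "(a', b') \<in> glue D E" for a b a' b'
  proof -
    have ncD: "\<not> int_cross (pos p) (pos q) (pos p') (pos q')" if "(p, q) \<in> D" "(p', q') \<in> D" for p q p' q'
      using D that unfolding kauffman_iff crosses_iff_int_cross by fastforce
    have ncE: "\<not> int_cross (2 * int (length v) + pos p) (2 * int (length v) + pos q)
        (2 * int (length v) + pos p') (2 * int (length v) + pos q')" if "(p, q) \<in> E" "(p', q') \<in> E" for p q p' q'
    proof -
      have "\<not> int_cross (pos p) (pos q) (pos p') (pos q')"
        using E that unfolding kauffman_iff crosses_iff_int_cross by fastforce
      then show ?thesis unfolding int_cross_def by linarith
    qed
    have ncDE: "\<not> int_cross (pos p) (pos q) (2 * int (length v) + pos p') (2 * int (length v) + pos q')"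
      if "(p, q) \<in> D" "(p', q') \<in> E" for p q p' q'
      using pos_less[of p u v] pos_less[of q u v] pos_ge[of p' v w] pos_ge[of q' v w] endsD[OF that(1)] endsE[OF that(2)]
      unfolding int_cross_def by auto
    have D_edge: "out_port v (upper_node p) = pos p" "in_port v (upper_node q) = pos q" if "(p, q) \<in> D" for p q
      using ports_upper endsD[OF that] by blast+
    have E_edge: "out_port v (lower_node p) = 2 * int (length v) + pos p"
        "in_port v (lower_node q) = 2 * int (length v) + pos q" if "(p, q) \<in> E" for p q
      using ports_lower endsE[OF that] by blast+
    from that show ?thesis
      unfolding glue_def using ncD ncE ncDE int_cross_commute(1) by (auto simp: D_edge E_edge)
  qed
  ultimately show ?thesis unfolding glued_def by auto
qed

lemma stack_kauffman:
  assumes "D \<in> kauffman u v" "E \<in> kauffman v w"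
  shows "stack D E \<in> kauffman u w"
  unfolding stack_eq_outer_diagram by (rule outer_diagram_glued[OF glued_glue[OF assms]])

text \<open>The lower diagram is only translated along the line, so each string keeps its
  rotation.\<close>

lemma node_weight_glue:
  assumes D: "D \<in> kauffman u v" and E: "E \<in> kauffman v w"
  shows "node_weight c v (glue D E) (node_state I L K) =
    weight c D (vertex_state I L) * weight c E (vertex_state L K)"
proof -
  note endsD = kauffman_source_target[OF D] and endsE = kauffman_source_target[OF E]
  let ?f = "\<lambda>(a, b). arc c (node_rot v a b) (node_state I L K a) (node_state I L K b)"
  have rotD: "node_rot v (upper_node p) (upper_node q) = rot p q" if "(p, q) \<in> D" for p q
    using ports_upper endsD[OF that] by (simp add: node_rot_def rot_def)
  have rotE: "node_rot v (lower_node p) (lower_node q) = rot p q" if "(p, q) \<in> E" for p q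
    using ports_lower endsE[OF that] by (simp add: node_rot_def rot_def)
  have disj: "map_prod upper_node upper_node ` D \<inter> map_prod lower_node lower_node ` E = {}"
    using upper_lower_distinct(1)[of _ u v _ w] endsD endsE by fastforce
  have "node_weight c v (glue D E) (node_state I L K) =
      prod ?f (map_prod upper_node upper_node ` D) * prod ?f (map_prod lower_node lower_node ` E)"
    unfolding node_weight_def glue_def
    by (rule prod.union_disjoint) (use disj finite_diagram[OF D] finite_diagram[OF E] in auto)
  also have "prod ?f (map_prod upper_node upper_node ` D) = weight c D (vertex_state I L)"
  proof -
    have "inj_on (map_prod upper_node upper_node) D" by (auto simp: inj_on_def)
    moreover have "node_state I L K (upper_node p) = vertex_state I L p" for p by (cases p) auto
    ultimately show ?thesis
      unfolding weight_def by (auto simp: prod.reindex rotD intro!: prod.cong)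
  qed
  also have "prod ?f (map_prod lower_node lower_node ` E) = weight c E (vertex_state L K)"
  proof -
    have "inj_on (map_prod lower_node lower_node) E" by (auto simp: inj_on_def)
    moreover have "node_state I L K (lower_node p) = vertex_state L K p" for p by (cases p) auto
    ultimately show ?thesis
      unfolding weight_def by (auto simp: prod.reindex rotE intro!: prod.cong)
  qed
  finally show ?thesis .
qed

text \<open>Functoriality of the state sum in matrix form: the sum over the states of the middle
  vertices is a matrix product.\<close>

theorem sum_weight_stack:
  assumes c: "\<And>k. k < n \<Longrightarrow> c k \<noteq> 0" "(\<Sum>k<n. c k powi 2) = \<delta>" "(\<Sum>k<n. c k powi (- 2)) = \<delta>"
    and I: "I \<in> tuples n (length u)" and K: "K \<in> tuples n (length w)"
    and D: "D \<in> kauffman u v" and E: "E \<in> kauffman v w"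
  shows "(\<Sum>L\<in>tuples n (length v). weight c D (vertex_state I L) * weight c E (vertex_state L K)) =
    \<delta> ^ loops D E * weight c (stack D E) (vertex_state I K)"
  using sum_glued[OF c I K glued_glue[OF D E]]
  by (simp add: node_weight_glue[OF D E] loops_eq_card_cycles stack_eq_outer_diagram)

section \<open>Juxtaposition, identity and reflection\<close>

lemma shift_inject [simp]: "shift m n p = shift m n q \<longleftrightarrow> p = q"
  by (cases p; cases q) auto

lemma sources_append: "sources (u @ v) (u' @ v') = sources u u' \<union> shift (length u) (length u') ` sources v v'"
  (is "?L = ?R")
proof (rule Set.set_eqI)
  fix p show "p \<in> ?L \<longleftrightarrow> p \<in> ?R"
  proof (cases p)
    case (Up i)
    have "p \<in> shift (length u) (length u') ` sources v v' \<longleftrightarrow> length u \<le> i \<and> Up (i - length u) \<in> sources v v'"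
      unfolding Up by (auto simp: image_def sources_def intro!: bexI[of _ "Up (i - length u)"])
    then show ?thesis using Up by (auto simp: nth_append)
  next
    case (Lo i)
    have "p \<in> shift (length u) (length u') ` sources v v' \<longleftrightarrow> length u' \<le> i \<and> Lo (i - length u') \<in> sources v v'"
      unfolding Lo by (auto simp: image_def sources_def intro!: bexI[of _ "Lo (i - length u')"])
    then show ?thesis using Lo by (auto simp: nth_append)
  qed
qed

lemma targets_append: "targets (u @ v) (u' @ v') = targets u u' \<union> shift (length u) (length u') ` targets v v'"
  using sources_append[of "map dual u" "map dual v" "map dual u'" "map dual v'"]
  by (simp add: targets_eq_sources_dual)

lemma pos_shift: "pos (shift m n p) = pos p + (if pos p < 0 then - int m else int n)"
  by (cases p) auto

lemma level_shift [simp]: "level (shift m n p) = level p"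
  by (cases p) auto

lemma rot_shift [simp]: "rot (shift m n p) (shift m n q) = rot p q"
  unfolding rot_def pos_shift level_shift by (auto simp: sgn_if)

lemma shift_fresh:
  assumes "p \<in> sources u v \<union> targets u v"
  shows "shift (length u) (length v) q \<noteq> p"
  using assms by (cases q) (auto simp: sources_def targets_def)

lemma int_cross_mono:
  fixes f :: "int \<Rightarrow> int"
  assumes "strict_mono f"
  shows "int_cross (f a) (f b) (f c) (f e) = int_cross a b c e"
  unfolding int_cross_def
  by (simp add: strict_mono_less[OF assms] min_of_mono max_of_mono strict_mono_mono[OF assms])

text \<open>In the boundary order the shifted vertices of \<open>E\<close> lie beyond those of
  \<open>D\<close> on both sides, so a string of \<open>E\<close> either encloses all of
  \<open>D\<close> or has it entirely outside.\<close>

lemma juxtapose_kauffman: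
  assumes D: "D \<in> kauffman u u'" and E: "E \<in> kauffman v v'"
  shows "juxtapose (length u) (length u') D E \<in> kauffman (u @ v) (u' @ v')"
proof -
  let ?s = "shift (length u) (length u')"
  let ?J = "juxtapose (length u) (length u') D E"
  have sv: "single_valued D" "single_valued (D\<inverse>)" "single_valued E" "single_valued (E\<inverse>)"
    and dom: "Domain D = sources u u'" "Range D = targets u u'" "Domain E = sources v v'" "Range E = targets v v'"
    using D E by (auto simp: kauffman_iff simp del: Domain_iff Range_iff)
  note endsD = kauffman_source_target[OF D]
  have fresh: "?s x \<noteq> p" "?s x \<noteq> q" if "(p, q) \<in> D" for p q x
    using endsD[OF that] shift_fresh by blast+
  have mem: "(p, q) \<in> ?J \<longleftrightarrow> (p, q) \<in> D \<or> (\<exists>p' q'. p = ?s p' \<and> q = ?s q' \<and> (p', q') \<in> E)" for p q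
    by (auto simp: juxtapose_def)
  have "single_valued ?J"
  proof (rule single_valuedI)
    fix x y z assume "(x, y) \<in> ?J" "(x, z) \<in> ?J"
    then show "y = z" unfolding mem using sv(1,3) fresh shift_inject by (metis single_valuedD)
  qed
  moreover have "single_valued (?J\<inverse>)"
  proof (rule single_valuedI)
    fix x y z assume "(x, y) \<in> ?J\<inverse>" "(x, z) \<in> ?J\<inverse>"
    then show "y = z" unfolding converse_iff mem using sv(2,4) fresh shift_inject
      by (metis single_valuedD converse_iff)
  qed
  moreover have "Domain ?J = sources (u @ v) (u' @ v')" "Range ?J = targets (u @ v) (u' @ v')"
    by (simp_all add: juxtapose_def Domain_Un_eq Range_Un_eq Domain_map_prod Range_map_prod dom
        sources_append targets_append del: Domain_iff Range_iff)
  moreover have "\<not> crosses s t" if "s \<in> ?J" "t \<in> ?J" for s t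
  proof -
    have ncD: "\<not> int_cross (pos p) (pos q) (pos p') (pos q')" if "(p, q) \<in> D" "(p', q') \<in> D" for p q p' q'
      using D that unfolding kauffman_iff crosses_iff_int_cross by fastforce
    have ncE: "\<not> int_cross (pos (?s p)) (pos (?s q)) (pos (?s p')) (pos (?s q'))"
      if "(p, q) \<in> E" "(p', q') \<in> E" for p q p' q'
    proof -
      have "\<not> int_cross (pos p) (pos q) (pos p') (pos q')"
        using E that unfolding kauffman_iff crosses_iff_int_cross by fastforce
      \<comment> \<open>\<open>f\<close> opens a gap for \<open>D\<close> at position 0 and is
        strictly monotone.\<close>
      moreover define f where "f x = x + (if x < 0 then - int (length u) else int (length u'))" for x
      moreover have "strict_mono f" by (auto simp: f_def strict_mono_def)
      ultimately show ?thesis unfolding pos_shift f_def[symmetric] by (simp add: int_cross_mono)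
    qed
    have ncDE: "\<not> int_cross (pos p) (pos q) (pos (?s p')) (pos (?s q'))" if "(p, q) \<in> D" for p q p' q'
    proof -
      have 1: "pos p < int (length u')" "pos q < int (length u')" "- int (length u) \<le> pos p" "- int (length u) \<le> pos q"
        using pos_less[of p u u'] pos_less[of q u u'] pos_ge[of p u u'] pos_ge[of q u u'] endsD[OF that] by auto
      have 2: "pos (?s r) < - int (length u) \<or> int (length u') \<le> pos (?s r)" for r
        unfolding pos_shift by auto
      show ?thesis using 1 2[of p'] 2[of q'] unfolding int_cross_def by linarith
    qed
    obtain p q p' q' where st: "s = (p, q)" "t = (p', q')" by (metis prod.collapse)
    have "\<not> int_cross (pos p) (pos q) (pos p') (pos q')"
      using that unfolding st mem using ncD ncE ncDE int_cross_commute(1) by metis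
    then show ?thesis by (simp add: st crosses_iff_int_cross)
  qed
  ultimately show ?thesis unfolding kauffman_iff by blast
qed

lemma vertex_state_append:
  assumes "length I = m" "length J = n"
  shows "vertex_state (I @ I') (J @ J') (shift m n p) = vertex_state I' J' p"
  using assms by (cases p) auto

lemma vertex_state_append_left:
  assumes "length I = length u" "length J = length v" "p \<in> sources u v \<union> targets u v"
  shows "vertex_state (I @ I') (J @ J') p = vertex_state I J p"
  using assms by (auto simp: sources_def targets_def nth_append)

lemma weight_juxtapose:
  assumes D: "D \<in> kauffman u u'" and E: "E \<in> kauffman v v'"
    and len: "length I = length u" "length J = length u'"
  shows "weight c (juxtapose (length u) (length u') D E) (vertex_state (I @ I') (J @ J')) =
    weight c D (vertex_state I J) * weight c E (vertex_state I' J')"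
proof -
  let ?s = "shift (length u) (length u')"
  let ?f = "\<lambda>(p, q). arc c (rot p q) (vertex_state (I @ I') (J @ J') p) (vertex_state (I @ I') (J @ J') q)"
  have disj: "D \<inter> map_prod ?s ?s ` E = {}"
    using kauffman_source_target[OF D] shift_fresh by fastforce
  have "weight c (juxtapose (length u) (length u') D E) (vertex_state (I @ I') (J @ J')) =
      prod ?f D * prod ?f (map_prod ?s ?s ` E)"
    unfolding weight_def juxtapose_def
    by (rule prod.union_disjoint) (use disj finite_diagram[OF D] finite_diagram[OF E] in auto)
  also have "prod ?f D = weight c D (vertex_state I J)"
    unfolding weight_def using kauffman_source_target[OF D]
    by (intro prod.cong) (auto simp: vertex_state_append_left[OF len])
  also have "prod ?f (map_prod ?s ?s ` E) = weight c E (vertex_state I' J')"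
  proof -
    have "inj_on (map_prod ?s ?s) E" by (auto simp: inj_on_def)
    then show ?thesis
      unfolding weight_def by (auto simp: prod.reindex vertex_state_append[OF len] intro!: prod.cong)
  qed
  finally show ?thesis .
qed

section \<open>The identity diagram and reflection\<close>

lemma id_diagram_kauffman: "id_diagram w \<in> kauffman w w"
proof -
  have mem: "(p, q) \<in> id_diagram w \<longleftrightarrow>
      (\<exists>i<length w. w ! i = LX \<and> p = Up i \<and> q = Lo i \<or> w ! i = LXstar \<and> p = Lo i \<and> q = Up i)" for p q
    unfolding id_diagram_def by (auto simp: image_iff split: if_splits)
  have "Domain (id_diagram w) = sources w w"
    by (rule Set.set_eqI) (auto simp: Domain_iff mem sources_def)
  moreover have "Range (id_diagram w) = targets w w"
    by (rule Set.set_eqI) (auto simp: Range_iff mem targets_def)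
  moreover have "single_valued (id_diagram w)" "single_valued ((id_diagram w)\<inverse>)"
    by (auto simp: single_valued_def mem)
  moreover have "\<not> crosses s t" if "s \<in> id_diagram w" "t \<in> id_diagram w" for s t
    using that by (cases s; cases t) (auto simp: mem crosses_def left_end_def right_end_def)
  ultimately show ?thesis unfolding kauffman_iff by blast
qed

text \<open>A vertical string has rotation 0, because the change of level cancels the sign of the
  change of position.\<close>

lemma weight_id_diagram:
  assumes "length I = length w" "length J = length w"
  shows "weight c (id_diagram w) (vertex_state I J) = (if I = J then 1 else 0)"
proof -
  have inj: "inj_on (\<lambda>i. if w ! i = LX then (Up i, Lo i) else (Lo i, Up i)) {..<length w}"
    by (auto simp: inj_on_def split: if_splits)
  have "weight c (id_diagram w) (vertex_state I J) = (\<Prod>i<length w. if I ! i = J ! i then 1 else 0)"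
    unfolding weight_def id_diagram_def prod.reindex[OF inj]
    by (rule prod.cong) (auto simp: arc_def rot_def)
  also have "\<dots> = (if I = J then 1 else 0)"
    using assms by (auto simp: list_eq_iff_nth_eq)
  finally show ?thesis .
qed

lemma pos_flip: "pos (flip p) = - 1 - pos p"
  by (cases p) auto

lemma level_flip: "level (flip p) = - 1 - level p"
  by (cases p) auto

text \<open>Reflection negates differences of positions and of levels, and reversing the orientation
  negates them again.\<close>

lemma rot_flip: "rot (flip q) (flip p) = rot p q"
  by (simp add: rot_def pos_flip level_flip)

lemma sources_flip: "flip ` sources u v = targets v u" and targets_flip: "flip ` targets u v = sources v u"
  by (auto simp: sources_def targets_def image_Un image_image)

lemma reflect_iff: "(p, q) \<in> reflect D \<longleftrightarrow> (flip q, flip p) \<in> D"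
proof
  assume "(flip q, flip p) \<in> D"
  then have "\<exists>p' q'. (p, q) = (flip q', flip p') \<and> (p', q') \<in> D" by (intro exI[of _ "flip q"] exI[of _ "flip p"]) simp
  then show "(p, q) \<in> reflect D" unfolding reflect_def by blast
qed (auto simp: reflect_def)

lemma reflect_eq_image: "reflect D = (\<lambda>(p, q). (flip q, flip p)) ` D"
  by (auto simp: reflect_def)

lemma reflect_kauffman:
  assumes D: "D \<in> kauffman u v" shows "reflect D \<in> kauffman v u"
proof -
  have sv: "single_valued D" "single_valued (D\<inverse>)"
    and dom: "Domain D = sources u v" "Range D = targets u v"
    using D by (auto simp: kauffman_iff simp del: Domain_iff Range_iff)
  have "single_valued (reflect D)" "single_valued ((reflect D)\<inverse>)"
    using sv unfolding single_valued_def reflect_iff converse_iff by (metis flip_flip)+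
  moreover have "Domain (reflect D) = flip ` Range D" "Range (reflect D) = flip ` Domain D"
    unfolding reflect_eq_image by force+
  moreover have "\<not> crosses s t" if st: "s \<in> reflect D" "t \<in> reflect D" for s t
  proof -
    obtain p q p' q' where e: "s = (p, q)" "t = (p', q')" by (metis prod.collapse)
    have "(flip q, flip p) \<in> D" "(flip q', flip p') \<in> D" using st unfolding e reflect_iff by auto
    then have "\<not> crosses (flip q, flip p) (flip q', flip p')" using D unfolding kauffman_iff by blast
    then show ?thesis unfolding e crosses_iff_int_cross int_cross_def fst_conv snd_conv pos_flip by linarith
  qed
  ultimately show ?thesis unfolding kauffman_iff dom sources_flip targets_flip by blast
qed

lemma vertex_state_flip: "vertex_state J I (flip p) = vertex_state I J p"
  by (cases p) auto

lemma weight_reflect: "weight c (reflect D) (vertex_state J I) = weight c D (vertex_state I J)"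
proof -
  have "inj_on (\<lambda>(p, q). (flip q, flip p)) D"
    by (auto simp: inj_on_def) (metis flip_flip)+
  then show ?thesis unfolding reflect_eq_image weight_def
    by (auto simp: prod.reindex rot_flip vertex_state_flip arc_def intro!: prod.cong)
qed

text \<open>A sign only sees the parity of the rotation. Like \<open>e\<close>, the rotation is odd
  for a string joining vertices of one edge and zero for the others, and the sum of \<open>e\<close>
  is \<open>sharp D\<close>.\<close>

lemma prod_sign_rot:
  assumes "finite D" "\<And>p. (p, p) \<notin> D" "\<sigma> = 1 \<or> \<sigma> = (- 1 :: complex)"
  shows "(\<Prod>(p, q)\<in>D. \<sigma> powi rot p q) = \<sigma> powi sharp D"
proof -
  define e :: "vertex \<times> vertex \<Rightarrow> int" where
    "e s = (if \<exists>i j. s = (Up i, Up j) then 1 else 0) - (if \<exists>i j. s = (Lo i, Lo j) then 1 else 0)" for s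
  have "\<sigma> powi rot p q = \<sigma> powi e (p, q)" if "p \<noteq> q" for p q
    using that assms(3) by (cases p; cases q) (auto simp: rot_def e_def sgn_if power_int_minus)
  then have "(\<Prod>(p, q)\<in>D. \<sigma> powi rot p q) = (\<Prod>s\<in>D. \<sigma> powi e s)"
    using assms(2) by (intro prod.cong refl) (metis (no_types, lifting) case_prod_conv surj_pair)
  also have "\<dots> = \<sigma> powi (\<Sum>s\<in>D. e s)"
    using assms(1) by (induction rule: finite_induct) (use assms(3) in \<open>auto simp: power_int_add\<close>)
  also have "(\<Sum>s\<in>D. e s) = sharp D"
    using assms(1) by (simp add: e_def sum_subtractf sharp_def sum.If_cases Int_def)
  finally show ?thesis .
qed

section \<open>The functor with a given eigenvalue list\<close>

lemma tuples_append: "tuples n (k + l) = (\<lambda>(I, J). I @ J) ` (tuples n k \<times> tuples n l)"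
proof (intro equalityI subsetI)
  fix L assume L: "L \<in> tuples n (k + l)"
  then have "take k L \<in> tuples n k" "drop k L \<in> tuples n l"
    by (auto simp: tuples_def dest: in_set_takeD in_set_dropD)
  then show "L \<in> (\<lambda>(I, J). I @ J) ` (tuples n k \<times> tuples n l)"
    by (intro image_eqI[of _ _ "(take k L, drop k L)"]) auto
qed (auto simp: tuples_def)

lemma inj_on_tuples_append: "inj_on (\<lambda>(I, J). I @ J) (tuples n k \<times> tuples n l)"
  by (auto simp: inj_on_def tuples_def)

lemma sum_tuples_append:
  "(\<Sum>L\<in>tuples n (k + l). f L) = (\<Sum>I\<in>tuples n k. \<Sum>J\<in>tuples n l. f (I @ J))"
  unfolding tuples_append sum.reindex[OF inj_on_tuples_append]
  by (simp add: sum.cartesian_product case_prod_unfold)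

lemma sum_fun_apply: "(\<Sum>i\<in>A. f i) x = (\<Sum>i\<in>A. f i x)"
  by (induction A rule: infinite_finite_induct) auto

definition fun_scale :: "complex \<Rightarrow> (nat list \<Rightarrow> complex) \<Rightarrow> nat list \<Rightarrow> complex" where
  "fun_scale a x = (\<lambda>I. a * x I)"

text \<open>All spaces live in one type, as functions on lists that vanish off
  \<open>tuples n k\<close>. Concatenation of index lists then makes the tensor product strictly
  associative.\<close>

definition tuple_space :: "nat \<Rightarrow> nat \<Rightarrow> (nat list \<Rightarrow> complex) hilb" where
  "tuple_space n k = \<lparr>scl = fun_scale, vecs = {x. \<forall>I. I \<notin> tuples n k \<longrightarrow> x I = 0},
     ip = (\<lambda>x y. \<Sum>I\<in>tuples n k. x I * cnj (y I))\<rparr>"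

definition tuple_unit :: "nat list \<Rightarrow> nat list \<Rightarrow> complex" where
  "tuple_unit I = (\<lambda>J. if J = I then 1 else 0)"

lemma tuple_space_simps [simp]:
  "scl (tuple_space n k) = fun_scale"
  "x \<in> vecs (tuple_space n k) \<longleftrightarrow> (\<forall>I. I \<notin> tuples n k \<longrightarrow> x I = 0)"
  "ip (tuple_space n k) x y = (\<Sum>I\<in>tuples n k. x I * cnj (y I))"
  by (simp_all add: tuple_space_def)

lemma vector_space_fun_scale: "vector_space fun_scale"
  by unfold_locales (auto simp: fun_scale_def algebra_simps)

interpretation fun_space: vector_space fun_scale
  by (rule vector_space_fun_scale)

lemma subspace_tuple_space: "fun_space.subspace (vecs (tuple_space n k))"
  unfolding fun_space.subspace_def by (auto simp: fun_scale_def)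

lemma span_tuple_unit: "fun_space.span (tuple_unit ` tuples n k) = vecs (tuple_space n k)"
proof
  show "fun_space.span (tuple_unit ` tuples n k) \<subseteq> vecs (tuple_space n k)"
    by (rule fun_space.span_minimal[OF _ subspace_tuple_space]) (auto simp: tuple_unit_def)
  show "vecs (tuple_space n k) \<subseteq> fun_space.span (tuple_unit ` tuples n k)"
  proof
    fix x assume x: "x \<in> vecs (tuple_space n k)"
    have "x = (\<Sum>I\<in>tuples n k. fun_scale (x I) (tuple_unit I))"
    proof
      fix J
      have "(\<Sum>I\<in>tuples n k. fun_scale (x I) (tuple_unit I) J) = (\<Sum>I\<in>tuples n k. if I = J then x J else 0)"
        by (rule sum.cong) (auto simp: fun_scale_def tuple_unit_def)
      then show "x J = (\<Sum>I\<in>tuples n k. fun_scale (x I) (tuple_unit I)) J"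
        using x by (simp add: sum_fun_apply)
    qed
    also have "\<dots> \<in> fun_space.span (tuple_unit ` tuples n k)"
      by (intro fun_space.span_sum fun_space.span_scale fun_space.span_base imageI)
    finally show "x \<in> fun_space.span (tuple_unit ` tuples n k)" .
  qed
qed

lemma fd_hilbert_tuple_space: "fd_hilbert (tuple_space n k)"
  unfolding fd_hilbert_def
proof (intro conjI ballI allI impI)
  show "vector_space (scl (tuple_space n k))" by (simp add: vector_space_fun_scale)
  show "module.subspace (scl (tuple_space n k)) (vecs (tuple_space n k))" using subspace_tuple_space by simp
  show "\<exists>B. finite B \<and> module.span (scl (tuple_space n k)) B = vecs (tuple_space n k)"
    using span_tuple_unit[of n k] by (intro exI[of _ "tuple_unit ` tuples n k"]) simp
next
  fix x :: "nat list \<Rightarrow> complex" assume x: "x \<in> vecs (tuple_space n k)" "x \<noteq> 0"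
  then obtain I where I: "x I \<noteq> 0" "I \<in> tuples n k" by (auto simp: fun_eq_iff)
  have "0 < (\<Sum>I\<in>tuples n k. (cmod (x I))\<^sup>2)"
    by (rule sum_pos2[OF _ I(2)]) (use I in auto)
  then show "0 < Re (ip (tuple_space n k) x x)"
    by (simp flip: complex_norm_square of_real_power of_real_sum)
qed (auto simp: fun_scale_def sum_distrib_left algebra_simps sum.distrib intro!: sum.cong)

text \<open>A fourth root of the sign of \<open>d\<close>. It distributes the signs of the state sum evenly over the vertices.\<close>

definition root_sign :: "real \<Rightarrow> complex" where
  "root_sign d = (if d > 0 then 1 else cis (pi / 4))"

lemma root_sign: assumes "d \<noteq> 0"
  shows "root_sign d \<noteq> 0" "cnj (root_sign d) = inverse (root_sign d)" "root_sign d ^ 4 = of_real (sgn d)"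
  using assms by (auto simp: root_sign_def cis_cnj cis_inverse DeMoivre)

text \<open>The divisor squares to the sign of \<open>d\<close>, so the sums over the powers 2 and
  -2 become \<open>d\<close> instead of \<open>|d|\<close>.\<close>

definition string_weight :: "real \<Rightarrow> real list \<Rightarrow> nat \<Rightarrow> complex" where
  "string_weight d ms k = of_real (if k < length ms then ms ! k else 1) / root_sign d ^ 2"

text \<open>The power of \<open>root_sign d\<close> depends only on the lengths of the words and is
  therefore multiplicative under both products.\<close>

definition coefficient ::
    "real \<Rightarrow> real list \<Rightarrow> word \<Rightarrow> word \<Rightarrow> diagram \<Rightarrow> nat list \<Rightarrow> nat list \<Rightarrow> complex" where
  "coefficient d ms u v D I J =
     root_sign d powi (int (length u) - int (length v)) * weight (string_weight d ms) D (vertex_state I J)"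

definition std_fiber :: "real \<Rightarrow> real list \<Rightarrow> (nat list \<Rightarrow> complex) fiber" where
  "std_fiber d ms = \<lparr>obj = (\<lambda>w. tuple_space (length ms) (length w)),
     mor = (\<lambda>u v f x J. if J \<in> tuples (length ms) (length v) then
        (\<Sum>I\<in>tuples (length ms) (length u). \<Sum>D\<in>kauffman u v. f D * coefficient d ms u v D I J * x I) else 0),
     ten = (\<lambda>u v x y L. x (take (length u) L) * y (drop (length u) L)),
     vac = tuple_unit []\<rparr>"

lemma std_fiber_simps [simp]:
  "obj (std_fiber d ms) w = tuple_space (length ms) (length w)"
  "mor (std_fiber d ms) u v f x J = (if J \<in> tuples (length ms) (length v) then
        (\<Sum>I\<in>tuples (length ms) (length u). \<Sum>D\<in>kauffman u v. f D * coefficient d ms u v D I J * x I) else 0)"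
  "ten (std_fiber d ms) u v x y L = x (take (length u) L) * y (drop (length u) L)"
  "vac (std_fiber d ms) = tuple_unit []"
  by (simp_all add: std_fiber_def)

text \<open>Evaluates the linear extension of \<open>\<phi>\<close> on a bilinear extension of
  \<open>h\<close>; concatenation, juxtaposition and reflection are instances of
  \<open>h\<close>.\<close>

lemma sum_of_diagram:
  assumes "finite S" "\<And>D E. D \<in> A \<Longrightarrow> E \<in> B \<Longrightarrow> h D E \<in> S"
  shows "(\<Sum>F\<in>S. (\<Sum>D\<in>A. \<Sum>E\<in>B. a D E * of_diagram (h D E) F) * \<phi> F) =
    (\<Sum>D\<in>A. \<Sum>E\<in>B. a D E * \<phi> (h D E))"
proof -
  have 1: "(\<Sum>F\<in>S. a D E * of_diagram (h D E) F * \<phi> F) = a D E * \<phi> (h D E)" if "D \<in> A" "E \<in> B" for D E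
  proof -
    have "(\<Sum>F\<in>S. a D E * of_diagram (h D E) F * \<phi> F) = (\<Sum>F\<in>S. if F = h D E then a D E * \<phi> (h D E) else 0)"
      by (rule sum.cong) (auto simp: of_diagram_def)
    then show ?thesis using assms that by simp
  qed
  have "(\<Sum>F\<in>S. (\<Sum>D\<in>A. \<Sum>E\<in>B. a D E * of_diagram (h D E) F) * \<phi> F) =
      (\<Sum>F\<in>S. \<Sum>D\<in>A. \<Sum>E\<in>B. a D E * of_diagram (h D E) F * \<phi> F)"
    by (simp add: sum_distrib_right)
  also have "\<dots> = (\<Sum>D\<in>A. \<Sum>F\<in>S. \<Sum>E\<in>B. a D E * of_diagram (h D E) F * \<phi> F)"
    by (rule sum.swap)
  also have "\<dots> = (\<Sum>D\<in>A. \<Sum>E\<in>B. \<Sum>F\<in>S. a D E * of_diagram (h D E) F * \<phi> F)"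
    by (intro sum.cong refl sum.swap)
  finally show ?thesis by (simp add: 1)
qed

lemma linear_map_mor: "linear_map (obj (std_fiber d ms) u) (obj (std_fiber d ms) v) (mor (std_fiber d ms) u v f)"
  unfolding linear_map_def
proof (intro conjI ballI allI)
  fix x y
  show "mor (std_fiber d ms) u v f (x + y) = mor (std_fiber d ms) u v f x + mor (std_fiber d ms) u v f y"
    by (auto simp: fun_eq_iff algebra_simps sum.distrib)
next
  fix c x
  show "mor (std_fiber d ms) u v f (scl (obj (std_fiber d ms) u) c x) =
      scl (obj (std_fiber d ms) v) c (mor (std_fiber d ms) u v f x)"
    by (auto simp: fun_eq_iff fun_scale_def sum_distrib_left mult_ac)
qed simp

lemma vec_expand:
  assumes "x \<in> vecs (tuple_space n k)" "J \<in> tuples n k"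
  shows "(\<Sum>I\<in>tuples n k. (if I = J then 1 else 0) * x I) = x J"
  using assms by (simp add: if_distrib[of "\<lambda>a. a * _"] cong: if_cong)

lemma mor_id:
  assumes x: "x \<in> vecs (obj (std_fiber d ms) w)"
  shows "mor (std_fiber d ms) w w (id_mor w) x = x"
proof
  fix J
  let ?T = "tuples (length ms) (length w)"
  show "mor (std_fiber d ms) w w (id_mor w) x J = x J"
  proof (cases "J \<in> ?T")
    case True
    have "(\<Sum>D\<in>kauffman w w. id_mor w D * coefficient d ms w w D I J * x I) = (if I = J then 1 else 0) * x I"
      if I: "I \<in> ?T" for I
    proof -
      have "(\<Sum>D\<in>kauffman w w. id_mor w D * coefficient d ms w w D I J * x I) =
          (\<Sum>D\<in>kauffman w w. if D = id_diagram w then coefficient d ms w w (id_diagram w) I J * x I else 0)"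
        by (rule sum.cong) (auto simp: id_mor_def of_diagram_def)
      also have "\<dots> = coefficient d ms w w (id_diagram w) I J * x I"
        using id_diagram_kauffman[of w] finite_kauffman by simp
      also have "coefficient d ms w w (id_diagram w) I J = (if I = J then 1 else 0)"
        using I True weight_id_diagram[of I w J] by (simp add: coefficient_def tuples_def)
      finally show ?thesis .
    qed
    then show ?thesis using True x vec_expand[of x] by simp
  qed (use x in simp)
qed

lemma coefficient_stack:
  assumes c: "\<And>k. k < length ms \<Longrightarrow> ms ! k > 0"
    "(\<Sum>k<length ms. ms ! k ^ 2) = \<bar>d\<bar>" "(\<Sum>k<length ms. ms ! k powi (- 2)) = \<bar>d\<bar>" "d \<noteq> 0"
    and I: "I \<in> tuples (length ms) (length u)" and K: "K \<in> tuples (length ms) (length w)"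
    and D: "D \<in> kauffman u v" and E: "E \<in> kauffman v w"
  shows "(\<Sum>L\<in>tuples (length ms) (length v). coefficient d ms u v D I L * coefficient d ms v w E L K) =
    of_real d ^ loops D E * coefficient d ms u w (stack D E) I K"
proof -
  let ?c = "string_weight d ms" and ?n = "length ms"
  note rs = root_sign[OF c(4)]
  have c0: "?c k \<noteq> 0" if "k < ?n" for k
    using c(1)[OF that] rs by (simp add: string_weight_def)
  have r4: "(root_sign d)\<^sup>2 * (root_sign d)\<^sup>2 = of_real (sgn d)"
    using rs(3) by (simp flip: power_add)
  have ssd: "of_real (sgn d) * of_real \<bar>d\<bar> = (of_real d :: complex)" "(of_real (sgn d) :: complex) \<noteq> 0"
    "of_real \<bar>d\<bar> / of_real (sgn d) = (of_real d :: complex)"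
    using c(4) by (auto simp: sgn_if)
  define q where "q = (root_sign d)\<^sup>2"
  have q: "q\<^sup>2 = of_real (sgn d)"
    using r4 by (simp add: q_def power2_eq_square)
  have sw: "?c k = of_real (ms ! k) / q" if "k < ?n" for k
    using that by (simp add: string_weight_def q_def)
  have "(\<Sum>k<?n. ?c k powi 2) = (\<Sum>k<?n. of_real (ms ! k ^ 2)) / of_real (sgn d)"
    unfolding sum_divide_distrib by (rule sum.cong) (auto simp: sw power_divide q)
  also have "\<dots> = of_real d" using c(2) ssd by (simp only: of_real_sum[symmetric])
  finally have s1: "(\<Sum>k<?n. ?c k powi 2) = of_real d" .
  have "(\<Sum>k<?n. ?c k powi (- 2)) = of_real (sgn d) * (\<Sum>k<?n. of_real (ms ! k powi (- 2)))"
    unfolding sum_distrib_left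
    by (rule sum.cong) (auto simp: sw power_divide power_int_minus q field_simps)
  also have "\<dots> = of_real d" using c(3) ssd by (simp only: of_real_sum[symmetric])
  finally have s2: "(\<Sum>k<?n. ?c k powi (- 2)) = of_real d" .
  have p: "root_sign d powi (int (length u) - int (length v)) * root_sign d powi (int (length v) - int (length w)) =
      root_sign d powi (int (length u) - int (length w))"
    using rs(1) by (simp flip: power_int_add)
  have "(\<Sum>L\<in>tuples ?n (length v). coefficient d ms u v D I L * coefficient d ms v w E L K) =
      root_sign d powi (int (length u) - int (length w)) *
      (\<Sum>L\<in>tuples ?n (length v). weight ?c D (vertex_state I L) * weight ?c E (vertex_state L K))"
    unfolding coefficient_def p[symmetric] by (simp add: sum_distrib_left mult_ac)
  also have "\<dots> = of_real d ^ loops D E * coefficient d ms u w (stack D E) I K"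
    by (subst sum_weight_stack[where c = ?c, OF c0 s1 s2 I K D E]) (simp_all add: coefficient_def mult_ac)
  finally show ?thesis .
qed

lemma mor_comp:
  assumes c: "\<And>k. k < length ms \<Longrightarrow> ms ! k > 0"
    "(\<Sum>k<length ms. ms ! k ^ 2) = \<bar>d\<bar>" "(\<Sum>k<length ms. ms ! k powi (- 2)) = \<bar>d\<bar>" "d \<noteq> 0"
  shows "mor (std_fiber d ms) u w (comp_mor d u v w f g) x =
    mor (std_fiber d ms) v w g (mor (std_fiber d ms) u v f x)"
proof
  fix K
  let ?T = "\<lambda>w. tuples (length ms) (length w)"
  let ?co = "coefficient d ms"
  show "mor (std_fiber d ms) u w (comp_mor d u v w f g) x K =
    mor (std_fiber d ms) v w g (mor (std_fiber d ms) u v f x) K"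
  proof (cases "K \<in> ?T w")
    case True
    have 1: "(\<Sum>F\<in>kauffman u w. comp_mor d u v w f g F * ?co u w F I K) =
        (\<Sum>L\<in>?T v. (\<Sum>D\<in>kauffman u v. f D * ?co u v D I L) * (\<Sum>E\<in>kauffman v w. g E * ?co v w E L K))"
      (is "?L = ?R") if I: "I \<in> ?T u" for I
    proof -
      have "?L = (\<Sum>D\<in>kauffman u v. \<Sum>E\<in>kauffman v w.
          f D * g E * of_real d ^ loops D E * ?co u w (stack D E) I K)"
        unfolding comp_mor_def by (rule sum_of_diagram[OF finite_kauffman]) (rule stack_kauffman)
      also have "\<dots> = (\<Sum>D\<in>kauffman u v. \<Sum>E\<in>kauffman v w. \<Sum>L\<in>?T v.
          (f D * ?co u v D I L) * (g E * ?co v w E L K))"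
      proof (intro sum.cong refl)
        fix D E assume "D \<in> kauffman u v" "E \<in> kauffman v w"
        from coefficient_stack[OF c I True this]
        have "f D * g E * of_real d ^ loops D E * ?co u w (stack D E) I K =
          f D * g E * (\<Sum>L\<in>?T v. ?co u v D I L * ?co v w E L K)" by simp
        then show "f D * g E * of_real d ^ loops D E * ?co u w (stack D E) I K =
          (\<Sum>L\<in>?T v. (f D * ?co u v D I L) * (g E * ?co v w E L K))"
          by (simp add: sum_distrib_left mult_ac)
      qed
      also have "\<dots> = (\<Sum>D\<in>kauffman u v. \<Sum>L\<in>?T v. \<Sum>E\<in>kauffman v w.
          (f D * ?co u v D I L) * (g E * ?co v w E L K))"
        by (intro sum.cong refl sum.swap)
      also have "\<dots> = (\<Sum>L\<in>?T v. \<Sum>D\<in>kauffman u v. \<Sum>E\<in>kauffman v w.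
          (f D * ?co u v D I L) * (g E * ?co v w E L K))"
        by (rule sum.swap)
      also have "\<dots> = ?R" by (simp add: sum_product)
      finally show ?thesis .
    qed
    have "mor (std_fiber d ms) u w (comp_mor d u v w f g) x K =
        (\<Sum>I\<in>?T u. (\<Sum>F\<in>kauffman u w. comp_mor d u v w f g F * ?co u w F I K) * x I)"
      using True by (simp add: sum_distrib_right)
    also have "\<dots> = (\<Sum>I\<in>?T u. \<Sum>L\<in>?T v. (\<Sum>D\<in>kauffman u v. f D * ?co u v D I L) *
        (\<Sum>E\<in>kauffman v w. g E * ?co v w E L K) * x I)"
      by (simp add: 1 sum_distrib_right)
    also have "\<dots> = (\<Sum>L\<in>?T v. \<Sum>I\<in>?T u. (\<Sum>D\<in>kauffman u v. f D * ?co u v D I L) *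
        (\<Sum>E\<in>kauffman v w. g E * ?co v w E L K) * x I)"
      by (rule sum.swap)
    also have "\<dots> = (\<Sum>L\<in>?T v. (\<Sum>E\<in>kauffman v w. g E * ?co v w E L K) *
        (\<Sum>I\<in>?T u. (\<Sum>D\<in>kauffman u v. f D * ?co u v D I L) * x I))"
      unfolding sum_distrib_left[of _ _ "?T u"] by (intro sum.cong refl) (simp add: mult_ac)
    also have "\<dots> = (\<Sum>L\<in>?T v. (\<Sum>E\<in>kauffman v w. g E * ?co v w E L K) * mor (std_fiber d ms) u v f x L)"
      by (intro sum.cong refl) (simp add: sum_distrib_right)
    also have "\<dots> = mor (std_fiber d ms) v w g (mor (std_fiber d ms) u v f x) K"
      using True by (simp add: sum_distrib_right del: std_fiber_simps(2) add: std_fiber_simps(2)[of d ms v w])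
    finally show ?thesis .
  qed simp
qed

lemma linear_functor_std_fiber:
  assumes c: "\<And>k. k < length ms \<Longrightarrow> ms ! k > 0"
    "(\<Sum>k<length ms. ms ! k ^ 2) = \<bar>d\<bar>" "(\<Sum>k<length ms. ms ! k powi (- 2)) = \<bar>d\<bar>" "d \<noteq> 0"
  shows "linear_functor d (std_fiber d ms)"
  unfolding linear_functor_def
proof (intro conjI allI ballI)
  show "fd_hilbert (obj (std_fiber d ms) w)" for w by (simp add: fd_hilbert_tuple_space)
  show "linear_map (obj (std_fiber d ms) u) (obj (std_fiber d ms) v) (mor (std_fiber d ms) u v f)" for u v f
    by (rule linear_map_mor)
  show "mor (std_fiber d ms) u v (\<lambda>D. f D + g D) x = mor (std_fiber d ms) u v f x + mor (std_fiber d ms) u v g x"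
    for u v f g x by (auto simp: fun_eq_iff algebra_simps sum.distrib)
  show "mor (std_fiber d ms) u v (\<lambda>D. c * f D) x = scl (obj (std_fiber d ms) v) c (mor (std_fiber d ms) u v f x)"
    for u v f c x by (auto simp: fun_eq_iff fun_scale_def sum_distrib_left mult_ac)
  show "mor (std_fiber d ms) w w (id_mor w) x = x" if "x \<in> vecs (obj (std_fiber d ms) w)" for w x
    by (rule mor_id[OF that])
  show "mor (std_fiber d ms) u w (comp_mor d u v w f g) x =
    mor (std_fiber d ms) v w g (mor (std_fiber d ms) u v f x)" for u v w f g x
    by (rule mor_comp[OF c])
qed

lemma ten_tuple_unit:
  assumes "I \<in> tuples n k"
  shows "(\<lambda>L. tuple_unit I (take k L) * tuple_unit J (drop k L)) = tuple_unit (I @ J)"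
proof
  fix L
  have "L = I @ J \<longleftrightarrow> take k L = I \<and> drop k L = J"
    using assms by (auto simp: tuples_def) (metis append_take_drop_id)
  then show "tuple_unit I (take k L) * tuple_unit J (drop k L) = tuple_unit (I @ J) L"
    by (simp add: tuple_unit_def)
qed

lemma ten_vecs:
  assumes x: "x \<in> vecs (tuple_space n k)" and y: "y \<in> vecs (tuple_space n l)"
  shows "(\<lambda>L. x (take k L) * y (drop k L)) \<in> vecs (tuple_space n (k + l))"
proof -
  have "x (take k L) * y (drop k L) = 0" if L: "L \<notin> tuples n (k + l)" for L
  proof (rule ccontr)
    assume "x (take k L) * y (drop k L) \<noteq> 0"
    then have "take k L \<in> tuples n k" "drop k L \<in> tuples n l" using x y by auto
    then have "take k L @ drop k L \<in> tuples n (k + l)" unfolding tuples_append by blast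
    then show False using L by simp
  qed
  then show ?thesis by simp
qed

lemma is_tensor_std:
  "is_tensor (tuple_space n k) (tuple_space n l) (tuple_space n (k + l)) (\<lambda>x y L. x (take k L) * y (drop k L))"
  unfolding is_tensor_def
proof (intro conjI ballI)
  fix y assume "y \<in> vecs (tuple_space n l)"
  then show "linear_map (tuple_space n k) (tuple_space n (k + l)) (\<lambda>x L. x (take k L) * y (drop k L))"
    using ten_vecs[of _ n k y l] unfolding linear_map_def
    by (auto simp: fun_eq_iff fun_scale_def algebra_simps)
next
  fix x assume "x \<in> vecs (tuple_space n k)"
  then show "linear_map (tuple_space n l) (tuple_space n (k + l)) (\<lambda>y L. x (take k L) * y (drop k L))"
    using ten_vecs[of x n k _ l] unfolding linear_map_def
    by (auto simp: fun_eq_iff fun_scale_def algebra_simps)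
next
  fix x x' y y'
  have len: "length I = k" if "I \<in> tuples n k" for I using that by (simp add: tuples_def)
  show "ip (tuple_space n (k + l)) (\<lambda>L. x (take k L) * y (drop k L)) (\<lambda>L. x' (take k L) * y' (drop k L)) =
      ip (tuple_space n k) x x' * ip (tuple_space n l) y y'"
    by (simp add: sum_tuples_append len sum_product mult_ac cong: sum.cong)
next
  let ?S = "{(\<lambda>L. x (take k L) * y (drop k L)) | x y. x \<in> vecs (tuple_space n k) \<and> y \<in> vecs (tuple_space n l)}"
  have "fun_space.span ?S = vecs (tuple_space n (k + l))"
  proof
    show "fun_space.span ?S \<subseteq> vecs (tuple_space n (k + l))"
      using ten_vecs by (intro fun_space.span_minimal[OF _ subspace_tuple_space]) blast
    have "tuple_unit ` tuples n (k + l) \<subseteq> ?S"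
    proof (clarsimp simp: tuples_append)
      fix I J assume IJ: "I \<in> tuples n k" "J \<in> tuples n l"
      show "\<exists>x y. tuple_unit (I @ J) = (\<lambda>L. x (take k L) * y (drop k L)) \<and>
        (\<forall>I. I \<notin> tuples n k \<longrightarrow> x I = 0) \<and> (\<forall>I. I \<notin> tuples n l \<longrightarrow> y I = 0)"
        using ten_tuple_unit[OF IJ(1), of J, symmetric] IJ
        by (intro exI[of _ "tuple_unit I"] exI[of _ "tuple_unit J"]) (auto simp: tuple_unit_def)
    qed
    then show "vecs (tuple_space n (k + l)) \<subseteq> fun_space.span ?S"
      unfolding span_tuple_unit[symmetric] by (rule fun_space.span_mono)
  qed
  then show "module.span (scl (tuple_space n (k + l))) ?S = vecs (tuple_space n (k + l))" by simp
qed

lemma coefficient_juxtapose: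
  assumes D: "D \<in> kauffman u u'" and E: "E \<in> kauffman v v'" and d: "d \<noteq> 0"
    and I: "I \<in> tuples n (length u)" "J \<in> tuples n (length u')"
  shows "coefficient d ms (u @ v) (u' @ v') (juxtapose (length u) (length u') D E) (I @ I') (J @ J') =
    coefficient d ms u u' D I J * coefficient d ms v v' E I' J'"
proof -
  have "root_sign d powi (int (length (u @ v)) - int (length (u' @ v'))) =
      root_sign d powi (int (length u) - int (length u')) * root_sign d powi (int (length v) - int (length v'))"
    using root_sign(1)[OF d] by (simp add: algebra_simps flip: power_int_add)
  then show ?thesis
    using I unfolding coefficient_def by (simp add: weight_juxtapose[OF D E] tuples_def mult_ac)
qed

lemma mor_tensor:
  assumes d: "d \<noteq> 0"
  shows "mor (std_fiber d ms) (u @ v) (u' @ v') (tensor_mor u u' v v' f g) (ten (std_fiber d ms) u v x y) =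
    ten (std_fiber d ms) u' v' (mor (std_fiber d ms) u u' f x) (mor (std_fiber d ms) v v' g y)"
proof
  fix L
  let ?T = "\<lambda>w. tuples (length ms) (length w)"
  let ?co = "coefficient d ms"
  show "mor (std_fiber d ms) (u @ v) (u' @ v') (tensor_mor u u' v v' f g) (ten (std_fiber d ms) u v x y) L =
    ten (std_fiber d ms) u' v' (mor (std_fiber d ms) u u' f x) (mor (std_fiber d ms) v v' g y) L"
  proof (cases "L \<in> tuples (length ms) (length u' + length v')")
    case False
    \<comment> \<open>Equality of functions is also required at lists outside the index set; both
      sides vanish there.\<close>
    then have "\<not> (take (length u') L \<in> ?T u' \<and> drop (length u') L \<in> ?T v')"
      by (auto simp: tuples_append image_iff) (metis append_take_drop_id)
    then show ?thesis using False by auto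
  next
    case True
    then obtain J J' where L: "L = J @ J'" and J: "J \<in> ?T u'" and J': "J' \<in> ?T v'"
      unfolding tuples_append by auto
    have lenJ: "length J = length u'" using J by (simp add: tuples_def)
    have 1: "(\<Sum>F\<in>kauffman (u @ v) (u' @ v'). tensor_mor u u' v v' f g F * ?co (u @ v) (u' @ v') F (I @ I') L) =
        (\<Sum>D\<in>kauffman u u'. f D * ?co u u' D I J) * (\<Sum>E\<in>kauffman v v'. g E * ?co v v' E I' J')"
      (is "?L = ?R") if I: "I \<in> ?T u" for I I'
    proof -
      have "?L = (\<Sum>D\<in>kauffman u u'. \<Sum>E\<in>kauffman v v'.
          f D * g E * ?co (u @ v) (u' @ v') (juxtapose (length u) (length u') D E) (I @ I') L)"
        unfolding tensor_mor_def by (rule sum_of_diagram[OF finite_kauffman]) (rule juxtapose_kauffman)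
      also have "\<dots> = (\<Sum>D\<in>kauffman u u'. \<Sum>E\<in>kauffman v v'.
          (f D * ?co u u' D I J) * (g E * ?co v v' E I' J'))"
        by (intro sum.cong refl) (simp add: L coefficient_juxtapose[OF _ _ d I J] mult_ac)
      also have "\<dots> = ?R" by (simp add: sum_product)
      finally show ?thesis .
    qed
    have "mor (std_fiber d ms) (u @ v) (u' @ v') (tensor_mor u u' v v' f g) (ten (std_fiber d ms) u v x y) L =
        (\<Sum>I\<in>?T u. \<Sum>I'\<in>?T v. (\<Sum>F\<in>kauffman (u @ v) (u' @ v').
           tensor_mor u u' v v' f g F * ?co (u @ v) (u' @ v') F (I @ I') L) *
           (x (take (length u) (I @ I')) * y (drop (length u) (I @ I'))))"
      using True by (simp add: sum_tuples_append sum_distrib_right)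
    also have "\<dots> = (\<Sum>I\<in>?T u. \<Sum>I'\<in>?T v. (\<Sum>D\<in>kauffman u u'. f D * ?co u u' D I J) *
        (\<Sum>E\<in>kauffman v v'. g E * ?co v v' E I' J') * (x I * y I'))"
    proof (intro sum.cong refl)
      fix I I' assume I: "I \<in> ?T u"
      then have "length I = length u" by (simp add: tuples_def)
      then show "(\<Sum>F\<in>kauffman (u @ v) (u' @ v').
           tensor_mor u u' v v' f g F * ?co (u @ v) (u' @ v') F (I @ I') L) *
           (x (take (length u) (I @ I')) * y (drop (length u) (I @ I'))) =
         (\<Sum>D\<in>kauffman u u'. f D * ?co u u' D I J) *
        (\<Sum>E\<in>kauffman v v'. g E * ?co v v' E I' J') * (x I * y I')" by (simp add: 1[OF I])
    qed
    also have "\<dots> = (\<Sum>I\<in>?T u. (\<Sum>D\<in>kauffman u u'. f D * ?co u u' D I J) * x I) *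
        (\<Sum>I'\<in>?T v. (\<Sum>E\<in>kauffman v v'. g E * ?co v v' E I' J') * y I')"
      unfolding sum_product[of _ "?T u"] by (intro sum.cong refl) (simp only: mult_ac)
    also have "\<dots> = ten (std_fiber d ms) u' v' (mor (std_fiber d ms) u u' f x) (mor (std_fiber d ms) v v' g y) L"
      using J J' lenJ by (simp add: L sum_distrib_right)
    finally show ?thesis .
  qed
qed

lemma monoidal_functor_std_fiber:
  assumes d: "d \<noteq> 0"
  shows "monoidal_functor (std_fiber d ms)"
  unfolding monoidal_functor_def
proof (intro conjI allI ballI)
  let ?F = "std_fiber d ms"
  show "is_tensor (obj ?F u) (obj ?F v) (obj ?F (u @ v)) (ten ?F u v)" for u v
    using is_tensor_std[of "length ms" "length u" "length v"] by (simp add: std_fiber_def)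
  show "vecs (obj ?F []) = module.span (scl (obj ?F [])) {vac ?F}"
    using span_tuple_unit[of "length ms" 0] by simp
  show "ip (obj ?F []) (vac ?F) (vac ?F) = 1" by (simp add: tuple_unit_def)
  show "ten ?F (u @ v) w (ten ?F u v x y) z = ten ?F u (v @ w) x (ten ?F v w y z)" for u v w x y z
    by (simp add: fun_eq_iff take_drop min_def add.commute)
  show "ten ?F [] w (vac ?F) x = x" for w x by (simp add: fun_eq_iff tuple_unit_def)
  show "ten ?F w [] x (vac ?F) = x" if x: "x \<in> vecs (obj ?F w)" for w x
  proof
    fix L
    \<comment> \<open>On a longer list the factor \<open>vac\<close> is evaluated at a nonempty rest
      and vanishes, as \<open>x\<close> does.\<close>
    have "x L = 0" if "length w < length L" using x that by (auto simp: tuples_def)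
    then show "ten ?F w [] x (vac ?F) L = x L"
      by (cases "length L \<le> length w") (auto simp: tuple_unit_def)
  qed
  show "mor ?F (u @ v) (u' @ v') (tensor_mor u u' v v' f g) (ten ?F u v x y) =
     ten ?F u' v' (mor ?F u u' f x) (mor ?F v v' g y)" for u v u' v' f g x y
    by (rule mor_tensor[OF d])
qed

text \<open>Conjugation multiplies each \<open>string_weight\<close> by the sign of
  \<open>d\<close>, so the total rotation appears as its exponent and may be replaced by
  \<open>sharp D\<close>. The vertex factor has modulus 1; conjugation inverts it, which amounts to
  exchanging the two edges.\<close>

lemma coefficient_reflect:
  assumes D: "D \<in> kauffman u v" and d: "d \<noteq> 0"
  shows "cnj (coefficient d ms u v D I J) =
    of_real ((d / \<bar>d\<bar>) powi sharp D) * coefficient d ms v u (reflect D) J I"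
proof -
  let ?c = "string_weight d ms" and ?s = "of_real (d / \<bar>d\<bar>) :: complex"
  note rs = root_sign[OF d]
  have s: "d / \<bar>d\<bar> = sgn d" by (simp add: sgn_if)
  have s1: "?s = 1 \<or> ?s = - 1" unfolding s by (auto simp: sgn_if d)
  have r4: "root_sign d ^ 2 = ?s / root_sign d ^ 2"
    unfolding s rs(3)[symmetric] using rs(1) by (simp add: field_simps flip: power_add)
  have cc: "cnj (?c k) = ?s * ?c k" for k
    using r4 by (simp add: string_weight_def rs(2) power_inverse divide_inverse mult_ac)
  have "cnj (arc ?c r i j) = ?s powi r * arc ?c r i j" for r i j
    unfolding arc_def if_distrib[of cnj] complex_cnj_power_int cc power_int_mult_distrib by simp
  then have "cnj (weight ?c D (vertex_state I J)) =
      (\<Prod>(p, q)\<in>D. ?s powi rot p q) * weight ?c D (vertex_state I J)"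
    unfolding weight_def by (simp add: case_prod_unfold prod.distrib)
  also have "(\<Prod>(p, q)\<in>D. ?s powi rot p q) = ?s powi sharp D"
    by (rule prod_sign_rot[OF finite_diagram[OF D] _ s1])
      (use kauffman_source_target[OF D] sources_targets_disjoint in blast)
  finally have w: "cnj (weight ?c D (vertex_state I J)) = ?s powi sharp D * weight ?c (reflect D) (vertex_state J I)"
    by (simp add: weight_reflect)
  have "cnj (root_sign d powi (int (length u) - int (length v))) = root_sign d powi (int (length v) - int (length u))"
    unfolding complex_cnj_power_int rs(2) power_int_inverse by (simp flip: power_int_minus)
  then show ?thesis unfolding coefficient_def by (simp add: w mult_ac)
qed

lemma star_preserving_std_fiber:
  assumes d: "d \<noteq> 0"
  shows "star_preserving d (std_fiber d ms)"
  unfolding star_preserving_def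
proof (intro allI ballI)
  fix u v f x y
  let ?T = "\<lambda>w. tuples (length ms) (length w)"
  let ?co = "coefficient d ms"
  have 1: "(\<Sum>E\<in>kauffman v u. star_mor d u v f E * ?co v u E J I) = cnj (\<Sum>D\<in>kauffman u v. f D * ?co u v D I J)"
    for I J
  proof -
    have "(\<Sum>E\<in>kauffman v u. star_mor d u v f E * ?co v u E J I) =
        (\<Sum>D\<in>kauffman u v. cnj (f D) * of_real ((d / \<bar>d\<bar>) powi sharp D) * ?co v u (reflect D) J I)"
      \<comment> \<open>The one-element index set turns the single sum over diagrams into the double
        sum of \<open>sum_of_diagram\<close>.\<close>
      using sum_of_diagram[OF finite_kauffman[of v u], where A = "kauffman u v" and B = "{()}" and
        h = "\<lambda>D _. reflect D" and a = "\<lambda>D _. cnj (f D) * of_real ((d / \<bar>d\<bar>) powi sharp D)" and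
        \<phi> = "\<lambda>E. ?co v u E J I"] reflect_kauffman
      by (simp add: star_mor_def)
    also have "\<dots> = (\<Sum>D\<in>kauffman u v. cnj (f D) * cnj (?co u v D I J))"
      by (intro sum.cong refl) (simp add: coefficient_reflect[OF _ d])
    finally show ?thesis by simp
  qed
  have "ip (obj (std_fiber d ms) u) x (mor (std_fiber d ms) v u (star_mor d u v f) y) =
      (\<Sum>I\<in>?T u. \<Sum>J\<in>?T v. x I * (cnj (\<Sum>E\<in>kauffman v u. star_mor d u v f E * ?co v u E J I) * cnj (y J)))"
    by (simp add: sum_distrib_left sum_distrib_right)
  also have "\<dots> = (\<Sum>I\<in>?T u. \<Sum>J\<in>?T v. (\<Sum>D\<in>kauffman u v. f D * ?co u v D I J) * x I * cnj (y J))"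
    unfolding 1 by (simp add: mult_ac)
  also have "\<dots> = (\<Sum>J\<in>?T v. \<Sum>I\<in>?T u. (\<Sum>D\<in>kauffman u v. f D * ?co u v D I J) * x I * cnj (y J))"
    by (rule sum.swap)
  also have "\<dots> = ip (obj (std_fiber d ms) v) (mor (std_fiber d ms) u v f x) y"
    by (simp add: sum_distrib_left sum_distrib_right)
  finally show "ip (obj (std_fiber d ms) u) x (mor (std_fiber d ms) v u (star_mor d u v f) y) =
      ip (obj (std_fiber d ms) v) (mor (std_fiber d ms) u v f x) y" .
qed

text \<open>The string has rotation 1, and the factors \<open>root_sign d\<close> of the two upper
  vertices cancel the divisor in \<open>string_weight\<close>.\<close>

lemma std_fiber_pairing:
  assumes d: "d \<noteq> 0" and "i < length ms" "j < length ms"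
  shows "mor (std_fiber d ms) [LXstar, LX] [] eps_Xstar (ten (std_fiber d ms) [LXstar] [LX] (tuple_unit [j]) (tuple_unit [i])) =
    fun_scale (if i = j then of_real (ms ! i) else 0) (vac (std_fiber d ms))"
proof
  fix K
  let ?n = "length ms"
  have ji: "[j] \<in> tuples ?n 1" "[j, i] \<in> tuples ?n 2" using assms by (auto simp: tuples_def)
  have t: "(\<lambda>L. tuple_unit [j] (take 1 L) * tuple_unit [i] (drop 1 L)) = tuple_unit ([j] @ [i])"
    by (rule ten_tuple_unit[OF ji(1)])
  have "ten (std_fiber d ms) [LXstar] [LX] (tuple_unit [j]) (tuple_unit [i]) = tuple_unit [j, i]"
    using t by (simp add: std_fiber_def)
  moreover have "mor (std_fiber d ms) [LXstar, LX] [] eps_Xstar (tuple_unit [j, i]) K =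
     (if K = [] then \<Sum>I\<in>tuples ?n 2. if I = [j, i] then coefficient d ms [LXstar, LX] [] {(Up 1, Up 0)} [j, i] [] else 0 else 0)"
    by (simp add: kauffman_eps_Xstar eps_Xstar_def of_diagram_def tuple_unit_def numeral_2_eq_2
        if_distrib[of "\<lambda>a. _ * a"] cong: if_cong)
  moreover have "coefficient d ms [LXstar, LX] [] {(Up 1, Up 0)} [j, i] [] = (if i = j then of_real (ms ! i) else 0)"
    using assms root_sign(1)[OF d]
    by (simp add: coefficient_def weight_def arc_def rot_def string_weight_def)
  ultimately show "mor (std_fiber d ms) [LXstar, LX] [] eps_Xstar (ten (std_fiber d ms) [LXstar] [LX] (tuple_unit [j]) (tuple_unit [i])) K =
    fun_scale (if i = j then of_real (ms ! i) else 0) (vac (std_fiber d ms)) K"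
    using ji by (simp add: fun_scale_def tuple_unit_def)
qed

section \<open>Finite-dimensional Hilbert spaces\<close>

locale hilbert =
  fixes H :: "'a::ab_group_add hilb"
  assumes fd_hilbert: "fd_hilbert H"
begin

sublocale vector_space "scl H"
  using fd_hilbert by (simp add: fd_hilbert_def)

lemma subspace_vecs: "subspace (vecs H)"
  using fd_hilbert by (simp add: fd_hilbert_def)

lemma vecs_closed [intro]:
  "0 \<in> vecs H" "x \<in> vecs H \<Longrightarrow> y \<in> vecs H \<Longrightarrow> x + y \<in> vecs H" "x \<in> vecs H \<Longrightarrow> y \<in> vecs H \<Longrightarrow> x - y \<in> vecs H"
  "x \<in> vecs H \<Longrightarrow> scl H c x \<in> vecs H" "(\<And>i. i \<in> A \<Longrightarrow> f i \<in> vecs H) \<Longrightarrow> sum f A \<in> vecs H"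
  using subspace_vecs by (auto intro: subspace_0 subspace_add subspace_diff subspace_scale subspace_sum)

lemma ip_add: "x \<in> vecs H \<Longrightarrow> y \<in> vecs H \<Longrightarrow> z \<in> vecs H \<Longrightarrow> ip H (x + y) z = ip H x z + ip H y z"
  and ip_scl: "x \<in> vecs H \<Longrightarrow> y \<in> vecs H \<Longrightarrow> ip H (scl H c x) y = c * ip H x y"
  and ip_commute: "x \<in> vecs H \<Longrightarrow> y \<in> vecs H \<Longrightarrow> ip H y x = cnj (ip H x y)"
  and ip_pos: "x \<in> vecs H \<Longrightarrow> x \<noteq> 0 \<Longrightarrow> Re (ip H x x) > 0"
  using fd_hilbert unfolding fd_hilbert_def by blast+

lemma ip_scl_right: "x \<in> vecs H \<Longrightarrow> y \<in> vecs H \<Longrightarrow> ip H x (scl H c y) = cnj c * ip H x y"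
  by (metis complex_cnj_mult ip_scl ip_commute vecs_closed(4))

lemma ip_0 [simp]: "x \<in> vecs H \<Longrightarrow> ip H 0 x = 0"
  using ip_scl[of 0 x 0] vecs_closed(1) by simp

lemma ip_diff: "x \<in> vecs H \<Longrightarrow> y \<in> vecs H \<Longrightarrow> z \<in> vecs H \<Longrightarrow> ip H (x - y) z = ip H x z - ip H y z"
  using ip_add[of "x - y" y z] vecs_closed(3) by (simp add: eq_diff_eq)

lemma ip_sum:
  "(\<And>i. i \<in> A \<Longrightarrow> f i \<in> vecs H) \<Longrightarrow> y \<in> vecs H \<Longrightarrow> ip H (sum f A) y = (\<Sum>i\<in>A. ip H (f i) y)"
  by (induction A rule: infinite_finite_induct) (auto simp: ip_add vecs_closed)

lemma ip_sum_scl: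
  assumes "\<And>i. i \<in> A \<Longrightarrow> f i \<in> vecs H" "y \<in> vecs H"
  shows "ip H (\<Sum>i\<in>A. scl H (c i) (f i)) y = (\<Sum>i\<in>A. c i * ip H (f i) y)"
proof -
  have "ip H (\<Sum>i\<in>A. scl H (c i) (f i)) y = (\<Sum>i\<in>A. ip H (scl H (c i) (f i)) y)"
    by (rule ip_sum) (use assms in \<open>auto intro: vecs_closed\<close>)
  then show ?thesis using assms by (simp add: ip_scl)
qed

lemma ip_eq_0: "x \<in> vecs H \<Longrightarrow> ip H x x = 0 \<Longrightarrow> x = 0"
  using ip_pos by fastforce

definition onb :: "'i set \<Rightarrow> ('i \<Rightarrow> 'a) \<Rightarrow> bool" where
  "onb A v \<longleftrightarrow> finite A \<and> (\<forall>i\<in>A. v i \<in> vecs H) \<and>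
     (\<forall>i\<in>A. \<forall>j\<in>A. ip H (v i) (v j) = (if i = j then 1 else 0)) \<and> span (v ` A) = vecs H"

lemma orthonormal_basis_iff_onb: "orthonormal_basis H n v \<longleftrightarrow> onb {..<n} v"
  by (auto simp: orthonormal_basis_def onb_def)

lemma onb_vecs: "onb A v \<Longrightarrow> i \<in> A \<Longrightarrow> v i \<in> vecs H"
  and onb_ip: "onb A v \<Longrightarrow> i \<in> A \<Longrightarrow> j \<in> A \<Longrightarrow> ip H (v i) (v j) = (if i = j then 1 else 0)"
  and onb_finite: "onb A v \<Longrightarrow> finite A"
  and onb_span: "onb A v \<Longrightarrow> span (v ` A) = vecs H"
  by (auto simp: onb_def)

lemma ip_lincomb:
  assumes "finite A" "\<And>i. i \<in> A \<Longrightarrow> v i \<in> vecs H"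
    "\<And>i j. i \<in> A \<Longrightarrow> j \<in> A \<Longrightarrow> ip H (v i) (v j) = (if i = j then 1 else 0)" "j \<in> A"
  shows "ip H (\<Sum>i\<in>A. scl H (c i) (v i)) (v j) = c j"
proof -
  have "ip H (\<Sum>i\<in>A. scl H (c i) (v i)) (v j) = (\<Sum>i\<in>A. c i * ip H (v i) (v j))"
    using assms by (simp add: ip_sum ip_scl vecs_closed)
  also have "\<dots> = (\<Sum>i\<in>A. if i = j then c j else 0)"
    by (rule sum.cong) (use assms in auto)
  finally show ?thesis using assms by simp
qed

lemma onb_expand:
  assumes v: "onb A v" and x: "x \<in> vecs H"
  shows "(\<Sum>i\<in>A. scl H (ip H x (v i)) (v i)) = x"
proof -
  note vv = onb_vecs[OF v]
  have "x \<in> span (v ` A)" using x onb_span[OF v] by simp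
  then have "x \<in> vecs H \<and> (\<Sum>i\<in>A. scl H (ip H x (v i)) (v i)) = x"
  proof (induction rule: span_induct_alt)
    case base
    then show ?case using vv by (simp add: vecs_closed)
  next
    case (step c y z)
    then obtain j where j: "y = v j" "j \<in> A" by auto
    have "(\<Sum>i\<in>A. scl H (ip H (scl H c y + z) (v i)) (v i)) =
        (\<Sum>i\<in>A. scl H (if i = j then c else 0) (v i)) + (\<Sum>i\<in>A. scl H (ip H z (v i)) (v i))"
      unfolding sum.distrib[symmetric]
      by (rule sum.cong)
        (use step j vv in \<open>auto simp: ip_add ip_scl vecs_closed scale_left_distrib onb_ip[OF v]\<close>)
    also have "(\<Sum>i\<in>A. scl H (if i = j then c else 0) (v i)) = (\<Sum>i\<in>A. if i = j then scl H c (v j) else 0)"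
      by (rule sum.cong) auto
    finally show ?case using step j vv onb_finite[OF v] by (auto simp: vecs_closed)
  qed
  then show ?thesis by simp
qed

lemma onb_eqI:
  assumes "onb A v" "x \<in> vecs H" "y \<in> vecs H" "\<And>i. i \<in> A \<Longrightarrow> ip H x (v i) = ip H y (v i)"
  shows "x = y"
  using onb_expand[OF assms(1,2)] onb_expand[OF assms(1,3)] assms(4) by (metis (no_types, lifting) sum.cong)

lemma onb_parseval:
  assumes v: "onb A v" and x: "x \<in> vecs H" and y: "y \<in> vecs H"
  shows "ip H x y = (\<Sum>i\<in>A. ip H x (v i) * cnj (ip H y (v i)))"
proof -
  have "ip H x y = ip H (\<Sum>i\<in>A. scl H (ip H x (v i)) (v i)) y" by (simp add: onb_expand[OF v x])
  also have "\<dots> = (\<Sum>i\<in>A. ip H x (v i) * ip H (v i) y)"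
    using onb_vecs[OF v] y by (simp add: ip_sum ip_scl vecs_closed)
  also have "\<dots> = (\<Sum>i\<in>A. ip H x (v i) * cnj (ip H y (v i)))"
    using onb_vecs[OF v] y by (intro sum.cong refl) (metis ip_commute)
  finally show ?thesis .
qed

lemma onbI:
  assumes "finite A" "\<And>i. i \<in> A \<Longrightarrow> v i \<in> vecs H"
    "\<And>i j. i \<in> A \<Longrightarrow> j \<in> A \<Longrightarrow> ip H (v i) (v j) = (if i = j then 1 else 0)"
    "\<And>x. x \<in> vecs H \<Longrightarrow> x \<in> span (v ` A)"
  shows "onb A v"
proof -
  have "span (v ` A) \<subseteq> vecs H" using assms(2) by (intro span_minimal[OF _ subspace_vecs]) auto
  then show ?thesis using assms by (auto simp: onb_def)
qed

text \<open>Orthonormal vectors are independent, so the exchange lemma applies. Cardinalities of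
  orthonormal bases take the place of dimension from here on.\<close>

lemma orthonormal_card_le:
  assumes v: "onb B v" and u: "finite A" "\<And>i. i \<in> A \<Longrightarrow> u i \<in> vecs H"
    "\<And>i j. i \<in> A \<Longrightarrow> j \<in> A \<Longrightarrow> ip H (u i) (u j) = (if i = j then 1 else 0)"
  shows "card A \<le> card B"
proof -
  have inj: "inj_on u A"
  proof (rule inj_onI)
    fix i j assume "i \<in> A" "j \<in> A" "u i = u j"
    then show "i = j" using u(3)[of i j] u(3)[of i i] by (auto split: if_splits)
  qed
  have "independent (u ` A)"
  proof (rule independent_if_scalars_zero)
    fix f x assume f: "(\<Sum>x\<in>u ` A. scl H (f x) x) = 0" "x \<in> u ` A"
    then obtain j where j: "x = u j" "j \<in> A" by auto
    have "(\<Sum>i\<in>A. scl H (f (u i)) (u i)) = 0" using f(1) inj by (simp add: sum.reindex)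
    moreover have "ip H (\<Sum>i\<in>A. scl H (f (u i)) (u i)) (u j) = f (u j)"
      using u j by (intro ip_lincomb) auto
    ultimately show "f x = 0" using j u(2) by simp
  qed (use u in simp)
  moreover have "u ` A \<subseteq> span (v ` B)" using u onb_span[OF v] by auto
  ultimately have "card (u ` A) \<le> card (v ` B)"
    using onb_finite[OF v] by (intro conjunct2[OF independent_span_bound]) auto
  also have "\<dots> \<le> card B" using onb_finite[OF v] by (rule card_image_le)
  finally show ?thesis using inj by (simp add: card_image)
qed

lemma onb_card_unique: "onb A v \<Longrightarrow> onb B w \<Longrightarrow> card A = card B"
  using orthonormal_card_le[of B w A v] orthonormal_card_le[of A v B w]
  by (simp add: onb_vecs onb_finite onb_ip)

lemma normalize:
  assumes x: "x \<in> vecs H" "x \<noteq> 0"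
  obtains c where "c \<noteq> 0" "ip H (scl H c x) (scl H c x) = 1"
proof -
  have "ip H x x = cnj (ip H x x)" by (rule ip_commute[OF x(1) x(1)])
  then have r: "ip H x x = of_real (Re (ip H x x))" by (auto simp: complex_eq_iff)
  define c where "c = (of_real (1 / sqrt (Re (ip H x x))) :: complex)"
  have pos: "Re (ip H x x) > 0" by (rule ip_pos[OF x])
  have "ip H (scl H c x) (scl H c x) = c * cnj c * of_real (Re (ip H x x))"
    using x r by (simp add: ip_scl ip_scl_right vecs_closed)
  also have "\<dots> = of_real ((1 / sqrt (Re (ip H x x)))\<^sup>2 * Re (ip H x x))"
    unfolding c_def complex_cnj_complex_of_real power2_eq_square of_real_mult ..
  also have "(1 / sqrt (Re (ip H x x)))\<^sup>2 * Re (ip H x x) = 1"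
    using pos by (simp add: power_divide)
  finally show ?thesis using that[of c] pos by (simp add: c_def)
qed

lemma gram_schmidt:
  assumes "finite B" "B \<subseteq> vecs H"
  shows "\<exists>n v. (\<forall>i<n. v i \<in> vecs H) \<and> (\<forall>i<n. \<forall>j<n. ip H (v i) (v j) = (if i = j then 1 else 0)) \<and>
    B \<subseteq> span (v ` {..<n::nat})"
  using assms
proof (induction B rule: finite_induct)
  case empty
  then show ?case by (intro exI[of _ 0]) auto
next
  case (insert b B)
  then obtain n and v :: "nat \<Rightarrow> 'a" where v: "\<And>i. i < n \<Longrightarrow> v i \<in> vecs H"
    "\<And>i j. i < n \<Longrightarrow> j < n \<Longrightarrow> ip H (v i) (v j) = (if i = j then 1 else 0)" "B \<subseteq> span (v ` {..<n})"
    by blast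
  have b: "b \<in> vecs H" using insert by auto
  define p where "p = (\<Sum>i<n. scl H (ip H b (v i)) (v i))"
  have p: "p \<in> vecs H" unfolding p_def using v by (auto intro!: vecs_closed)
  have p': "p \<in> span (v ` {..<n})"
    unfolding p_def by (intro span_sum span_scale span_base imageI) auto
  show ?case
  proof (cases "b = p")
    case True
    then show ?thesis using v p' by (intro exI[of _ n] exI[of _ v]) auto
  next
    case False
    have orth: "ip H (b - p) (v j) = 0" if "j < n" for j
    proof -
      have "ip H p (v j) = ip H b (v j)" unfolding p_def using v that by (intro ip_lincomb) auto
      then show ?thesis using b p v that by (simp add: ip_diff)
    qed
    have bp: "b - p \<in> vecs H" "b - p \<noteq> 0" using b p False by (auto intro: vecs_closed)
    from normalize[OF this] obtain c where c: "c \<noteq> 0" "ip H (scl H c (b - p)) (scl H c (b - p)) = 1" .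
    define v' where "v' = v(n := scl H c (b - p))"
    have 1: "v' i \<in> vecs H" if "i < Suc n" for i
      using that v bp by (auto simp: v'_def less_Suc_eq vecs_closed)
    have 2: "ip H (v' i) (v' j) = (if i = j then 1 else 0)" if "i < Suc n" "j < Suc n" for i j
    proof -
      have "ip H (v i) (scl H c (b - p)) = 0" if "i < n" for i
        using orth[OF that] v(1)[OF that] bp by (metis complex_cnj_zero ip_commute ip_scl_right mult_zero_right)
      then show ?thesis using that v c orth bp by (auto simp: v'_def less_Suc_eq ip_scl)
    qed
    have sub: "span (v ` {..<n}) \<subseteq> span (v' ` {..<Suc n})"
      by (rule span_mono) (auto simp: v'_def)
    have "b = scl H (1 / c) (v' n) + p" using c by (simp add: v'_def)
    moreover have "v' n \<in> span (v' ` {..<Suc n})" by (rule span_base) simp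
    moreover have "p \<in> span (v' ` {..<Suc n})" using p' sub by blast
    ultimately have "b \<in> span (v' ` {..<Suc n})" by (metis (no_types) span_add span_scale)
    then have "insert b B \<subseteq> span (v' ` {..<Suc n})" using v(3) sub by blast
    then show ?thesis using 1 2 by blast
  qed
qed

lemma onb_exists: obtains n and v :: "nat \<Rightarrow> 'a" where "onb {..<n} v"
proof -
  obtain B where B: "finite B" "span B = vecs H" using fd_hilbert by (auto simp: fd_hilbert_def)
  have "B \<subseteq> vecs H" using B span_superset by auto
  from gram_schmidt[OF B(1) this] obtain n and v :: "nat \<Rightarrow> 'a" where v: "\<forall>i<n. v i \<in> vecs H"
    "\<forall>i<n. \<forall>j<n. ip H (v i) (v j) = (if i = j then 1 else 0)" "B \<subseteq> span (v ` {..<n})" by auto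
  have "vecs H \<subseteq> span (v ` {..<n})" using v(3) B(2) by (metis span_minimal subspace_span)
  then have "onb {..<n} v" using v by (intro onbI) auto
  then show ?thesis by (rule that)
qed

lemma onb_reindex:
  assumes v: "onb B v" and h: "bij_betw h A B"
  shows "onb A (\<lambda>i. v (h i))"
proof (rule onbI)
  have hA: "h i \<in> B" if "i \<in> A" for i using h that by (auto simp: bij_betw_def)
  show "finite A" using onb_finite[OF v] h by (simp add: bij_betw_finite)
  show "v (h i) \<in> vecs H" if "i \<in> A" for i using onb_vecs[OF v hA[OF that]] .
  show "ip H (v (h i)) (v (h j)) = (if i = j then 1 else 0)" if "i \<in> A" "j \<in> A" for i j
    using onb_ip[OF v hA hA] that h by (auto simp: bij_betw_def inj_on_def)
  have "(\<lambda>i. v (h i)) ` A = v ` B" using h by (auto simp: bij_betw_def)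
  then show "x \<in> span ((\<lambda>i. v (h i)) ` A)" if "x \<in> vecs H" for x using that onb_span[OF v] by simp
qed

text \<open>If \<open>x\<close> differed from its projection \<open>p\<close>, the normalized
  remainder would extend \<open>u\<close> to \<open>n + 1\<close> orthonormal vectors.\<close>

lemma orthonormal_full_onb:
  assumes v: "onb {..<n} v" and u: "\<And>i. i < n \<Longrightarrow> u i \<in> vecs H"
    "\<And>i j. i < n \<Longrightarrow> j < n \<Longrightarrow> ip H (u i) (u j) = (if i = j then 1 else 0)"
  shows "onb {..<n::nat} u"
proof (rule onbI)
  fix x assume x: "x \<in> vecs H"
  define p where "p = (\<Sum>i<n. scl H (ip H x (u i)) (u i))"
  have p: "p \<in> vecs H" unfolding p_def using u by (auto intro!: vecs_closed)
  have p': "p \<in> span (u ` {..<n})"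
    unfolding p_def by (intro span_sum span_scale span_base imageI) auto
  have "x = p"
  proof (rule ccontr)
    assume "x \<noteq> p"
    have orth: "ip H (x - p) (u j) = 0" if "j < n" for j
    proof -
      have "ip H p (u j) = ip H x (u j)" unfolding p_def using u that by (intro ip_lincomb) auto
      then show ?thesis using x p u that by (simp add: ip_diff)
    qed
    have xp: "x - p \<in> vecs H" "x - p \<noteq> 0" using x p \<open>x \<noteq> p\<close> by (auto intro: vecs_closed)
    from normalize[OF this] obtain c where c: "ip H (scl H c (x - p)) (scl H c (x - p)) = 1" by blast
    have orth': "ip H (u j) (scl H c (x - p)) = 0" if "j < n" for j
      using orth[OF that] u(1)[OF that] xp by (metis complex_cnj_zero ip_commute ip_scl_right mult_zero_right)
    have "card {..<Suc n} \<le> card {..<n}"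
    proof (rule orthonormal_card_le[OF v, where u = "u(n := scl H c (x - p))"])
      fix i j assume "i \<in> {..<Suc n}" "j \<in> {..<Suc n}"
      then show "ip H ((u(n := scl H c (x - p))) i) ((u(n := scl H c (x - p))) j) = (if i = j then 1 else 0)"
        using u c orth orth' xp by (auto simp: less_Suc_eq ip_scl)
    qed (use u xp in \<open>auto simp: less_Suc_eq vecs_closed\<close>)
    then show False by simp
  qed
  then show "x \<in> span (u ` {..<n})" using p' by simp
qed (use u in auto)

end

lemma linear_map_sum:
  assumes H: "hilbert H" and T: "linear_map H L T" and f: "\<And>i. i \<in> A \<Longrightarrow> f i \<in> vecs H"
    and fin: "finite A" and L: "hilbert L"
  shows "T (\<Sum>i\<in>A. scl H (c i) (f i)) = (\<Sum>i\<in>A. scl L (c i) (T (f i)))"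
proof -
  interpret H: hilbert H by (rule H)
  interpret L: hilbert L by (rule L)
  have T0: "T 0 = 0"
    using T H.vecs_closed(1) unfolding linear_map_def by (metis L.scale_zero_left H.scale_zero_left)
  show ?thesis
    using fin f
  proof (induction A rule: finite_induct)
    case (insert i A)
    have "(\<Sum>j\<in>A. scl H (c j) (f j)) \<in> vecs H" "scl H (c i) (f i) \<in> vecs H"
      using insert by (auto intro!: H.vecs_closed)
    then show ?case using insert T unfolding linear_map_def by simp
  qed (simp add: T0)
qed

section \<open>The spectral theorem for self-adjoint maps\<close>

lemma eigenvector_exists:
  assumes "hilbert H" and T: "linear_map H H T" and v: "hilbert.onb H {..<n::nat} v" and n: "n \<noteq> 0"
  obtains x c where "x \<in> vecs H" "x \<noteq> 0" "T x = scl H c x"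
proof -
  interpret hilbert H by fact
  have vv: "v i \<in> vecs H" if "i < n" for i using onb_vecs[OF v] that by simp
  have Tv: "T (v i) \<in> vecs H" if "i < n" for i using T vv[OF that] by (simp add: linear_map_def)
  define A where "A = mat n n (\<lambda>(i, j). ip H (T (v j)) (v i))"
  have A: "A \<in> carrier_mat n n" by (simp add: A_def)
  have "degree (char_poly A) = n" using degree_monic_char_poly[OF A] by simp
  then have "\<not> constant (poly (char_poly A))" using n by (simp add: constant_degree)
  then obtain c where "poly (char_poly A) c = 0" using fundamental_theorem_of_algebra by blast
  then have "eigenvalue A c" using eigenvalue_root_char_poly[OF A] by simp
  then obtain y where y: "y \<in> carrier_vec n" "y \<noteq> 0\<^sub>v n" "A *\<^sub>v y = c \<cdot>\<^sub>v y"
    using A by (auto simp: eigenvalue_def eigenvector_def)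
  define x where "x = (\<Sum>j<n. scl H (y $ j) (v j))"
  have x: "x \<in> vecs H" unfolding x_def using vv by (auto intro!: vecs_closed)
  have xv: "ip H x (v j) = y $ j" if "j < n" for j
    unfolding x_def using vv onb_ip[OF v] that by (intro ip_lincomb) auto
  obtain j where j: "j < n" "y $ j \<noteq> 0" using y by (metis carrier_vecD eq_vecI index_zero_vec(1) index_zero_vec(2))
  have "x \<noteq> 0" using xv[OF j(1)] j vv by auto
  moreover have "T x = scl H c x"
  proof (rule onb_eqI[OF v])
    show "T x \<in> vecs H" using T x by (simp add: linear_map_def)
    fix i assume i: "i \<in> {..<n}"
    have "T x = (\<Sum>j<n. scl H (y $ j) (T (v j)))"
      unfolding x_def by (rule linear_map_sum[OF hilbert_axioms T]) (use vv hilbert_axioms in auto)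
    moreover have "ip H (\<Sum>j<n. scl H (y $ j) (T (v j))) (v i) = (\<Sum>j<n. y $ j * ip H (T (v j)) (v i))"
      using vv Tv i by (intro ip_sum_scl) auto
    ultimately have "ip H (T x) (v i) = (\<Sum>j<n. y $ j * ip H (T (v j)) (v i))" by simp
    also have "\<dots> = (A *\<^sub>v y) $ i"
      using i y(1) by (simp add: A_def scalar_prod_def atLeast0LessThan mult.commute)
    also have "\<dots> = c * ip H x (v i)" using i y(1) xv by (simp add: y(3))
    finally show "ip H (T x) (v i) = ip H (scl H c x) (v i)" using x vv i by (simp add: ip_scl)
  qed (use x in \<open>auto intro: vecs_closed\<close>)
  ultimately show ?thesis using that x by blast
qed

text \<open>Only the carrier shrinks; ambient space and inner product stay, so the complement is
  again of type \<open>hilb\<close>. It is spanned by the projections of an orthonormal basis of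
  \<open>H\<close>.\<close>

lemma hilbert_orthogonal_complement:
  assumes "hilbert H" and e: "e \<in> vecs H" "ip H e e = 1"
  defines "K \<equiv> H\<lparr>vecs := {x \<in> vecs H. ip H x e = 0}\<rparr>"
  shows "hilbert K"
proof -
  interpret hilbert H by fact
  have sub: "subspace {x \<in> vecs H. ip H x e = 0}"
    unfolding subspace_def using e by (auto simp: ip_add ip_scl vecs_closed)
  obtain n and v :: "nat \<Rightarrow> 'a" where v: "onb {..<n} v" by (rule onb_exists)
  have vv: "v i \<in> vecs H" if "i < n" for i using onb_vecs[OF v] that by simp
  let ?p = "\<lambda>x. x - scl H (ip H x e) e"
  have p: "?p x \<in> {x \<in> vecs H. ip H x e = 0}" if "x \<in> vecs H" for x
    using that e by (auto simp: ip_diff ip_scl vecs_closed)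
  have "span ((\<lambda>i. ?p (v i)) ` {..<n}) = {x \<in> vecs H. ip H x e = 0}"
  proof
    show "span ((\<lambda>i. ?p (v i)) ` {..<n}) \<subseteq> {x \<in> vecs H. ip H x e = 0}"
      using p vv by (intro span_minimal[OF _ sub]) blast
    show "{x \<in> vecs H. ip H x e = 0} \<subseteq> span ((\<lambda>i. ?p (v i)) ` {..<n})"
    proof
      fix x assume "x \<in> {x \<in> vecs H. ip H x e = 0}"
      then have x: "x \<in> vecs H" "ip H x e = 0" by auto
      have "0 = ip H (\<Sum>i<n. scl H (ip H x (v i)) (v i)) e" using x onb_expand[OF v x(1)] by simp
      also have "\<dots> = (\<Sum>i<n. ip H x (v i) * ip H (v i) e)" using vv e by (intro ip_sum_scl) auto
      \<comment> \<open>Hence the components along \<open>e\<close> cancel when \<open>x\<close> is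
        written as a combination of the projected basis vectors.\<close>
      finally have z: "(\<Sum>i<n. ip H x (v i) * ip H (v i) e) = 0" by simp
      have "(\<Sum>i<n. scl H (ip H x (v i)) (?p (v i))) =
          (\<Sum>i<n. scl H (ip H x (v i)) (v i)) - scl H (\<Sum>i<n. ip H x (v i) * ip H (v i) e) e"
        by (simp add: scale_right_diff_distrib sum_subtractf scale_sum_left)
      then have "x = (\<Sum>i<n. scl H (ip H x (v i)) (?p (v i)))" using z onb_expand[OF v x(1)] by simp
      moreover have "\<dots> \<in> span ((\<lambda>i. ?p (v i)) ` {..<n})"
        by (intro span_sum span_scale span_base imageI) auto
      ultimately show "x \<in> span ((\<lambda>i. ?p (v i)) ` {..<n})" by simp
    qed
  qed
  then have "\<exists>B. finite B \<and> span B = {x \<in> vecs H. ip H x e = 0}"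
    by (intro exI[of _ "(\<lambda>i. ?p (v i)) ` {..<n}"]) auto
  then show ?thesis
    unfolding hilbert_def fd_hilbert_def K_def
    using sub vector_space_axioms by (auto simp: ip_add ip_scl ip_pos intro: ip_commute)
qed

text \<open>Induction on the dimension: since \<open>T\<close> is self-adjoint, it leaves the
  orthogonal complement \<open>K\<close> of an eigenvector \<open>e\<close> invariant.\<close>

theorem spectral:
  assumes "hilbert H" and T: "linear_map H H T"
    and sa: "\<And>x y. x \<in> vecs H \<Longrightarrow> y \<in> vecs H \<Longrightarrow> ip H (T x) y = ip H x (T y)"
    and u: "hilbert.onb H {..<n::nat} u"
  shows "\<exists>v \<mu>. hilbert.onb H {..<n} v \<and> (\<forall>i<n. T (v i) = scl H (of_real (\<mu> i)) (v i))"
  using assms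
proof (induction n arbitrary: H u)
  case 0
  then show ?case by auto
next
  case (Suc n)
  interpret hilbert H by fact
  note T = Suc.prems(2) and sa = Suc.prems(3)
  obtain x c where x: "x \<in> vecs H" "x \<noteq> 0" "T x = scl H c x"
    by (rule eigenvector_exists[OF Suc.prems(1,2,4)]) auto
  obtain a where a: "a \<noteq> 0" "ip H (scl H a x) (scl H a x) = 1" using normalize[OF x(1,2)] .
  define e where "e = scl H a x"
  have e: "e \<in> vecs H" "ip H e e = 1" "T e = scl H c e"
    using x a T by (auto simp: e_def vecs_closed linear_map_def mult.commute)
  have "c = cnj c" using sa[OF e(1,1)] e by (simp add: ip_scl ip_scl_right)
  then have c: "c = of_real (Re c)" by (auto simp: complex_eq_iff)
  define K where "K = H\<lparr>vecs := {x \<in> vecs H. ip H x e = 0}\<rparr>"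
  have K: "hilbert K" unfolding K_def by (rule hilbert_orthogonal_complement[OF Suc.prems(1) e(1,2)])
  interpret K: hilbert K by (rule K)
  have Kv: "y \<in> vecs K \<longleftrightarrow> y \<in> vecs H \<and> ip H y e = 0" for y by (simp add: K_def)
  have Ks: "scl K = scl H" "ip K = ip H" by (simp_all add: K_def)
  have TK: "linear_map K K T"
    using T sa e unfolding linear_map_def K_def by (auto simp: ip_scl_right)
  \<comment> \<open>Used twice: with an arbitrary orthonormal basis of \<open>K\<close>, to see that
    it has \<open>n\<close> elements, and with the eigenbasis from the induction hypothesis.\<close>
  have combine: "onb {..<Suc m} (case_nat e w)" if w: "K.onb {..<m} w" for m w
  proof (rule onbI)
    have wm: "w i \<in> vecs H" "ip H (w i) e = 0" if "i < m" for i
      using K.onb_vecs[OF w, of i] that Kv by auto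
    have ew: "ip H e (w i) = 0" if "i < m" for i
      using ip_commute[OF wm(1)[OF that] e(1)] wm(2)[OF that] by simp
    have wi: "ip H (w i) (w j) = (if i = j then 1 else 0)" if "i < m" "j < m" for i j
      using K.onb_ip[OF w, of i j] that Ks by simp
    show "case_nat e w i \<in> vecs H" if "i \<in> {..<Suc m}" for i
      using that e wm by (auto split: nat.split)
    show "ip H (case_nat e w i) (case_nat e w j) = (if i = j then 1 else 0)"
      if "i \<in> {..<Suc m}" "j \<in> {..<Suc m}" for i j
      using that e wm ew wi by (auto split: nat.split)
    fix y assume y: "y \<in> vecs H"
    have "y - scl H (ip H y e) e \<in> vecs K" using y e by (auto simp: Kv ip_diff ip_scl vecs_closed)
    then have "y - scl H (ip H y e) e \<in> span (w ` {..<m})" using K.onb_span[OF w] Ks by simp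
    moreover have "w ` {..<m} \<subseteq> case_nat e w ` {..<Suc m}" by (force simp: image_iff)
    ultimately have "y - scl H (ip H y e) e \<in> span (case_nat e w ` {..<Suc m})" using span_mono by blast
    moreover have "e \<in> span (case_nat e w ` {..<Suc m})" by (rule span_base) (force simp: image_iff)
    ultimately have "(y - scl H (ip H y e) e) + scl H (ip H y e) e \<in> span (case_nat e w ` {..<Suc m})"
      by (intro span_add span_scale)
    then show "y \<in> span (case_nat e w ` {..<Suc m})" by simp
  qed auto
  obtain m and w :: "nat \<Rightarrow> 'a" where w: "K.onb {..<m} w" by (rule K.onb_exists)
  have "m = n" using onb_card_unique[OF combine[OF w] Suc.prems(4)] by simp
  have "ip K (T x) y = ip K x (T y)" if "x \<in> vecs K" "y \<in> vecs K" for x y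
    using sa that Kv Ks by simp
  from Suc.IH[OF K TK this, of w] w \<open>m = n\<close> obtain v \<mu> where
    v: "K.onb {..<n} v" "\<And>i. i < n \<Longrightarrow> T (v i) = scl H (of_real (\<mu> i)) (v i)"
    by (auto simp: Ks)
  show ?case
    using combine[OF v(1)] v(2) e(3) c
    by (intro exI[of _ "case_nat e v"] exI[of _ "case_nat (Re c) \<mu>"]) (auto split: nat.split)
qed

lemma unitary_map_onb:
  assumes "hilbert H" "hilbert L" and v: "hilbert.onb H A v" and w: "hilbert.onb L A w"
  defines "U \<equiv> \<lambda>x. \<Sum>i\<in>A. scl L (ip H x (v i)) (w i)"
  shows "unitary_map H L U" and "\<And>i. i \<in> A \<Longrightarrow> U (v i) = w i"
proof -
  interpret H: hilbert H by fact
  interpret L: hilbert L by fact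
  note vv = H.onb_vecs[OF v] and wv = L.onb_vecs[OF w] and fin = H.onb_finite[OF v]
  show Uv: "U (v i) = w i" if "i \<in> A" for i
  proof -
    have "U (v i) = (\<Sum>j\<in>A. if j = i then w i else 0)"
      unfolding U_def by (rule sum.cong) (use that H.onb_ip[OF v that] in auto)
    then show ?thesis using that fin by simp
  qed
  have UL: "U x \<in> vecs L" for x unfolding U_def using wv by (auto intro!: L.vecs_closed)
  have lin: "linear_map H L U"
    unfolding linear_map_def
  proof (intro conjI ballI allI)
    show "U (x + y) = U x + U y" if "x \<in> vecs H" "y \<in> vecs H" for x y
      unfolding U_def using that vv by (simp add: H.ip_add L.scale_left_distrib flip: sum.distrib)
    show "U (scl H c x) = scl L c (U x)" if "x \<in> vecs H" for c x
      unfolding U_def using that vv by (simp add: H.ip_scl L.scale_sum_right)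
  qed (rule UL)
  have Uw: "ip L (U x) (w j) = ip H x (v j)" if "j \<in> A" for x j
    unfolding U_def using wv L.onb_ip[OF w] that fin by (intro L.ip_lincomb) auto
  have "ip L (U x) (U y) = ip H x y" if "x \<in> vecs H" "y \<in> vecs H" for x y
    using L.onb_parseval[OF w UL UL, of x y] H.onb_parseval[OF v that] Uw by (simp cong: sum.cong)
  moreover have "U ` vecs H = vecs L"
  proof (intro equalityI subsetI)
    fix z assume z: "z \<in> vecs L"
    let ?x = "\<Sum>i\<in>A. scl H (ip L z (w i)) (v i)"
    have x: "?x \<in> vecs H" using vv by (auto intro!: H.vecs_closed)
    have "ip H ?x (v j) = ip L z (w j)" if "j \<in> A" for j
      using vv H.onb_ip[OF v] that fin by (intro H.ip_lincomb) auto
    then have "U ?x = z"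
      by (intro L.onb_eqI[OF w UL z]) (simp add: Uw)
    then show "z \<in> U ` vecs H" using x by (metis imageI)
  qed (use UL in auto)
  ultimately show "unitary_map H L U" using lin by (simp add: unitary_map_def)
qed

lemma linear_map_eq_onb:
  assumes "hilbert H" "hilbert L" and v: "hilbert.onb H A v" and "linear_map H L S" "linear_map H L T"
    and "\<And>i. i \<in> A \<Longrightarrow> S (v i) = T (v i)" "x \<in> vecs H"
  shows "S x = T x"
proof -
  interpret H: hilbert H by fact
  have "S (\<Sum>i\<in>A. scl H (ip H x (v i)) (v i)) = T (\<Sum>i\<in>A. scl H (ip H x (v i)) (v i))"
    using assms(6) linear_map_sum[OF assms(1,4) H.onb_vecs[OF v] H.onb_finite[OF v] assms(2)]
      linear_map_sum[OF assms(1,5) H.onb_vecs[OF v] H.onb_finite[OF v] assms(2)] by simp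
  then show ?thesis using H.onb_expand[OF v assms(7)] by simp
qed

lemma onb_tensor:
  assumes "hilbert H" "hilbert L" "hilbert M" and t: "is_tensor H L M t"
    and v: "hilbert.onb H A v" and w: "hilbert.onb L B w"
  shows "hilbert.onb M (A \<times> B) (\<lambda>(i, j). t (v i) (w j))"
proof -
  interpret H: hilbert H by fact
  interpret L: hilbert L by fact
  interpret M: hilbert M by fact
  note vv = H.onb_vecs[OF v] and wv = L.onb_vecs[OF w]
  have tl: "linear_map H M (\<lambda>x. t x y)" if "y \<in> vecs L" for y using t that by (simp add: is_tensor_def)
  have tr: "linear_map L M (t x)" if "x \<in> vecs H" for x using t that by (simp add: is_tensor_def)
  have ipt: "ip M (t x y) (t x' y') = ip H x x' * ip L y y'"
    if "x \<in> vecs H" "x' \<in> vecs H" "y \<in> vecs L" "y' \<in> vecs L" for x x' y y'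
    using t that by (simp add: is_tensor_def)
  let ?e = "\<lambda>(i, j). t (v i) (w j)"
  show ?thesis
  proof (rule M.onbI)
    show "finite (A \<times> B)" using H.onb_finite[OF v] L.onb_finite[OF w] by simp
    show "?e i \<in> vecs M" if "i \<in> A \<times> B" for i
      using that vv wv tr unfolding linear_map_def by auto
    show "ip M (?e i) (?e j) = (if i = j then 1 else 0)" if "i \<in> A \<times> B" "j \<in> A \<times> B" for i j
      using that vv wv by (auto simp: ipt H.onb_ip[OF v] L.onb_ip[OF w] split: if_splits)
    have "{t x y | x y. x \<in> vecs H \<and> y \<in> vecs L} \<subseteq> M.span (?e ` (A \<times> B))"
    proof clarify
      fix x y assume x: "x \<in> vecs H" and y: "y \<in> vecs L"
      have "t x y = t (\<Sum>i\<in>A. scl H (ip H x (v i)) (v i)) y" by (simp add: H.onb_expand[OF v x])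
      also have "\<dots> = (\<Sum>i\<in>A. scl M (ip H x (v i)) (t (v i) y))"
        by (rule linear_map_sum[OF assms(1) tl[OF y] vv H.onb_finite[OF v] assms(3)])
      also have "\<dots> = (\<Sum>i\<in>A. scl M (ip H x (v i)) (t (v i) (\<Sum>j\<in>B. scl L (ip L y (w j)) (w j))))"
        by (simp add: L.onb_expand[OF w y])
      also have "\<dots> = (\<Sum>i\<in>A. scl M (ip H x (v i)) (\<Sum>j\<in>B. scl M (ip L y (w j)) (t (v i) (w j))))"
        by (intro sum.cong refl arg_cong[where f = "scl M _"]
            linear_map_sum[OF assms(2) tr[OF vv] wv L.onb_finite[OF w] assms(3)])
      also have "\<dots> \<in> M.span (?e ` (A \<times> B))"
        by (intro M.span_sum M.span_scale M.span_base) auto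
      finally show "t x y \<in> M.span (?e ` (A \<times> B))" .
    qed
    then have "M.span {t x y | x y. x \<in> vecs H \<and> y \<in> vecs L} \<subseteq> M.span (?e ` (A \<times> B))"
      by (rule M.span_minimal[OF _ M.subspace_span])
    moreover have "M.span {t x y | x y. x \<in> vecs H \<and> y \<in> vecs L} = vecs M"
      using t by (simp add: is_tensor_def)
    ultimately show "x \<in> M.span (?e ` (A \<times> B))" if "x \<in> vecs M" for x using that by blast
  qed
qed

section \<open>Generation of diagrams by cups, bending and reflection\<close>

fun bend :: "vertex \<Rightarrow> vertex" where
  "bend (Up i) = Up (Suc i)"
| "bend (Lo 0) = Up 0"
| "bend (Lo (Suc j)) = Lo j"

definition bend_diagram :: "diagram \<Rightarrow> diagram" where
  "bend_diagram D = map_prod bend bend ` D"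

text \<open>Obtained from bending by reflection, so that the inverse of bending needs no case of its
  own in the induction on diagrams.\<close>

definition unbend_diagram :: "diagram \<Rightarrow> diagram" where
  "unbend_diagram D = reflect (bend_diagram (reflect D))"

text \<open>The two basic arcs; \<open>cap LXstar\<close> is the diagram of
  \<open>eps_Xstar\<close>.\<close>

definition cap :: "letter \<Rightarrow> diagram" where
  "cap a = (if a = LX then {(Up 0, Up 1)} else {(Up 1, Up 0)})"

definition cup :: "letter \<Rightarrow> diagram" where
  "cup a = (if a = LX then {(Lo 1, Lo 0)} else {(Lo 0, Lo 1)})"

lemma reflect_cap: "reflect (cap a) = cup a" and reflect_cup: "reflect (cup a) = cap a"
  by (auto simp: cap_def cup_def reflect_def)

lemma pos_bend: "pos (bend p) = pos p - 1"
  by (cases p rule: bend.cases) auto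

lemma bend_inject [simp]: "bend p = bend q \<longleftrightarrow> p = q"
proof
  assume "bend p = bend q"
  then have "pos (bend p) = pos (bend q)" by simp
  then show "p = q" by (simp add: pos_bend)
qed simp

lemma bend_sources: "bend ` sources u (a # v) = sources (dual a # u) v"
  (is "?L = ?R")
proof (rule Set.set_eqI)
  fix p
  have eq: "p \<in> ?L \<longleftrightarrow> (\<exists>q \<in> sources u (a # v). bend q = p)" by auto
  show "p \<in> ?L \<longleftrightarrow> p \<in> ?R"
  proof (cases p)
    case (Up i)
    show ?thesis
    proof (cases i)
      case 0
      then have "bend q = p \<longleftrightarrow> q = Lo 0" for q using Up by (cases q rule: bend.cases) auto
      then show ?thesis unfolding eq by (auto simp: Up 0)
    next
      case (Suc j)
      then have "bend q = p \<longleftrightarrow> q = Up j" for q using Up by (cases q rule: bend.cases) auto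
      then show ?thesis unfolding eq by (auto simp: Up Suc)
    qed
  next
    case (Lo j)
    then have "bend q = p \<longleftrightarrow> q = Lo (Suc j)" for q by (cases q rule: bend.cases) auto
    then show ?thesis unfolding eq by (auto simp: Lo)
  qed
qed

lemma bend_targets: "bend ` targets u (a # v) = targets (dual a # u) v"
  by (simp add: targets_eq_sources_dual bend_sources)

text \<open>A translation of all positions preserves crossings. The letter is dualized because a
  starting vertex is labelled X on the upper edge and X* on the lower one.\<close>

lemma bend_kauffman:
  assumes D: "D \<in> kauffman u (a # v)"
  shows "bend_diagram D \<in> kauffman (dual a # u) v"
proof -
  have "single_valued D" "single_valued (D\<inverse>)" "Domain D = sources u (a # v)" "Range D = targets u (a # v)"
    using D by (auto simp: kauffman_iff simp del: Domain_iff Range_iff)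
  then have "single_valued (bend_diagram D)" "single_valued ((bend_diagram D)\<inverse>)"
    "Domain (bend_diagram D) = sources (dual a # u) v" "Range (bend_diagram D) = targets (dual a # u) v"
    by (auto simp: bend_diagram_def Domain_map_prod Range_map_prod bend_sources bend_targets single_valued_def
        simp del: Domain_iff Range_iff)
  moreover have "\<not> crosses s t" if st: "s \<in> bend_diagram D" "t \<in> bend_diagram D" for s t
  proof -
    obtain p q p' q' where e: "s = (bend p, bend q)" "t = (bend p', bend q')" "(p, q) \<in> D" "(p', q') \<in> D"
      using st by (auto simp: bend_diagram_def)
    then have "\<not> crosses (p, q) (p', q')" using D unfolding kauffman_iff by blast
    then show ?thesis unfolding e crosses_iff_int_cross int_cross_def fst_conv snd_conv pos_bend by linarith
  qed
  ultimately show ?thesis unfolding kauffman_iff by blast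
qed

lemma unbend_kauffman: "D \<in> kauffman (a # u) v \<Longrightarrow> unbend_diagram D \<in> kauffman u (dual a # v)"
  unfolding unbend_diagram_def by (intro reflect_kauffman bend_kauffman)

lemma flip_bend: "flip (bend (flip (bend p))) = p"
  by (cases p rule: bend.cases) auto

lemma bend_flip: "bend (flip (bend (flip p))) = p"
  by (metis flip_bend flip_flip)

lemma unbend_bend [simp]: "unbend_diagram (bend_diagram D) = D"
  unfolding unbend_diagram_def bend_diagram_def reflect_eq_image image_image
  by (force simp: flip_bend image_iff)

lemma bend_unbend [simp]: "bend_diagram (unbend_diagram D) = D"
  unfolding unbend_diagram_def bend_diagram_def reflect_eq_image image_image
  by (force simp: bend_flip image_iff)

lemma cap_kauffman: "cap a \<in> kauffman [a, dual a] []"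
proof -
  have "sources [a, dual a] [] = {if a = LX then Up 0 else Up 1}"
    by (cases a) (auto simp: sources_def less_Suc_eq)
  moreover have "targets [a, dual a] [] = {if a = LX then Up 1 else Up 0}"
    by (cases a) (auto simp: targets_def less_Suc_eq)
  moreover have "cap a = {(if a = LX then Up 0 else Up 1, if a = LX then Up 1 else Up 0)}"
    by (simp add: cap_def)
  ultimately show ?thesis
    by (simp add: kauffman_iff single_valued_def crosses_def)
qed

lemma cup_kauffman: "cup a \<in> kauffman [] [a, dual a]"
  using reflect_kauffman[OF cap_kauffman[of a]] by (simp add: reflect_cap)

lemma cycle_not_outer:
  assumes "glued u v w t G" "(x, x) \<in> G\<^sup>+"
  shows "x \<notin> range outer_node"
proof
  assume "x \<in> range outer_node"
  then obtain p where x: "x = outer_node p" by auto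
  have "x \<in> Domain G" "x \<in> Range G" using assms(2) by (meson Domain.simps Range.simps tranclD tranclD2)+
  then have "p \<in> sources u w" "p \<in> targets u w"
    using assms(1) x by (auto simp: glued_def node_sources_def node_targets_def simp del: Domain_iff Range_iff)
  then show False using sources_targets_disjoint by blast
qed

text \<open>Lying on a cycle spreads along edges in both directions. Together with
  \<open>cycle_not_outer\<close> this excludes closed loops when every middle vertex is connected to
  an outer one.\<close>

lemma cycle_step:
  assumes sv: "single_valued G" "single_valued (G\<inverse>)" and x: "(x, x) \<in> G\<^sup>+"
  shows "(x, y) \<in> G \<Longrightarrow> (y, y) \<in> G\<^sup>+" "(y, x) \<in> G \<Longrightarrow> (y, y) \<in> G\<^sup>+"
proof -
  assume xy: "(x, y) \<in> G"
  from x obtain z where "(x, z) \<in> G" "(z, x) \<in> G\<^sup>*" by (meson tranclD)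
  then have "(y, x) \<in> G\<^sup>*" using xy sv by (auto simp: single_valued_def)
  then show "(y, y) \<in> G\<^sup>+" using xy by (rule rtrancl_into_trancl1)
next
  assume yx: "(y, x) \<in> G"
  from x obtain z where "(x, z) \<in> G\<^sup>*" "(z, x) \<in> G" by (meson tranclD2)
  moreover have "z = y" using \<open>(z, x) \<in> G\<close> yx sv(2) by (auto simp: single_valued_def)
  ultimately show "(y, y) \<in> G\<^sup>+" using yx by (meson rtrancl_into_trancl2)
qed

lemma id_diagram_single: "id_diagram [b] = (if b = LX then {(Up 0, Lo 0)} else {(Lo 0, Up 0)})"
  by (simp add: id_diagram_def lessThan_Suc)

text \<open>For \<open>D = cup a\<close> this is the snake identity.\<close>

lemma stack_bend:
  assumes D: "D \<in> kauffman u (a # v)"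
  defines "S \<equiv> juxtapose 1 1 (id_diagram [dual a]) D"
    and "T \<equiv> juxtapose 2 0 (cap (dual a)) (id_diagram v)"
  shows "S \<in> kauffman (dual a # u) (dual a # a # v)" and "T \<in> kauffman (dual a # a # v) v"
    and "stack S T = bend_diagram D" and "loops S T = 0"
proof -
  show S: "S \<in> kauffman (dual a # u) (dual a # a # v)"
    using juxtapose_kauffman[OF id_diagram_kauffman[of "[dual a]"] D] by (simp add: S_def)
  show T: "T \<in> kauffman (dual a # a # v) v"
    using juxtapose_kauffman[OF cap_kauffman[of "dual a"] id_diagram_kauffman[of v]]
    by (simp add: T_def numeral_2_eq_2)
  let ?G = "glue S T"
  note gl = glued_glue[OF S T]
  have sv: "single_valued ?G" "single_valued (?G\<inverse>)" using gl by (auto simp: glued_def)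
  \<comment> \<open>\<open>n\<close> embeds the vertices of \<open>D\<close> into the glued graph,
    to the right of the added identity string.\<close>
  define n where "n p = upper_node (shift 1 1 p)" for p
  have n [simp]: "n (Up i) = Top (Suc i)" "n (Lo j) = Mid (Suc j)" for i j by (simp_all add: n_def)
  have e0: "(Top 0, Mid 0) \<in> ?G" "(Mid 0, Mid (Suc 0)) \<in> ?G" if "a = LXstar"
    using that by (force simp: glue_def S_def T_def juxtapose_def id_diagram_single cap_def image_iff)+
  have e1: "(Mid 0, Top 0) \<in> ?G" "(Mid (Suc 0), Mid 0) \<in> ?G" if "a = LX"
    using that by (force simp: glue_def S_def T_def juxtapose_def id_diagram_single cap_def image_iff)+
  have eD: "(n p, n q) \<in> ?G" if "(p, q) \<in> D" for p q
    using that by (force simp: glue_def S_def juxtapose_def n_def image_iff)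
  have idT: "map_prod (shift 2 0) (shift 2 0) ` id_diagram v \<subseteq> T" by (simp add: T_def juxtapose_def)
  have e2: "(Mid (Suc (Suc j)), Bot j) \<in> ?G" if "j < length v" "v ! j = LX" for j
  proof -
    have "(Up j, Lo j) \<in> id_diagram v" using that by (auto simp: id_diagram_def image_iff)
    then have "(shift 2 0 (Up j), shift 2 0 (Lo j)) \<in> T" using idT by blast
    then have "(lower_node (shift 2 0 (Up j)), lower_node (shift 2 0 (Lo j))) \<in> ?G" unfolding glue_def by blast
    then show ?thesis by simp
  qed
  have e3: "(Bot j, Mid (Suc (Suc j))) \<in> ?G" if "j < length v" "v ! j = LXstar" for j
  proof -
    have "(Lo j, Up j) \<in> id_diagram v" using that by (force simp: id_diagram_def image_iff)
    then have "(shift 2 0 (Lo j), shift 2 0 (Up j)) \<in> T" using idT by blast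
    then have "(lower_node (shift 2 0 (Lo j)), lower_node (shift 2 0 (Up j))) \<in> ?G" unfolding glue_def by blast
    then show ?thesis by simp
  qed
  \<comment> \<open>An upper vertex of \<open>D\<close> is already at its bent place; the first
    lower vertex reaches it through the cap and the added string, the others through the identity of
    \<open>v\<close>.\<close>
  have src: "(outer_node (bend p), n p) \<in> ?G\<^sup>*" if "p \<in> sources u (a # v)" for p
    using that by (cases p rule: bend.cases) (auto intro: e0 e3 rtrancl_trans[OF r_into_rtrancl r_into_rtrancl])
  have tgt: "(n p, outer_node (bend p)) \<in> ?G\<^sup>*" if "p \<in> targets u (a # v)" for p
    using that by (cases p rule: bend.cases) (auto intro: e1 e2 rtrancl_trans[OF r_into_rtrancl r_into_rtrancl])
  have "bend_diagram D \<subseteq> stack S T"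
  proof
    fix s assume "s \<in> bend_diagram D"
    then obtain p q where s: "s = (bend p, bend q)" "(p, q) \<in> D" by (auto simp: bend_diagram_def)
    have "(outer_node (bend p), outer_node (bend q)) \<in> ?G\<^sup>+"
      using src tgt kauffman_source_target[OF D s(2)] eD[OF s(2)]
      by (meson rtrancl_into_trancl1 rtrancl_trancl_trancl trancl_rtrancl_trancl)
    then show "s \<in> stack S T" by (simp add: s stack_def)
  qed
  then show "stack S T = bend_diagram D"
    using kauffman_subset_eq[OF bend_kauffman[OF D] stack_kauffman[OF S T]] by simp
  \<comment> \<open>A cycle would spread from \<open>Mid 1\<close> to \<open>Mid 0\<close> and on to
    \<open>Top 0\<close>, and from each later middle vertex to a bottom vertex.\<close>
  have "(x, x) \<notin> ?G\<^sup>+" for x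
  proof
    assume x: "(x, x) \<in> ?G\<^sup>+"
    note out = cycle_not_outer[OF gl] and st = cycle_step[OF sv]
    have noT: "(Top i, Top i) \<notin> ?G\<^sup>+" "(Bot i, Bot i) \<notin> ?G\<^sup>+" for i
      using out[of "Top i"] out[of "Bot i"] by (metis outer_node.simps rangeI)+
    have no0: "(Mid 0, Mid 0) \<notin> ?G\<^sup>+"
      using st[of "Mid 0" "Top 0"] noT e0 e1 by (cases a) auto
    have no1: "(Mid (Suc 0), Mid (Suc 0)) \<notin> ?G\<^sup>+"
      using st[of "Mid (Suc 0)" "Mid 0"] no0 e0 e1 by (cases a) auto
    have no2: "(Mid (Suc (Suc j)), Mid (Suc (Suc j))) \<notin> ?G\<^sup>+" if "j < length v" for j
      using st[of "Mid (Suc (Suc j))" "Bot j"] noT e2 e3 that by (cases "v ! j") auto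
    from x have "x \<in> Domain ?G" by (meson Domain.simps tranclD)
    then have "x \<in> node_sources (dual a # u) v (length (dual a # a # v))" using gl by (simp add: glued_def)
    then show False using x out no0 no1 no2
      by (auto simp: node_sources_def less_Suc_eq_0_disj)
  qed
  then have "cycles ?G = {}" by (simp add: cycles_def)
  then show "loops S T = 0" by (simp add: loops_eq_card_cycles)
qed

section \<open>Innermost strings and splitting off a cup\<close>

lemma ends_unique:
  assumes "D \<in> kauffman u v" "s \<in> D" "t \<in> D" "p = fst s \<or> p = snd s" "p = fst t \<or> p = snd t"
  shows "s = t"
proof -
  obtain a b c d where e: "s = (a, b)" "t = (c, d)" by (metis prod.collapse)
  have "single_valued D" "single_valued (D\<inverse>)" using assms(1) by (auto simp: kauffman_iff)
  moreover have "a \<in> sources u v" "b \<in> targets u v" "c \<in> sources u v" "d \<in> targets u v"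
    using kauffman_source_target[OF assms(1)] assms(2,3) e by blast+
  ultimately show ?thesis using assms(2-) sources_targets_disjoint[of u v] unfolding e single_valued_def
    by auto
qed

lemma pos_surj:
  assumes "- int m \<le> k" "k < int n"
  obtains p where "p \<in> vertices m n" "pos p = k"
proof (cases "k < 0")
  case True
  then have "pos (Up (nat (- k - 1))) = k" "nat (- k - 1) < m" using assms by auto
  then show ?thesis using that[of "Up (nat (- k - 1))"] by (auto simp: vertices_def)
next
  case False
  then have "pos (Lo (nat k)) = k" "nat k < n" using assms by auto
  then show ?thesis using that[of "Lo (nat k)"] by (auto simp: vertices_def)
qed

text \<open>In a string \<open>s\<close> of least span, a vertex strictly between the ends would
  belong to a string that cannot cross \<open>s\<close> and so would have a smaller span.\<close>

lemma adjacent_string: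
  assumes D: "D \<in> kauffman u v" and ne: "D \<noteq> {}"
  shows "\<exists>s\<in>D. right_end s = left_end s + 1"
proof -
  obtain s where s: "s \<in> D" "\<And>t. t \<in> D \<Longrightarrow> nat (right_end s - left_end s) \<le> nat (right_end t - left_end t)"
    using ex_has_least_nat[of "\<lambda>s. s \<in> D" _ "\<lambda>s. nat (right_end s - left_end s)"] ne by blast
  obtain a b where ab: "s = (a, b)" by force
  have inV: "pos p < int (length v)" "- int (length u) \<le> pos p" if "t \<in> D" "p = fst t \<or> p = snd t" for t p
    using kauffman_source_target[OF D, of "fst t" "snd t"] that pos_less[of p u v] pos_ge[of p u v] by auto
  have "a \<noteq> b" using kauffman_source_target[OF D] s(1) ab sources_targets_disjoint by blast
  then have "pos a \<noteq> pos b" by simp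
  then have lr: "left_end s < right_end s" unfolding ab left_end_def right_end_def fst_conv snd_conv by linarith
  have "right_end s = left_end s + 1"
  proof (rule ccontr)
    assume "right_end s \<noteq> left_end s + 1"
    then have gap: "left_end s + 1 < right_end s" using lr by simp
    have "right_end s < int (length v)" "- int (length u) \<le> left_end s"
      using inV[OF s(1)] by (auto simp: ab left_end_def right_end_def)
    then obtain p where p: "p \<in> vertices (length u) (length v)" "pos p = left_end s + 1"
      using pos_surj[of "length u" "left_end s + 1" "length v"] gap by auto
    then have "p \<in> Domain D \<union> Range D"
      using D sources_Un_targets[of u v] by (auto simp: kauffman_iff simp del: Domain_iff Range_iff)
    then obtain t where t: "t \<in> D" "p = fst t \<or> p = snd t" by force
    obtain c e where ce: "t = (c, e)" by force
    have "p \<noteq> a" "p \<noteq> b" using p(2) gap by (auto simp: ab left_end_def right_end_def min_def max_def split: if_splits)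
    then have "s \<noteq> t" using t by (auto simp: ab)
    then have "c \<noteq> a" "c \<noteq> b" "e \<noteq> a" "e \<noteq> b" using ends_unique[OF D s(1) t(1)] ab ce by auto
    then have "pos c \<noteq> pos a" "pos c \<noteq> pos b" "pos e \<noteq> pos a" "pos e \<noteq> pos b" by auto
    moreover have "\<not> crosses s t" "\<not> crosses t s" using D s t by (auto simp: kauffman_iff)
    ultimately have "right_end t - left_end t < right_end s - left_end s" "left_end t \<le> right_end t"
      using t p gap unfolding crosses_def ab ce left_end_def right_end_def
      by (auto simp: min_def max_def split: if_splits)
    then show False using s(2)[OF t(1)] by simp
  qed
  then show ?thesis using s by blast
qed

text \<open>Positions 0 and 1 are the first two lower vertices, so \<open>s\<close> is a cup there,
  and by uniqueness of ends every other string avoids both vertices.\<close>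

lemma split_cup:
  assumes D: "D \<in> kauffman u w" and s: "s \<in> D" "left_end s = 0" "right_end s = 1"
  shows "\<exists>a v D'. w = a # dual a # v \<and> D' \<in> kauffman u v \<and> D = juxtapose 0 2 (cup a) D'"
proof -
  obtain p q where pq: "s = (p, q)" by force
  have p0: "pos x = 0 \<longleftrightarrow> x = Lo 0" "pos x = 1 \<longleftrightarrow> x = Lo 1" for x by (cases x; auto)+
  from s(2,3) have "pos p = 0 \<and> pos q = 1 \<or> pos p = 1 \<and> pos q = 0"
    unfolding pq left_end_def right_end_def by (auto simp: min_def max_def split: if_splits)
  then have cases: "(Lo 0, Lo 1) \<in> D \<or> (Lo 1, Lo 0) \<in> D" using s(1) pq p0 by auto
  then have len: "1 < length w" using kauffman_source_target[OF D] by fastforce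
  then obtain a b v where w: "w = a # b # v" by (metis Suc_less_eq length_Cons length_greater_0_conv list.exhaust list.size(3) not_less_zero One_nat_def less_one)
  have b: "b = dual a" and cupD: "cup a \<subseteq> D"
    using cases kauffman_source_target[OF D, of "Lo 0" "Lo 1"] kauffman_source_target[OF D, of "Lo 1" "Lo 0"]
    by (auto simp: w cup_def)
  define D' where "D' = {(p, q). (shift 0 2 p, shift 0 2 q) \<in> D}"
  have shift_cases: "x = Lo 0 \<or> x = Lo 1 \<or> (\<exists>y. x = shift 0 2 y)" for x
  proof (cases x)
    case (Up i)
    then have "x = shift 0 2 (Up i)" by simp
    then show ?thesis by blast
  next
    case (Lo j)
    show ?thesis
    proof (cases "j < 2")
      case False
      then have "x = shift 0 2 (Lo (j - 2))" using Lo by simp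
      then show ?thesis by blast
    qed (use Lo in \<open>auto simp: less_2_cases_iff\<close>)
  qed
  have shift_neq: "shift 0 2 x \<noteq> Lo 0" "shift 0 2 x \<noteq> Lo 1" for x by (cases x; simp)+
  obtain c where c: "cup a = {c}" "c = (Lo 0, Lo 1) \<or> c = (Lo 1, Lo 0)" by (cases a) (auto simp: cup_def)
  have rest: "(x, y) = c \<or> (\<exists>x' y'. x = shift 0 2 x' \<and> y = shift 0 2 y')" if xy: "(x, y) \<in> D" for x y
  proof (cases "x \<in> {Lo 0, Lo 1} \<or> y \<in> {Lo 0, Lo 1}")
    case True
    then obtain p where p: "p = x \<or> p = y" "p = Lo 0 \<or> p = Lo 1" by blast
    moreover have "p = fst c \<or> p = snd c" using p(2) c(2) by auto
    ultimately have "(x, y) = c" using ends_unique[OF D xy, of c p] c cupD by auto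
    then show ?thesis by simp
  qed (use shift_cases in blast)
  have eq: "D = juxtapose 0 2 (cup a) D'"
  proof
    show "D \<subseteq> juxtapose 0 2 (cup a) D'"
      using rest unfolding juxtapose_def c D'_def by (force simp: image_iff)
    show "juxtapose 0 2 (cup a) D' \<subseteq> D"
      using cupD by (auto simp: juxtapose_def D'_def)
  qed
  have sv: "single_valued D" "single_valued (D\<inverse>)" and dom: "Domain D = sources u w" "Range D = targets u w"
    using D by (auto simp: kauffman_iff simp del: Domain_iff Range_iff)
  have sh: "shift 0 2 x \<in> sources u w \<longleftrightarrow> x \<in> sources u v" "shift 0 2 x \<in> targets u w \<longleftrightarrow> x \<in> targets u v" for x
    by (cases x; simp add: w)+
  have "single_valued D'" "single_valued (D'\<inverse>)"
    using sv by (auto simp: D'_def intro!: single_valuedI dest: single_valuedD)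
  moreover have "Domain D' = sources u v"
  proof (intro equalityI subsetI)
    fix x assume "x \<in> sources u v"
    then have "shift 0 2 x \<in> Domain D" using sh dom by simp
    then obtain y where y: "(shift 0 2 x, y) \<in> D" by blast
    then obtain y' where "y = shift 0 2 y'" using rest[OF y] c shift_neq by auto
    then show "x \<in> Domain D'" using y by (auto simp: D'_def)
  next
    fix x assume "x \<in> Domain D'"
    then have "shift 0 2 x \<in> Domain D" by (auto simp: D'_def)
    then show "x \<in> sources u v" using sh dom by simp
  qed
  moreover have "Range D' = targets u v"
  proof (intro equalityI subsetI)
    fix x assume "x \<in> targets u v"
    then have "shift 0 2 x \<in> Range D" using sh dom by simp
    then obtain y where y: "(y, shift 0 2 x) \<in> D" by blast
    then obtain y' where "y = shift 0 2 y'" using rest[OF y] c shift_neq by auto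
    then show "x \<in> Range D'" using y by (auto simp: D'_def)
  next
    fix x assume "x \<in> Range D'"
    then have "shift 0 2 x \<in> Range D" by (auto simp: D'_def)
    then show "x \<in> targets u v" using sh dom by simp
  qed
  moreover have "\<not> crosses s t" if "s \<in> D'" "t \<in> D'" for s t
  proof -
    obtain x y x' y' where st: "s = (x, y)" "t = (x', y')" by (metis prod.collapse)
    define f where "f k = k + (if k < 0 then - int 0 else int 2)" for k :: int
    have f: "strict_mono f" by (auto simp: f_def strict_mono_def)
    have "\<not> crosses (shift 0 2 x, shift 0 2 y) (shift 0 2 x', shift 0 2 y')"
      using that D by (auto simp: st D'_def kauffman_iff)
    then show ?thesis
      unfolding crosses_iff_int_cross st fst_conv snd_conv pos_shift f_def[symmetric] int_cross_mono[OF f] .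
  qed
  ultimately have "D' \<in> kauffman u v" unfolding kauffman_iff by blast
  then show ?thesis using eq w b by blast
qed

lemma length_bend_kauffman: "left_end (map_prod bend bend s) = left_end s - 1"
  "right_end (map_prod bend bend s) = right_end s - 1"
  by (cases s; simp add: left_end_def right_end_def pos_bend)+

text \<open>Bending the leftmost vertex from one edge to the other shifts all positions by one. This moves
  an innermost string to the position where it splits off as a tensor factor.\<close>

theorem kauffman_induct [consumes 1, case_names empty cup bend reflect]:
  assumes D: "D \<in> kauffman u v"
    and empty: "P [] [] {}"
    and cup: "\<And>a u v D. D \<in> kauffman u v \<Longrightarrow> P u v D \<Longrightarrow> P u (a # dual a # v) (juxtapose 0 2 (cup a) D)"
    and bend: "\<And>a u v D. D \<in> kauffman u (a # v) \<Longrightarrow> P u (a # v) D \<Longrightarrow> P (dual a # u) v (bend_diagram D)"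
    and reflect: "\<And>u v D. D \<in> kauffman u v \<Longrightarrow> P u v D \<Longrightarrow> P v u (reflect D)"
  shows "P u v D"
  using D
proof (induction "length u + length v" arbitrary: u v D rule: less_induct)
  case less
  have unbend: "P u (dual a # v) (unbend_diagram D)" if "D \<in> kauffman (a # u) v" "P (a # u) v D" for a u v D
    unfolding unbend_diagram_def using that by (intro reflect bend bend_kauffman reflect_kauffman)
  \<comment> \<open>Inner induction on the distance of an innermost string from position 0. Bending
    either way keeps the total number of vertices; it drops only when a cup is split off, and there
    the outer hypothesis applies.\<close>
  have aux: "P u' v' D'" if "D' \<in> kauffman u' v'" "length u' + length v' = length u + length v"
    "s \<in> D'" "right_end s = left_end s + 1" "nat \<bar>left_end s\<bar> = k" for u' v' D' s k
    using that
  proof (induction k arbitrary: u' v' D' s)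
    case 0
    then have "left_end s = 0" "right_end s = 1" by auto
    from split_cup[OF 0(1,3) this] obtain a w E where
      w: "v' = a # dual a # w" "E \<in> kauffman u' w" "D' = juxtapose 0 2 (cup a) E" by auto
    have "P u' w E" by (rule less.hyps[OF _ w(2)]) (use 0(2) w(1) in simp)
    then show ?case using cup w by simp
  next
    case (Suc k)
    have ends: "left_end s \<ge> - int (length u')" "right_end s < int (length v')"
      using kauffman_source_target[OF Suc.prems(1), of "fst s" "snd s"] Suc.prems(3)
        pos_less[of "fst s" u' v'] pos_less[of "snd s" u' v'] pos_ge[of "fst s" u' v'] pos_ge[of "snd s" u' v']
      by (auto simp: left_end_def right_end_def)
    show ?case
    proof (cases "left_end s > 0")
      case True
      then obtain a w where v': "v' = a # w" using ends(2) Suc.prems(4) by (cases v') auto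
      have E: "bend_diagram D' \<in> kauffman (dual a # u') w" using bend_kauffman Suc.prems(1) v' by simp
      have "P (dual a # u') w (bend_diagram D')"
        by (rule Suc.IH[OF E, of "map_prod bend bend s"])
          (use Suc.prems v' True in \<open>auto simp: length_bend_kauffman bend_diagram_def\<close>)
      from unbend[OF E this] show ?thesis using v' by simp
    next
      case False
      then obtain a w where u': "u' = a # w" using ends(1) Suc.prems(5) by (cases u') auto
      let ?E = "unbend_diagram D'"
      have E: "?E \<in> kauffman w (dual a # v')" using unbend_kauffman Suc.prems(1) u' by simp
      have "s \<in> bend_diagram ?E" using Suc.prems(3) by simp
      then obtain s' where s': "s = map_prod bend bend s'" "s' \<in> ?E" by (auto simp: bend_diagram_def)
      have "P w (dual a # v') ?E"
        by (rule Suc.IH[OF E _ s'(2)])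
          (use Suc.prems u' False in \<open>auto simp: s'(1) length_bend_kauffman\<close>)
      from bend[OF E this] show ?thesis using u' by simp
    qed
  qed
  show ?case
  proof (cases "D = {}")
    case True
    then have "vertices (length u) (length v) = {}"
      using less.prems sources_Un_targets[of u v] by (auto simp: kauffman_iff)
    then have "u = []" "v = []" by (auto simp: vertices_def lessThan_empty_iff)
    then show ?thesis using empty True by simp
  next
    case False
    then show ?thesis using adjacent_string[OF less.prems] aux[OF less.prems] by blast
  qed
qed

section \<open>The pairing of a fiber functor\<close>

lemma of_diagram_Hom [simp]: "D \<in> kauffman u v \<Longrightarrow> of_diagram D \<in> Hom u v"
  by (auto simp: Hom_def of_diagram_def)

lemma sum_of_diagram_left:
  assumes "finite A" "D \<in> A"
  shows "(\<Sum>E\<in>A. of_diagram D E * \<phi> E) = (\<phi> D :: complex)"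
proof -
  have "(\<Sum>E\<in>A. of_diagram D E * \<phi> E) = (\<Sum>E\<in>A. if E = D then \<phi> D else 0)"
    by (rule sum.cong) (auto simp: of_diagram_def)
  then show ?thesis using assms by simp
qed

lemma comp_of_diagram:
  assumes "D \<in> kauffman u v" "E \<in> kauffman v w"
  shows "comp_mor d u v w (of_diagram D) (of_diagram E) =
    (\<lambda>F. of_real d ^ loops D E * of_diagram (stack D E) F)"
proof
  fix F
  have "comp_mor d u v w (of_diagram D) (of_diagram E) F =
      (\<Sum>D'\<in>kauffman u v. of_diagram D D' * (\<Sum>E'\<in>kauffman v w. of_diagram E E' *
        (of_real d ^ loops D' E' * of_diagram (stack D' E') F)))"
    by (simp add: comp_mor_def sum_distrib_left mult.assoc)
  then show "comp_mor d u v w (of_diagram D) (of_diagram E) F =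
      of_real d ^ loops D E * of_diagram (stack D E) F"
    using assms by (simp add: sum_of_diagram_left finite_kauffman)
qed

lemma tensor_of_diagram:
  assumes "D \<in> kauffman u u'" "E \<in> kauffman v v'"
  shows "tensor_mor u u' v v' (of_diagram D) (of_diagram E) =
    of_diagram (juxtapose (length u) (length u') D E)"
proof
  fix F
  have "tensor_mor u u' v v' (of_diagram D) (of_diagram E) F =
      (\<Sum>D'\<in>kauffman u u'. of_diagram D D' * (\<Sum>E'\<in>kauffman v v'. of_diagram E E' *
        of_diagram (juxtapose (length u) (length u') D' E') F))"
    by (simp add: tensor_mor_def sum_distrib_left mult.assoc)
  then show "tensor_mor u u' v v' (of_diagram D) (of_diagram E) F =
      of_diagram (juxtapose (length u) (length u') D E) F"
    using assms by (simp add: sum_of_diagram_left finite_kauffman)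
qed

lemma star_of_diagram:
  assumes "D \<in> kauffman u v"
  shows "star_mor d u v (of_diagram D) =
    (\<lambda>F. of_real ((d / \<bar>d\<bar>) powi sharp D) * of_diagram (reflect D) F)"
proof
  fix F
  have "star_mor d u v (of_diagram D) F = (\<Sum>D'\<in>kauffman u v. of_diagram D D' *
      (of_real ((d / \<bar>d\<bar>) powi sharp D') * of_diagram (reflect D') F))"
    unfolding star_mor_def by (rule sum.cong) (auto simp: of_diagram_def)
  then show "star_mor d u v (of_diagram D) F =
      of_real ((d / \<bar>d\<bar>) powi sharp D) * of_diagram (reflect D) F"
    using assms by (simp add: sum_of_diagram_left finite_kauffman)
qed

text \<open>Contracting \<open>Mid 1\<close> leaves a loop at \<open>Mid 0\<close>, and contracting
  that vertex counts the only cycle.\<close>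

lemma loops_cup_cap: "loops (cup a) (cap a) = 1"
proof -
  let ?G = "{(Mid 0, Mid 1), (Mid 1, Mid 0)}"
  have G: "glue (cup a) (cap a) = ?G"
    by (cases a) (auto simp: glue_def cup_def cap_def)
  have c1: "contract (Mid 1) ?G = {(Mid 0, Mid 0)}" and c0: "contract (Mid 0) {(Mid 0, Mid 0)} = {}"
    by (auto simp: contract_def)
  have "card (cycles ?G) = card (cycles {(Mid 0, Mid 0)})"
    using card_cycles_contract[of ?G "Mid 1"] by (simp add: c1[simplified] single_valued_def)
  also have "\<dots> = card (cycles ({} :: (node \<times> node) set)) + 1"
    using card_cycles_contract[of "{(Mid 0, Mid 0)}" "Mid 0"] by (simp add: c0 single_valued_def)
  finally show ?thesis by (simp add: loops_eq_card_cycles G cycles_def)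
qed

lemma kauffman_Nil: "kauffman [] [] = {{}}"
  by (auto simp: kauffman_iff sources_def targets_def Domain_empty_iff)

lemma id_diagram_Nil [simp]: "id_diagram [] = {}"
  by (simp add: id_diagram_def)

lemma sharp_cap: "sharp (cap a) = 1"
proof -
  have "{s \<in> cap a. \<exists>i j. s = (Up i, Up j)} = cap a" "{s \<in> cap a. \<exists>i j. s = (Lo i, Lo j)} = {}"
    by (auto simp: cap_def split: if_splits)
  then show ?thesis by (simp add: sharp_def) (simp add: cap_def)
qed

lemma bend_cup: "bend_diagram (cup a) = id_diagram [dual a]"
  by (cases a) (auto simp: bend_diagram_def cup_def id_diagram_single)

lemma linear_map_comp: "linear_map H L S \<Longrightarrow> linear_map L M T \<Longrightarrow> linear_map H M (\<lambda>x. T (S x))"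
  by (simp add: linear_map_def)

section \<open>Pairing, copairing and the snake identity\<close>

locale fiber_functor =
  fixes d :: real and \<Phi> :: "'a::ab_group_add fiber"
  assumes uff: "unitary_fiber_functor d \<Phi>" and d0: "d \<noteq> 0"
begin

definition \<sigma> :: complex where "\<sigma> = of_real (d / \<bar>d\<bar>)"

lemma sigma: "\<sigma> * \<sigma> = 1" "cnj \<sigma> = \<sigma>" "\<sigma> * of_real d = of_real \<bar>d\<bar>"
  using d0 by (auto simp: \<sigma>_def abs_if)

lemma hil: "hilbert (obj \<Phi> w)"
  using uff by (simp add: hilbert_def unitary_fiber_functor_def linear_functor_def)

definition dmor :: "word \<Rightarrow> word \<Rightarrow> diagram \<Rightarrow> 'a \<Rightarrow> 'a" where
  "dmor u v D = mor \<Phi> u v (of_diagram D)"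

lemma mor_linear: "f \<in> Hom u v \<Longrightarrow> linear_map (obj \<Phi> u) (obj \<Phi> v) (mor \<Phi> u v f)"
  using uff by (simp add: unitary_fiber_functor_def linear_functor_def)

lemma mor_scale: "f \<in> Hom u v \<Longrightarrow> x \<in> vecs (obj \<Phi> u) \<Longrightarrow>
    mor \<Phi> u v (\<lambda>D. c * f D) x = scl (obj \<Phi> v) c (mor \<Phi> u v f x)"
  using uff by (simp add: unitary_fiber_functor_def linear_functor_def)

lemma mor_add: "f \<in> Hom u v \<Longrightarrow> g \<in> Hom u v \<Longrightarrow> x \<in> vecs (obj \<Phi> u) \<Longrightarrow>
    mor \<Phi> u v (\<lambda>D. f D + g D) x = mor \<Phi> u v f x + mor \<Phi> u v g x"
  using uff by (simp add: unitary_fiber_functor_def linear_functor_def)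

lemma dmor_linear: "D \<in> kauffman u v \<Longrightarrow> linear_map (obj \<Phi> u) (obj \<Phi> v) (dmor u v D)"
  unfolding dmor_def by (intro mor_linear of_diagram_Hom)

lemma dmor_vecs: "D \<in> kauffman u v \<Longrightarrow> x \<in> vecs (obj \<Phi> u) \<Longrightarrow> dmor u v D x \<in> vecs (obj \<Phi> v)"
  using dmor_linear by (simp add: linear_map_def)

lemma dmor_id: "x \<in> vecs (obj \<Phi> w) \<Longrightarrow> dmor w w (id_diagram w) x = x"
  using uff by (simp add: dmor_def unitary_fiber_functor_def linear_functor_def flip: id_mor_def)

lemma dmor_comp:
  assumes D: "D \<in> kauffman u v" and E: "E \<in> kauffman v w" and x: "x \<in> vecs (obj \<Phi> u)"
  shows "dmor v w E (dmor u v D x) = scl (obj \<Phi> w) (of_real d ^ loops D E) (dmor u w (stack D E) x)"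
proof -
  have "dmor v w E (dmor u v D x) = mor \<Phi> u w (comp_mor d u v w (of_diagram D) (of_diagram E)) x"
    using uff assms by (simp add: dmor_def unitary_fiber_functor_def linear_functor_def)
  then show ?thesis
    unfolding comp_of_diagram[OF D E] dmor_def using mor_scale[OF of_diagram_Hom[OF stack_kauffman[OF D E]] x] by simp
qed

lemma monoidal: "monoidal_functor \<Phi>"
  using uff by (simp add: unitary_fiber_functor_def)

lemma is_tensor: "is_tensor (obj \<Phi> u) (obj \<Phi> v) (obj \<Phi> (u @ v)) (ten \<Phi> u v)"
  using monoidal by (simp add: monoidal_functor_def)

lemma dmor_tensor:
  assumes "D \<in> kauffman u u'" "E \<in> kauffman v v'" "x \<in> vecs (obj \<Phi> u)" "y \<in> vecs (obj \<Phi> v)"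
  shows "dmor (u @ v) (u' @ v') (juxtapose (length u) (length u') D E) (ten \<Phi> u v x y) =
    ten \<Phi> u' v' (dmor u u' D x) (dmor v v' E y)"
  unfolding dmor_def tensor_of_diagram[OF assms(1,2), symmetric]
  using monoidal of_diagram_Hom[OF assms(1)] of_diagram_Hom[OF assms(2)] assms(3,4)
  unfolding monoidal_functor_def by blast

lemma ten_assoc: "x \<in> vecs (obj \<Phi> u) \<Longrightarrow> y \<in> vecs (obj \<Phi> v) \<Longrightarrow> z \<in> vecs (obj \<Phi> w) \<Longrightarrow>
    ten \<Phi> (u @ v) w (ten \<Phi> u v x y) z = ten \<Phi> u (v @ w) x (ten \<Phi> v w y z)"
  using monoidal by (simp add: monoidal_functor_def)

lemma ten_vac: "x \<in> vecs (obj \<Phi> w) \<Longrightarrow> ten \<Phi> [] w (vac \<Phi>) x = x"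
  "x \<in> vecs (obj \<Phi> w) \<Longrightarrow> ten \<Phi> w [] x (vac \<Phi>) = x"
  using monoidal by (simp_all add: monoidal_functor_def)

lemma ten_linear_left: "y \<in> vecs (obj \<Phi> v) \<Longrightarrow> linear_map (obj \<Phi> u) (obj \<Phi> (u @ v)) (\<lambda>x. ten \<Phi> u v x y)"
  and ten_linear_right: "x \<in> vecs (obj \<Phi> u) \<Longrightarrow> linear_map (obj \<Phi> v) (obj \<Phi> (u @ v)) (ten \<Phi> u v x)"
  using is_tensor[of u v] by (auto simp: is_tensor_def)

lemma ten_vecs: "x \<in> vecs (obj \<Phi> u) \<Longrightarrow> y \<in> vecs (obj \<Phi> v) \<Longrightarrow> ten \<Phi> u v x y \<in> vecs (obj \<Phi> (u @ v))"
  using ten_linear_right[of x u v] by (simp add: linear_map_def)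

lemma vac_onb: "hilbert.onb (obj \<Phi> []) {[] :: nat list} (\<lambda>_. vac \<Phi>)"
proof -
  interpret hilbert "obj \<Phi> []" by (rule hil)
  have "vecs (obj \<Phi> []) = span {vac \<Phi>}" "ip (obj \<Phi> []) (vac \<Phi>) (vac \<Phi>) = 1"
    using monoidal by (auto simp: monoidal_functor_def)
  moreover have "vac \<Phi> \<in> span {vac \<Phi>}" by (rule span_base) simp
  ultimately show ?thesis by (intro onbI) auto
qed

lemma vac_vecs: "vac \<Phi> \<in> vecs (obj \<Phi> [])"
  using hilbert.onb_vecs[OF hil vac_onb] by simp

lemma vac_ip: "ip (obj \<Phi> []) (vac \<Phi>) (vac \<Phi>) = 1"
  using monoidal by (simp add: monoidal_functor_def)

lemma vac_expand: "x \<in> vecs (obj \<Phi> []) \<Longrightarrow> x = scl (obj \<Phi> []) (ip (obj \<Phi> []) x (vac \<Phi>)) (vac \<Phi>)"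
  using hilbert.onb_expand[OF hil vac_onb] by simp

lemma dmor_star:
  assumes D: "D \<in> kauffman u v" and x: "x \<in> vecs (obj \<Phi> u)" and y: "y \<in> vecs (obj \<Phi> v)"
  shows "ip (obj \<Phi> v) (dmor u v D x) y = \<sigma> powi sharp D * ip (obj \<Phi> u) x (dmor v u (reflect D) y)"
proof -
  interpret hilbert "obj \<Phi> u" by (rule hil)
  have "ip (obj \<Phi> v) (dmor u v D x) y = ip (obj \<Phi> u) x (mor \<Phi> v u (star_mor d u v (of_diagram D)) y)"
    using uff of_diagram_Hom[OF D] x y
    unfolding dmor_def unitary_fiber_functor_def star_preserving_def by simp
  also have "mor \<Phi> v u (star_mor d u v (of_diagram D)) y =
      scl (obj \<Phi> u) (of_real ((d / \<bar>d\<bar>) powi sharp D)) (dmor v u (reflect D) y)"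
    unfolding star_of_diagram[OF D] dmor_def by (rule mor_scale[OF of_diagram_Hom[OF reflect_kauffman[OF D]] y])
  also have "ip (obj \<Phi> u) x \<dots> = of_real ((d / \<bar>d\<bar>) powi sharp D) * ip (obj \<Phi> u) x (dmor v u (reflect D) y)"
    using x dmor_vecs[OF reflect_kauffman[OF D] y] by (simp only: ip_scl_right complex_cnj_complex_of_real)
  finally show ?thesis unfolding \<sigma>_def of_real_power_int .
qed

definition form :: "letter \<Rightarrow> 'a \<Rightarrow> 'a \<Rightarrow> complex" where
  "form a x y = ip (obj \<Phi> []) (dmor [a, dual a] [] (cap a) (ten \<Phi> [a] [dual a] x y)) (vac \<Phi>)"

lemma ten_pair_vecs: "x \<in> vecs (obj \<Phi> [a]) \<Longrightarrow> y \<in> vecs (obj \<Phi> [b]) \<Longrightarrow> ten \<Phi> [a] [b] x y \<in> vecs (obj \<Phi> [a, b])"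
  using ten_vecs[of x "[a]" y "[b]"] by simp

lemma dmor_cap:
  assumes "x \<in> vecs (obj \<Phi> [a])" "y \<in> vecs (obj \<Phi> [dual a])"
  shows "dmor [a, dual a] [] (cap a) (ten \<Phi> [a] [dual a] x y) = scl (obj \<Phi> []) (form a x y) (vac \<Phi>)"
  unfolding form_def by (rule vac_expand[OF dmor_vecs[OF cap_kauffman ten_pair_vecs[OF assms]]])

lemma form_lincomb_left:
  assumes "finite A" "\<And>i. i \<in> A \<Longrightarrow> f i \<in> vecs (obj \<Phi> [a])" "y \<in> vecs (obj \<Phi> [dual a])"
  shows "form a (\<Sum>i\<in>A. scl (obj \<Phi> [a]) (c i) (f i)) y = (\<Sum>i\<in>A. c i * form a (f i) y)"
proof -
  interpret hilbert "obj \<Phi> []" by (rule hil)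
  have lin: "linear_map (obj \<Phi> [a]) (obj \<Phi> []) (\<lambda>x. dmor [a, dual a] [] (cap a) (ten \<Phi> [a] [dual a] x y))"
    using linear_map_comp[OF ten_linear_left[OF assms(3), of "[a]"], simplified, OF dmor_linear[OF cap_kauffman]] .
  have v: "dmor [a, dual a] [] (cap a) (ten \<Phi> [a] [dual a] (f i) y) \<in> vecs (obj \<Phi> [])" if "i \<in> A" for i
    using dmor_vecs[OF cap_kauffman ten_pair_vecs] assms that by simp
  show ?thesis
    unfolding form_def using linear_map_sum[OF hil lin assms(2,1) hil, where c = c] ip_sum_scl[OF v vac_vecs, where c = c]
    by simp
qed

lemma form_lincomb_right:
  assumes "finite A" "\<And>i. i \<in> A \<Longrightarrow> f i \<in> vecs (obj \<Phi> [dual a])" "x \<in> vecs (obj \<Phi> [a])"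
  shows "form a x (\<Sum>i\<in>A. scl (obj \<Phi> [dual a]) (c i) (f i)) = (\<Sum>i\<in>A. c i * form a x (f i))"
proof -
  interpret hilbert "obj \<Phi> []" by (rule hil)
  have lin: "linear_map (obj \<Phi> [dual a]) (obj \<Phi> []) (\<lambda>y. dmor [a, dual a] [] (cap a) (ten \<Phi> [a] [dual a] x y))"
    using linear_map_comp[OF ten_linear_right[OF assms(3), of "[dual a]"], simplified, OF dmor_linear[OF cap_kauffman]] .
  have v: "dmor [a, dual a] [] (cap a) (ten \<Phi> [a] [dual a] x (f i)) \<in> vecs (obj \<Phi> [])" if "i \<in> A" for i
    using dmor_vecs[OF cap_kauffman ten_pair_vecs] assms that by simp
  show ?thesis
    unfolding form_def using linear_map_sum[OF hil lin assms(2,1) hil, where c = c] ip_sum_scl[OF v vac_vecs, where c = c]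
    by simp
qed

definition copairing :: "letter \<Rightarrow> 'a" where
  "copairing a = dmor [] [a, dual a] (cup a) (vac \<Phi>)"

lemma copairing_vecs: "copairing a \<in> vecs (obj \<Phi> [a, dual a])"
  unfolding copairing_def by (rule dmor_vecs[OF cup_kauffman vac_vecs])

text \<open>The cap has \<open>sharp\<close> equal to 1, so its star is \<open>\<sigma>\<close>
  times the cup.\<close>

lemma ip_copairing:
  assumes "x \<in> vecs (obj \<Phi> [a, dual a])"
  shows "ip (obj \<Phi> []) (dmor [a, dual a] [] (cap a) x) (vac \<Phi>) = \<sigma> * ip (obj \<Phi> [a, dual a]) x (copairing a)"
  using dmor_star[OF cap_kauffman assms vac_vecs] by (simp add: sharp_cap reflect_cap copairing_def)

context
  fixes a :: letter and A :: "'i set" and B :: "'j set" and v :: "'i \<Rightarrow> 'a" and w :: "'j \<Rightarrow> 'a"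
  assumes v: "hilbert.onb (obj \<Phi> [a]) A v" and w: "hilbert.onb (obj \<Phi> [dual a]) B w"
begin

lemma pair_onb: "hilbert.onb (obj \<Phi> [a, dual a]) (A \<times> B) (\<lambda>(i, j). ten \<Phi> [a] [dual a] (v i) (w j))"
  using onb_tensor[OF hil hil hil is_tensor v w] by simp

lemma copairing_ip: "i \<in> A \<Longrightarrow> j \<in> B \<Longrightarrow>
    ip (obj \<Phi> [a, dual a]) (copairing a) (ten \<Phi> [a] [dual a] (v i) (w j)) = \<sigma> * cnj (form a (v i) (w j))"
proof -
  assume ij: "i \<in> A" "j \<in> B"
  interpret hilbert "obj \<Phi> [a, dual a]" by (rule hil)
  let ?x = "ten \<Phi> [a] [dual a] (v i) (w j)"
  have x: "?x \<in> vecs (obj \<Phi> [a, dual a])"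
    using ij ten_pair_vecs hilbert.onb_vecs[OF hil v] hilbert.onb_vecs[OF hil w] by blast
  have "\<sigma> * form a (v i) (w j) = ip (obj \<Phi> [a, dual a]) ?x (copairing a)"
    unfolding form_def ip_copairing[OF x] by (simp add: sigma flip: mult.assoc)
  then have "cnj (\<sigma> * form a (v i) (w j)) = ip (obj \<Phi> [a, dual a]) (copairing a) ?x"
    using ip_commute[OF x copairing_vecs] by simp
  then show ?thesis by (simp add: sigma)
qed

lemma copairing_expand:
  "copairing a = (\<Sum>p\<in>A \<times> B. scl (obj \<Phi> [a, dual a]) (\<sigma> * cnj (form a (v (fst p)) (w (snd p))))
     (ten \<Phi> [a] [dual a] (v (fst p)) (w (snd p))))"
proof -
  have "copairing a = (\<Sum>p\<in>A \<times> B. scl (obj \<Phi> [a, dual a])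
      (ip (obj \<Phi> [a, dual a]) (copairing a) (case p of (i, j) \<Rightarrow> ten \<Phi> [a] [dual a] (v i) (w j)))
      (case p of (i, j) \<Rightarrow> ten \<Phi> [a] [dual a] (v i) (w j)))"
    by (rule hilbert.onb_expand[OF hil pair_onb copairing_vecs, symmetric])
  also have "\<dots> = (\<Sum>p\<in>A \<times> B. scl (obj \<Phi> [a, dual a]) (\<sigma> * cnj (form a (v (fst p)) (w (snd p))))
     (ten \<Phi> [a] [dual a] (v (fst p)) (w (snd p))))"
    by (rule sum.cong) (auto simp: copairing_ip)
  finally show ?thesis .
qed

text \<open>The cup followed by the cap is a closed loop of value \<open>d\<close>; by adjointness
  it is also \<open>\<sigma>\<close> times the squared norm of \<open>copairing a\<close>, which
  Parseval expresses by the entries of \<open>form a\<close>.\<close>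

lemma sum_form_square: "(\<Sum>i\<in>A. \<Sum>j\<in>B. (cmod (form a (v i) (w j)))\<^sup>2) = \<bar>d\<bar>"
proof -
  interpret hilbert "obj \<Phi> [a, dual a]" by (rule hil)
  have "dmor [a, dual a] [] (cap a) (copairing a) = scl (obj \<Phi> []) (of_real d) (dmor [] [] (stack (cup a) (cap a)) (vac \<Phi>))"
    using dmor_comp[OF cup_kauffman cap_kauffman vac_vecs] by (simp add: copairing_def loops_cup_cap)
  also have "stack (cup a) (cap a) = id_diagram []"
    using stack_kauffman[OF cup_kauffman[of a] cap_kauffman[of a]] by (simp add: kauffman_Nil)
  also have "dmor [] [] (id_diagram []) (vac \<Phi>) = vac \<Phi>" by (rule dmor_id[OF vac_vecs])
  finally have "ip (obj \<Phi> []) (dmor [a, dual a] [] (cap a) (copairing a)) (vac \<Phi>) = of_real d"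
    using hilbert.ip_scl[OF hil vac_vecs vac_vecs] by (simp add: vac_ip)
  then have "of_real d = \<sigma> * ip (obj \<Phi> [a, dual a]) (copairing a) (copairing a)"
    using ip_copairing[OF copairing_vecs] by simp
  then have "of_real \<bar>d\<bar> = ip (obj \<Phi> [a, dual a]) (copairing a) (copairing a)"
    using sigma by (metis mult.assoc mult_1)
  also have "\<dots> = (\<Sum>p\<in>A \<times> B. of_real ((cmod (form a (v (fst p)) (w (snd p))))\<^sup>2))"
    unfolding onb_parseval[OF pair_onb copairing_vecs copairing_vecs]
  proof (rule sum.cong)
    fix p assume "p \<in> A \<times> B"
    then obtain i j where p: "p = (i, j)" "i \<in> A" "j \<in> B" by auto
    let ?f = "form a (v i) (w j)"
    have "(\<sigma> * cnj ?f) * cnj (\<sigma> * cnj ?f) = (\<sigma> * \<sigma>) * (?f * cnj ?f)" by (simp add: sigma(2) mult_ac)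
    also have "\<dots> = of_real ((cmod ?f)\<^sup>2)" by (simp add: sigma(1) complex_norm_square del: of_real_power)
    finally show "ip (obj \<Phi> [a, dual a]) (copairing a) (case p of (i, j) \<Rightarrow> ten \<Phi> [a] [dual a] (v i) (w j)) *
        cnj (ip (obj \<Phi> [a, dual a]) (copairing a) (case p of (i, j) \<Rightarrow> ten \<Phi> [a] [dual a] (v i) (w j))) =
        of_real ((cmod (form a (v (fst p)) (w (snd p))))\<^sup>2)"
      using p by (simp add: copairing_ip)
  qed simp
  also have "\<dots> = of_real (\<Sum>i\<in>A. \<Sum>j\<in>B. (cmod (form a (v i) (w j)))\<^sup>2)"
    by (simp add: sum.cartesian_product case_prod_unfold)
  finally show ?thesis using of_real_eq_iff by metis
qed

text \<open>The zigzag of a cup and a cap is the identity. Applied to \<open>w k\<close>, with the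
  cup expanded in the product basis, its coefficient at \<open>w l\<close> is the sum on the
  left.\<close>

lemma snake:
  assumes k: "k \<in> B" and l: "l \<in> B"
  shows "(\<Sum>i\<in>A. \<sigma> * cnj (form a (v i) (w l)) * form (dual a) (w k) (v i)) = (if k = l then 1 else 0)"
proof -
  let ?b = "dual a"
  interpret Hb: hilbert "obj \<Phi> [?b]" by (rule hil)
  have vv: "v i \<in> vecs (obj \<Phi> [a])" if "i \<in> A" for i by (rule hilbert.onb_vecs[OF hil v that])
  have ww: "w j \<in> vecs (obj \<Phi> [?b])" if "j \<in> B" for j by (rule hilbert.onb_vecs[OF hil w that])
  have fin: "finite (A \<times> B)" using hilbert.onb_finite[OF hil v] hilbert.onb_finite[OF hil w] by simp
  define S where "S = juxtapose 1 1 (id_diagram [?b]) (cup a)"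
  define T where "T = juxtapose 2 0 (cap ?b) (id_diagram [?b])"
  have S: "S \<in> kauffman [?b] [?b, a, ?b]" and T: "T \<in> kauffman [?b, a, ?b] [?b]"
    and st: "stack S T = id_diagram [?b]" "loops S T = 0"
    using stack_bend[OF cup_kauffman[of a]] by (simp_all add: S_def T_def bend_cup)
  let ?y = "w k"
  note y = ww[OF k]
  have "?y = dmor [?b, a, ?b] [?b] T (dmor [?b] [?b, a, ?b] S ?y)"
    using dmor_comp[OF S T y] dmor_id[OF y] by (simp add: st)
  also have "dmor [?b] [?b, a, ?b] S ?y = ten \<Phi> [?b] [a, ?b] ?y (copairing a)"
    using dmor_tensor[OF id_diagram_kauffman cup_kauffman[of a] y vac_vecs] dmor_id[OF y]
    by (simp add: S_def copairing_def ten_vac[OF y])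
  also have "\<dots> = (\<Sum>p\<in>A \<times> B. scl (obj \<Phi> [?b, a, ?b]) (\<sigma> * cnj (form a (v (fst p)) (w (snd p))))
     (ten \<Phi> [?b] [a, ?b] ?y (ten \<Phi> [a] [?b] (v (fst p)) (w (snd p)))))"
    unfolding copairing_expand
    using linear_map_sum[OF hil ten_linear_right[OF y, of "[a, ?b]"] _ fin hil] ten_pair_vecs vv ww by auto
  also have "dmor [?b, a, ?b] [?b] T \<dots> = (\<Sum>p\<in>A \<times> B. scl (obj \<Phi> [?b]) (\<sigma> * cnj (form a (v (fst p)) (w (snd p))))
     (dmor [?b, a, ?b] [?b] T (ten \<Phi> [?b] [a, ?b] ?y (ten \<Phi> [a] [?b] (v (fst p)) (w (snd p))))))"
    by (rule linear_map_sum[OF hil dmor_linear[OF T] _ fin hil])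
      (use ten_vecs[of ?y "[?b]" _ "[a, ?b]"] ten_pair_vecs vv ww y in auto)
  also have "\<dots> = (\<Sum>p\<in>A \<times> B. scl (obj \<Phi> [?b])
      (\<sigma> * cnj (form a (v (fst p)) (w (snd p))) * form ?b ?y (v (fst p))) (w (snd p)))"
  proof (rule sum.cong)
    fix p assume "p \<in> A \<times> B"
    then obtain i j where p: "p = (i, j)" "i \<in> A" "j \<in> B" by auto
    have t: "ten \<Phi> [?b] [a] ?y (v i) \<in> vecs (obj \<Phi> [?b, a])" using ten_pair_vecs y vv p by blast
    have "dmor [?b, a, ?b] [?b] T (ten \<Phi> [?b] [a, ?b] ?y (ten \<Phi> [a] [?b] (v i) (w j))) =
        dmor ([?b, a] @ [?b]) ([] @ [?b]) T (ten \<Phi> [?b, a] [?b] (ten \<Phi> [?b] [a] ?y (v i)) (w j))"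
      using ten_assoc[OF y vv[OF p(2)] ww[OF p(3)]] by simp
    also have "\<dots> = ten \<Phi> [] [?b] (dmor [?b, a] [] (cap ?b) (ten \<Phi> [?b] [a] ?y (v i))) (w j)"
      using dmor_tensor[OF cap_kauffman[of ?b] id_diagram_kauffman[of "[?b]"], of "ten \<Phi> [?b] [a] ?y (v i)" "w j"]
        t ww[OF p(3)] dmor_id by (simp add: T_def numeral_2_eq_2)
    also have "dmor [?b, a] [] (cap ?b) (ten \<Phi> [?b] [a] ?y (v i)) = scl (obj \<Phi> []) (form ?b ?y (v i)) (vac \<Phi>)"
      using dmor_cap[of ?y ?b "v i"] y vv[OF p(2)] by simp
    also have "ten \<Phi> [] [?b] \<dots> (w j) = scl (obj \<Phi> [?b]) (form ?b ?y (v i)) (w j)"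
      using ten_linear_left[OF ww[OF p(3)], of "[]"] vac_vecs ten_vac(1)[OF ww[OF p(3)]]
      by (simp add: linear_map_def)
    finally show "scl (obj \<Phi> [?b]) (\<sigma> * cnj (form a (v (fst p)) (w (snd p))))
        (dmor [?b, a, ?b] [?b] T (ten \<Phi> [?b] [a, ?b] ?y (ten \<Phi> [a] [?b] (v (fst p)) (w (snd p))))) =
      scl (obj \<Phi> [?b]) (\<sigma> * cnj (form a (v (fst p)) (w (snd p))) * form ?b ?y (v (fst p))) (w (snd p))"
      using p by simp
  qed simp
  finally have e: "?y = (\<Sum>p\<in>A \<times> B. scl (obj \<Phi> [?b])
      (\<sigma> * cnj (form a (v (fst p)) (w (snd p))) * form ?b ?y (v (fst p))) (w (snd p)))" .
  have "(if k = l then 1 else 0) = ip (obj \<Phi> [?b]) ?y (w l)" using Hb.onb_ip[OF w k l] by simp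
  also have "\<dots> = (\<Sum>p\<in>A \<times> B. (\<sigma> * cnj (form a (v (fst p)) (w (snd p))) * form ?b ?y (v (fst p))) *
      ip (obj \<Phi> [?b]) (w (snd p)) (w l))"
    by (subst e) (rule Hb.ip_sum_scl, use ww l in auto)
  also have "\<dots> = (\<Sum>i\<in>A. \<Sum>j\<in>B. if j = l then \<sigma> * cnj (form a (v i) (w l)) * form ?b ?y (v i) else 0)"
    unfolding sum.cartesian_product by (rule sum.cong) (use Hb.onb_ip[OF w] l in auto)
  also have "\<dots> = (\<Sum>i\<in>A. \<sigma> * cnj (form a (v i) (w l)) * form ?b ?y (v i))"
    using hilbert.onb_finite[OF hil w] l by simp
  finally show ?thesis by simp
qed

end

section \<open>Singular value decomposition of the pairing\<close>

definition adapted :: "nat \<Rightarrow> (nat \<Rightarrow> 'a) \<Rightarrow> (nat \<Rightarrow> 'a) \<Rightarrow> (nat \<Rightarrow> real) \<Rightarrow> bool" where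
  "adapted n v w \<mu> \<longleftrightarrow> hilbert.onb (obj \<Phi> [LX]) {..<n} v \<and> hilbert.onb (obj \<Phi> [LXstar]) {..<n} w \<and>
     (\<forall>i<n. \<mu> i > 0) \<and> (\<forall>i<n. \<forall>j<n. form LXstar (w j) (v i) = (if i = j then of_real (\<mu> i) else 0))"

text \<open>The snake identity inverts a diagonal matrix entry by entry.\<close>

lemma adapted_form_LX:
  assumes ad: "adapted n v w \<mu>" and ij: "i < n" "j < n"
  shows "form LX (v i) (w j) = (if i = j then \<sigma> / of_real (\<mu> i) else 0)"
proof -
  have v: "hilbert.onb (obj \<Phi> [LX]) {..<n} v" and w: "hilbert.onb (obj \<Phi> [dual LX]) {..<n} w"
    using ad by (auto simp: adapted_def)
  have mu: "\<mu> i > 0" using ad ij by (simp add: adapted_def)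
  have "(if i = j then 1 else 0) = (\<Sum>k<n. \<sigma> * cnj (form LX (v k) (w j)) * form LXstar (w i) (v k))"
    using snake[OF v w, of i j] ij by simp
  also have "\<dots> = (\<Sum>k<n. if k = i then \<sigma> * cnj (form LX (v i) (w j)) * of_real (\<mu> i) else 0)"
    by (rule sum.cong) (use ad ij in \<open>auto simp: adapted_def\<close>)
  also have "\<dots> = \<sigma> * cnj (form LX (v i) (w j)) * of_real (\<mu> i)" using ij by simp
  finally have "cnj (if i = j then 1 else 0) = cnj (\<sigma> * cnj (form LX (v i) (w j)) * of_real (\<mu> i))" by simp
  then have "(if i = j then 1 else 0) = \<sigma> * form LX (v i) (w j) * of_real (\<mu> i)"
    by (simp add: sigma(2) split: if_splits)
  then have "\<sigma> * (if i = j then 1 else 0) = (\<sigma> * \<sigma>) * form LX (v i) (w j) * of_real (\<mu> i)" by (simp add: mult_ac)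
  then show ?thesis using mu by (auto simp: sigma(1) field_simps split: if_splits)
qed

text \<open>This is \<open>sum_form_square\<close> for the two letters, where the diagonal entries
  have modulus \<open>\<mu> i\<close> and its inverse.\<close>

lemma adapted_sums:
  assumes ad: "adapted n v w \<mu>"
  shows "(\<Sum>i<n. (\<mu> i)\<^sup>2) = \<bar>d\<bar>" "(\<Sum>i<n. \<mu> i powi (- 2)) = \<bar>d\<bar>"
proof -
  have v: "hilbert.onb (obj \<Phi> [LX]) {..<n} v" and w: "hilbert.onb (obj \<Phi> [LXstar]) {..<n} w"
    and mu: "\<And>i. i < n \<Longrightarrow> \<mu> i > 0"
    using ad by (auto simp: adapted_def)
  have "\<bar>d\<bar> = (\<Sum>j<n. \<Sum>i<n. (cmod (form LXstar (w j) (v i)))\<^sup>2)"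
    using sum_form_square[of LXstar "{..<n}" w "{..<n}" v] v w by simp
  also have "\<dots> = (\<Sum>j<n. \<Sum>i<n. if i = j then (\<mu> j)\<^sup>2 else 0)"
    by (intro sum.cong refl) (use ad in \<open>auto simp: adapted_def\<close>)
  finally show "(\<Sum>i<n. (\<mu> i)\<^sup>2) = \<bar>d\<bar>" by simp
  have s1: "cmod \<sigma> = 1" unfolding \<sigma>_def norm_of_real using d0 by simp
  have "\<bar>d\<bar> = (\<Sum>i<n. \<Sum>j<n. (cmod (form LX (v i) (w j)))\<^sup>2)"
    using sum_form_square[of LX "{..<n}" v "{..<n}" w] v w by simp
  also have "\<dots> = (\<Sum>i<n. \<Sum>j<n. if j = i then \<mu> i powi (- 2) else 0)"
    by (intro sum.cong refl)
      (use mu s1 in \<open>auto simp: adapted_form_LX[OF ad] norm_divide power_int_minus power_divide field_simps\<close>)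
  finally show "(\<Sum>i<n. \<mu> i powi (- 2)) = \<bar>d\<bar>" by simp
qed

text \<open>Comparison of traces: up to conjugation, the snake identities for the two letters have
  the same double sum, which counts both bases.\<close>

lemma dim_eq:
  assumes v: "hilbert.onb (obj \<Phi> [LX]) {..<n::nat} v" and w: "hilbert.onb (obj \<Phi> [LXstar]) {..<m::nat} w"
  shows "n = m"
proof -
  have "of_nat m = (\<Sum>k<m. \<Sum>i<n. \<sigma> * cnj (form LX (v i) (w k)) * form LXstar (w k) (v i))"
    using snake[of LX "{..<n}" v "{..<m}" w] v w by simp
  also have "\<dots> = (\<Sum>i<n. \<Sum>k<m. \<sigma> * cnj (form LX (v i) (w k)) * form LXstar (w k) (v i))"
    by (rule sum.swap)
  also have "\<dots> = cnj (\<Sum>i<n. \<Sum>k<m. \<sigma> * cnj (form LXstar (w k) (v i)) * form LX (v i) (w k))"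
    by (simp add: sigma(2) mult_ac)
  also have "(\<Sum>i<n. \<Sum>k<m. \<sigma> * cnj (form LXstar (w k) (v i)) * form LX (v i) (w k)) = of_nat n"
    using snake[of LXstar "{..<m}" w "{..<n}" v] v w by simp
  finally show ?thesis by simp
qed

text \<open>\<open>G\<close> is the Gram form of the rows of the pairing, represented by the
  self-adjoint map \<open>T\<close>. Its eigenvectors give \<open>w\<close>, and the square roots of
  its eigenvalues give \<open>\<mu>\<close>.\<close>

theorem adapted_exists: "\<exists>n v w \<mu>. adapted n v w \<mu>"
proof -
  interpret X: hilbert "obj \<Phi> [LX]" by (rule hil)
  interpret Y: hilbert "obj \<Phi> [LXstar]" by (rule hil)
  obtain n and v :: "nat \<Rightarrow> 'a" where v: "X.onb {..<n} v" by (rule X.onb_exists)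
  obtain m and w0 :: "nat \<Rightarrow> 'a" where w0: "Y.onb {..<m} w0" by (rule Y.onb_exists)
  have "m = n" using dim_eq[OF v w0] by simp
  with w0 have w0: "Y.onb {..<n} w0" by simp
  have vv: "v i \<in> vecs (obj \<Phi> [LX])" if "i < n" for i using X.onb_vecs[OF v] that by simp
  have ww: "w0 i \<in> vecs (obj \<Phi> [LXstar])" if "i < n" for i using Y.onb_vecs[OF w0] that by simp
  define G where "G x y = (\<Sum>i<n. form LXstar x (v i) * cnj (form LXstar y (v i)))" for x y
  have G_commute: "G y x = cnj (G x y)" for x y by (simp add: G_def mult.commute)
  define T where "T x = (\<Sum>j<n. scl (obj \<Phi> [LXstar]) (G x (w0 j)) (w0 j))" for x
  have T: "T x \<in> vecs (obj \<Phi> [LXstar])" for x unfolding T_def using ww by (auto intro!: Y.vecs_closed)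
  have form_expand: "form LXstar y (v i) = (\<Sum>j<n. ip (obj \<Phi> [LXstar]) y (w0 j) * form LXstar (w0 j) (v i))"
    if y: "y \<in> vecs (obj \<Phi> [LXstar])" and i: "i < n" for y i
    using form_lincomb_left[of "{..<n}" w0 LXstar "v i" "\<lambda>j. ip (obj \<Phi> [LXstar]) y (w0 j)"] ww vv[OF i]
    by (simp add: Y.onb_expand[OF w0 y])
  have ipT: "ip (obj \<Phi> [LXstar]) (T x) y = G x y" if y: "y \<in> vecs (obj \<Phi> [LXstar])" for x y
  proof -
    have "ip (obj \<Phi> [LXstar]) (T x) y = (\<Sum>j<n. ip (obj \<Phi> [LXstar]) (T x) (w0 j) * cnj (ip (obj \<Phi> [LXstar]) y (w0 j)))"
      by (rule Y.onb_parseval[OF w0 T y])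
    also have "\<dots> = (\<Sum>j<n. G x (w0 j) * cnj (ip (obj \<Phi> [LXstar]) y (w0 j)))"
    proof (rule sum.cong)
      fix j assume j: "j \<in> {..<n}"
      have "ip (obj \<Phi> [LXstar]) (T x) (w0 j) = G x (w0 j)"
        unfolding T_def using ww Y.onb_ip[OF w0] j by (intro Y.ip_lincomb) auto
      then show "ip (obj \<Phi> [LXstar]) (T x) (w0 j) * cnj (ip (obj \<Phi> [LXstar]) y (w0 j)) =
          G x (w0 j) * cnj (ip (obj \<Phi> [LXstar]) y (w0 j))" by simp
    qed simp
    also have "\<dots> = (\<Sum>j<n. \<Sum>i<n. form LXstar x (v i) * cnj (ip (obj \<Phi> [LXstar]) y (w0 j) * form LXstar (w0 j) (v i)))"
      unfolding G_def sum_distrib_right by (intro sum.cong refl) (simp add: mult_ac)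
    also have "\<dots> = (\<Sum>i<n. \<Sum>j<n. form LXstar x (v i) * cnj (ip (obj \<Phi> [LXstar]) y (w0 j) * form LXstar (w0 j) (v i)))"
      by (rule sum.swap)
    also have "\<dots> = G x y" unfolding G_def
      by (rule sum.cong) (simp_all add: form_expand[OF y] sum_distrib_left)
    finally show ?thesis .
  qed
  have form_add: "form LXstar (x + y) (v i) = form LXstar x (v i) + form LXstar y (v i)"
    if "x \<in> vecs (obj \<Phi> [LXstar])" "y \<in> vecs (obj \<Phi> [LXstar])" "i < n" for x y i
    unfolding form_expand[OF that(1,3)] form_expand[OF that(2,3)] form_expand[OF Y.vecs_closed(2)[OF that(1,2)] that(3)]
    using that ww by (simp add: Y.ip_add sum.distrib distrib_right)
  have form_scl: "form LXstar (scl (obj \<Phi> [LXstar]) c x) (v i) = c * form LXstar x (v i)"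
    if "x \<in> vecs (obj \<Phi> [LXstar])" "i < n" for x c i
    unfolding form_expand[OF that] form_expand[OF Y.vecs_closed(4)[OF that(1)] that(2)]
    using that ww by (simp add: Y.ip_scl sum_distrib_left mult_ac)
  have lin: "linear_map (obj \<Phi> [LXstar]) (obj \<Phi> [LXstar]) T"
    unfolding linear_map_def
  proof (intro conjI ballI allI)
    fix x y assume xy: "x \<in> vecs (obj \<Phi> [LXstar])" "y \<in> vecs (obj \<Phi> [LXstar])"
    have "G (x + y) z = G x z + G y z" for z
      unfolding G_def using xy by (simp add: form_add sum.distrib distrib_right)
    then show "T (x + y) = T x + T y" by (simp add: T_def Y.scale_left_distrib sum.distrib)
  next
    fix c x assume x: "x \<in> vecs (obj \<Phi> [LXstar])"
    have "G (scl (obj \<Phi> [LXstar]) c x) z = c * G x z" for z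
      unfolding G_def using x by (simp add: form_scl sum_distrib_left mult_ac)
    then show "T (scl (obj \<Phi> [LXstar]) c x) = scl (obj \<Phi> [LXstar]) c (T x)"
      by (simp add: T_def Y.scale_sum_right)
  qed (rule T)
  have sa: "ip (obj \<Phi> [LXstar]) (T x) y = ip (obj \<Phi> [LXstar]) x (T y)"
    if "x \<in> vecs (obj \<Phi> [LXstar])" "y \<in> vecs (obj \<Phi> [LXstar])" for x y
    using ipT[OF that(1), of y] ipT[OF that(2), of x] Y.ip_commute[OF T that(1), of y] G_commute[of x y] by simp
  obtain w \<kappa> where w: "Y.onb {..<n} w" and ev: "\<And>i. i < n \<Longrightarrow> T (w i) = scl (obj \<Phi> [LXstar]) (of_real (\<kappa> i)) (w i)"
    using spectral[OF hil lin sa w0] by blast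
  have wv: "w i \<in> vecs (obj \<Phi> [LXstar])" if "i < n" for i using Y.onb_vecs[OF w] that by simp
  have G: "G (w j) (w k) = (if j = k then of_real (\<kappa> j) else 0)" if "j < n" "k < n" for j k
    unfolding ipT[OF wv[OF that(2)], of "w j", symmetric] using that wv Y.onb_ip[OF w] by (simp add: ev Y.ip_scl)
  have pos: "\<kappa> j > 0" if j: "j < n" for j
  proof -
    have "of_real (\<kappa> j) = (\<Sum>i<n. form LXstar (w j) (v i) * cnj (form LXstar (w j) (v i)))"
      using G[OF j j] by (simp add: G_def)
    also have "\<dots> = of_real (\<Sum>i<n. (cmod (form LXstar (w j) (v i)))\<^sup>2)"
      by (simp only: complex_norm_square[symmetric] of_real_sum)
    finally have k: "\<kappa> j = (\<Sum>i<n. (cmod (form LXstar (w j) (v i)))\<^sup>2)" using of_real_eq_iff by blast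
    moreover have "\<kappa> j \<noteq> 0"
    proof
      assume "\<kappa> j = 0"
      then have "form LXstar (w j) (v i) = 0" if "i < n" for i
        using k that by (simp add: sum_nonneg_eq_0_iff)
      \<comment> \<open>By the snake identity the pairing is nondegenerate, so no row
        vanishes.\<close>
      then show False using snake[of LX "{..<n}" v "{..<n}" w j j] v w j by simp
    qed
    ultimately show ?thesis by (metis antisym_conv1 sum_nonneg zero_le_power2 order_le_less)
  qed
  define \<mu> where "\<mu> j = sqrt (\<kappa> j)" for j
  have mu: "\<mu> j > 0" "\<mu> j * \<mu> j = \<kappa> j" if "j < n" for j
    using pos[OF that] by (simp_all add: \<mu>_def)
  \<comment> \<open>The conjugated row of \<open>w k\<close>, divided by its norm
    \<open>\<mu> k\<close>; pairing \<open>w j\<close> with it gives \<open>G (w j) (w k)\<close>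
    divided by \<open>\<mu> k\<close>.\<close>
  define v' where "v' k = (\<Sum>i<n. scl (obj \<Phi> [LX]) (cnj (form LXstar (w k) (v i)) / of_real (\<mu> k)) (v i))" for k
  have v': "v' k \<in> vecs (obj \<Phi> [LX])" for k unfolding v'_def using vv by (auto intro!: X.vecs_closed)
  have ip': "ip (obj \<Phi> [LX]) (v' k) (v i) = cnj (form LXstar (w k) (v i)) / of_real (\<mu> k)" if "i < n" for k i
    unfolding v'_def using vv X.onb_ip[OF v] that by (intro X.ip_lincomb) auto
  have "X.onb {..<n} v'"
  proof (rule X.orthonormal_full_onb[OF v])
    fix k l assume kl: "k < n" "l < n"
    have "ip (obj \<Phi> [LX]) (v' k) (v' l) = (\<Sum>i<n. ip (obj \<Phi> [LX]) (v' k) (v i) * cnj (ip (obj \<Phi> [LX]) (v' l) (v i)))"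
      by (rule X.onb_parseval[OF v v' v'])
    also have "\<dots> = (\<Sum>i<n. form LXstar (w l) (v i) * cnj (form LXstar (w k) (v i))) / of_real (\<mu> k * \<mu> l)"
      unfolding sum_divide_distrib by (rule sum.cong) (simp_all add: ip' mult_ac)
    also have "\<dots> = (if k = l then 1 else 0)"
      using G[OF kl(2,1)] mu[OF kl(1)] by (auto simp: G_def simp flip: of_real_mult)
    finally show "ip (obj \<Phi> [LX]) (v' k) (v' l) = (if k = l then 1 else 0)" .
  qed (rule v')
  moreover have "form LXstar (w j) (v' k) = (if k = j then of_real (\<mu> k) else 0)" if jk: "j < n" "k < n" for j k
  proof -
    have "form LXstar (w j) (v' k) = (\<Sum>i<n. cnj (form LXstar (w k) (v i)) / of_real (\<mu> k) * form LXstar (w j) (v i))"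
      unfolding v'_def using form_lincomb_right[of "{..<n}" v LXstar "w j"] vv wv[OF jk(1)] by simp
    also have "\<dots> = G (w j) (w k) / of_real (\<mu> k)"
      unfolding G_def sum_divide_distrib by (rule sum.cong) simp_all
    also have "\<dots> = (if k = j then of_real (\<mu> k) else 0)"
      using G[OF jk] mu[OF jk(2)] by (auto simp: field_simps simp flip: of_real_mult)
    finally show ?thesis .
  qed
  ultimately have "adapted n v' w \<mu>"
    using w mu by (auto simp: adapted_def)
  then show ?thesis by blast
qed

text \<open>Lists are unordered, so both bases must be permuted together before two functors can be
  matched.\<close>

lemma adapted_reindex:
  assumes "adapted n v w \<mu>" "bij_betw h {..<n} {..<n}"
  shows "adapted n (\<lambda>i. v (h i)) (\<lambda>i. w (h i)) (\<lambda>i. \<mu> (h i))"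
proof -
  have "h i < n" if "i < n" for i using assms(2) that by (auto simp: bij_betw_def)
  moreover have "h i = h j \<longleftrightarrow> i = j" if "i < n" "j < n" for i j
    using assms(2) that by (auto simp: bij_betw_def inj_on_def)
  ultimately show ?thesis
    using assms hilbert.onb_reindex[OF hil _ assms(2)] unfolding adapted_def by simp
qed

end

section \<open>The eigenvalue list\<close>

lemma mat_adjoint_dims [simp]: "dim_row (mat_adjoint A) = dim_col A" "dim_col (mat_adjoint A) = dim_row A"
  by (simp_all add: mat_adjoint_def)

lemma mat_adjoint_mat: "mat_adjoint (mat n m f) = mat m n (\<lambda>(i, j). cnj (f (j, i)))"
  by (rule eq_matI) (auto simp: mat_adjoint_def mat_of_rows_index)

lemma mat_mult_mat:
  "mat n m f * mat m k g = (mat n k (\<lambda>(i, j). \<Sum>l<m. f (i, l) * g (l, j)) :: complex mat)"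
  by (rule eq_matI) (auto simp: scalar_prod_def atLeast0LessThan)

lemma proots_linear_list: "proots (\<Prod>e\<leftarrow>es. [:- e, 1:]) = (mset es :: complex multiset)"
proof (induction es)
  case (Cons e es)
  have "(\<Prod>e\<leftarrow>es. [:- e, 1:]) \<noteq> 0" by (auto simp: prod_list_zero_iff)
  then have "proots ([:- e, 1:] * (\<Prod>e\<leftarrow>es. [:- e, 1:])) = proots [:- e, 1:] + proots (\<Prod>e\<leftarrow>es. [:- e, 1:])"
    by (intro proots_mult) auto
  then show ?case using Cons by (simp del: mult_pCons_left)
qed simp

lemma proots_upper_triangular:
  assumes "A \<in> carrier_mat n n" "upper_triangular A"
  shows "proots (char_poly A) = (mset (diag_mat A) :: complex multiset)"
  using char_poly_upper_triangular[OF assms] proots_linear_list by simp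

text \<open>After Schur triangularization the diagonal of the square consists of the squares of the
  diagonal entries. Together with nonnegativity this recovers the roots for a positive square root
  from those for its square.\<close>

lemma proots_char_poly_square:
  assumes P: "(P :: complex mat) \<in> carrier_mat n n"
  shows "proots (char_poly (P * P)) = image_mset (\<lambda>z. z * z) (proots (char_poly P))"
proof -
  obtain es where es: "char_poly P = (\<Prod>e\<leftarrow>es. [:- e, 1:])" using char_poly_factorized[OF P] by blast
  obtain B Q R where sd: "schur_decomposition P es = (B, Q, R)" by (metis prod_cases3)
  have wit: "similar_mat_wit P B Q R" and up: "upper_triangular B" and diag: "diag_mat B = es"
    using schur_decomposition[OF P es sd] by auto
  have B: "B \<in> carrier_mat n n" using similar_mat_witD2[OF P wit] by auto
  have "similar_mat_wit (P ^\<^sub>m 2) (B ^\<^sub>m 2) Q R" by (rule similar_mat_wit_pow[OF wit])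
  then have "similar_mat_wit (P * P) (B * B) Q R" using P B by (simp add: numeral_2_eq_2)
  then have cp: "char_poly (P * P) = char_poly (B * B)"
    by (intro char_poly_similar) (auto simp: similar_mat_def)
  have BB: "(B * B) $$ (i, j) = (\<Sum>k<n. B $$ (i, k) * B $$ (k, j))" if "i < n" "j < n" for i j
    using that B by (auto simp: scalar_prod_def atLeast0LessThan)
  have zero: "B $$ (i, j) = 0" if "j < i" "i < n" for i j using up that B by (auto simp: upper_triangular_def)
  have "upper_triangular (B * B)"
  proof (rule upper_triangularI)
    fix i j assume ij: "j < i" "i < dim_row (B * B)"
    then have i: "i < n" using B by simp
    have "B $$ (i, k) * B $$ (k, j) = 0" if "k < n" for k
      using zero[of k i] zero[of j k] ij i that by (cases "k < i") auto
    then have "(\<Sum>k<n. B $$ (i, k) * B $$ (k, j)) = 0" by (intro sum.neutral) auto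
    then show "(B * B) $$ (i, j) = 0" using BB[of i j] ij i by simp
  qed
  moreover have "diag_mat (B * B) = map (\<lambda>z. z * z) (diag_mat B)"
  proof -
    have "(B * B) $$ (i, i) = B $$ (i, i) * B $$ (i, i)" if i: "i < n" for i
    proof -
      have "B $$ (i, k) * B $$ (k, i) = (if k = i then B $$ (i, i) * B $$ (i, i) else 0)" if "k < n" for k
        using zero[of k i] zero[of i k] i that by (cases k i rule: linorder_cases) auto
      then have "(\<Sum>k<n. B $$ (i, k) * B $$ (k, i)) = (\<Sum>k<n. if k = i then B $$ (i, i) * B $$ (i, i) else 0)"
        by (intro sum.cong refl) simp
      then show ?thesis using BB[OF i i] i by simp
    qed
    then show ?thesis using B by (auto simp: diag_mat_def)
  qed
  moreover have "B * B \<in> carrier_mat n n" using B by simp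
  ultimately have "proots (char_poly (B * B)) = mset (map (\<lambda>z. z * z) es)"
    using proots_upper_triangular diag by metis
  then show ?thesis using cp es proots_linear_list by simp
qed

definition diagonal :: "nat \<Rightarrow> (nat \<Rightarrow> complex) \<Rightarrow> complex mat" where
  "diagonal n f = mat n n (\<lambda>(i, j). if i = j then f i else 0)"

lemma diagonal_carrier [simp]: "diagonal n f \<in> carrier_mat n n"
  by (simp add: diagonal_def)

lemma proots_diagonal: "proots (char_poly (diagonal n f)) = mset (map f [0..<n])"
proof -
  have "diag_mat (diagonal n f) = map f [0..<n]" by (simp add: diag_mat_def diagonal_def)
  moreover have "upper_triangular (diagonal n f)" by (auto simp: diagonal_def upper_triangular_def)
  ultimately show ?thesis using proots_upper_triangular[OF diagonal_carrier] by metis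
qed

lemma adjoint_diagonal: "mat_adjoint (diagonal n f) = diagonal n (\<lambda>i. cnj (f i))"
  unfolding diagonal_def mat_adjoint_mat by (rule eq_matI) auto

lemma psd_sqrt_eigenvalue_nonneg:
  assumes P: "psd_sqrt A P" and A: "A \<in> carrier_mat n n"
    and ev: "of_real \<mu> \<in># proots (char_poly P)"
  shows "\<mu> \<ge> 0"
proof -
  have Pc: "P \<in> carrier_mat n n" using P A by (simp add: psd_sqrt_def)
  have "char_poly P \<noteq> 0" using degree_monic_char_poly[OF Pc] by auto
  then have "poly (char_poly P) (of_real \<mu>) = 0" using ev by simp
  then have "eigenvalue P (of_real \<mu>)" using eigenvalue_root_char_poly[OF Pc] by simp
  then obtain x where x: "x \<in> carrier_vec n" "x \<noteq> 0\<^sub>v n" "P *\<^sub>v x = of_real \<mu> \<cdot>\<^sub>v x"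
    using Pc by (auto simp: eigenvalue_def eigenvector_def)
  have "x \<bullet>c x > 0" using conjugate_square_greater_0_vec[OF x(1)] x(2) by simp
  then have pos: "Re (x \<bullet>c x) > 0" by (simp add: less_complex_def)
  have "0 \<le> Re ((P *\<^sub>v x) \<bullet>c x)" using P A x(1) by (simp add: psd_sqrt_def)
  also have "(P *\<^sub>v x) \<bullet>c x = of_real \<mu> * (x \<bullet>c x)" using x by simp
  finally have "0 \<le> \<mu> * Re (x \<bullet>c x)" by simp
  then show ?thesis using pos by (simp add: zero_le_mult_iff)
qed

context fiber_functor
begin

lemma pairing_matrix_form: "pairing_matrix \<Phi> n v w = mat n n (\<lambda>(j, i). form LXstar (w j) (v i))"
  by (simp add: pairing_matrix_def form_def dmor_def eps_Xstar_def cap_def)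

text \<open>In adapted bases the pairing matrix is diagonal and positive, so it is itself the square
  root of its product with its adjoint.\<close>

lemma adapted_eigenvalue_list:
  assumes ad: "adapted n v w \<mu>"
  shows "eigenvalue_list \<Phi> (mset (map \<mu> [0..<n]))"
proof -
  have v: "orthonormal_basis (obj \<Phi> [LX]) n v" and w: "orthonormal_basis (obj \<Phi> [LXstar]) n w"
    and mu: "\<And>i. i < n \<Longrightarrow> \<mu> i > 0"
    using ad hilbert.orthonormal_basis_iff_onb[OF hil] by (auto simp: adapted_def)
  let ?P = "diagonal n (\<lambda>i. of_real (\<mu> i))"
  have pm: "pairing_matrix \<Phi> n v w = ?P"
    unfolding pairing_matrix_form diagonal_def by (rule eq_matI) (use ad in \<open>auto simp: adapted_def\<close>)
  have "psd_sqrt (?P * mat_adjoint ?P) ?P"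
    unfolding psd_sqrt_def
  proof (intro conjI ballI)
    have dr: "dim_row (?P * mat_adjoint ?P) = n" by (simp add: diagonal_def)
    show "?P \<in> carrier_mat (dim_row (?P * mat_adjoint ?P)) (dim_row (?P * mat_adjoint ?P))" unfolding dr by simp
    show "mat_adjoint ?P = ?P" "?P * ?P = ?P * mat_adjoint ?P" by (simp_all add: adjoint_diagonal)
    fix x :: "complex vec" assume "x \<in> carrier_vec (dim_row (?P * mat_adjoint ?P))"
    then have x: "x \<in> carrier_vec n" unfolding dr .
    have "(?P *\<^sub>v x) \<bullet>c x = (\<Sum>i<n. (\<Sum>j<n. (if i = j then of_real (\<mu> i) else 0) * x $ j) * cnj (x $ i))"
      using x by (auto simp: scalar_prod_def diagonal_def atLeast0LessThan intro!: sum.cong)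
    also have "\<dots> = (\<Sum>i<n. of_real (\<mu> i) * (x $ i * cnj (x $ i)))"
    proof (rule sum.cong)
      fix i assume i: "i \<in> {..<n}"
      have "(\<Sum>j<n. (if i = j then of_real (\<mu> i) else 0) * x $ j) = (\<Sum>j<n. if j = i then of_real (\<mu> i) * x $ i else 0)"
        by (rule sum.cong) auto
      then show "(\<Sum>j<n. (if i = j then of_real (\<mu> i) else 0) * x $ j) * cnj (x $ i) = of_real (\<mu> i) * (x $ i * cnj (x $ i))"
        using i by simp
    qed simp
    also have "\<dots> = of_real (\<Sum>i<n. \<mu> i * (cmod (x $ i))\<^sup>2)"
      by (simp only: complex_norm_square[symmetric] of_real_mult of_real_sum)
    finally have "Re ((?P *\<^sub>v x) \<bullet>c x) = (\<Sum>i<n. \<mu> i * (cmod (x $ i))\<^sup>2)"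
      by (simp only: Re_complex_of_real)
    then show "0 \<le> Re ((?P *\<^sub>v x) \<bullet>c x)"
      by (simp only:) (intro sum_nonneg mult_nonneg_nonneg; simp add: mu order.strict_implies_order)
  qed
  moreover have "image_mset complex_of_real (mset (map \<mu> [0..<n])) = proots (char_poly ?P)"
    by (simp add: proots_diagonal multiset.map_comp comp_def)
  ultimately show ?thesis
    unfolding eigenvalue_list_def using v w pm by metis
qed

text \<open>For other bases the diagonal matrix of the \<open>\<mu> i\<close> is multiplied by
  \<open>U\<close> on the left and by the transpose of \<open>V\<close> on the right, both unitary.
  In the product with the adjoint \<open>V\<close> cancels, and what remains is similar to the
  diagonal matrix of squares.\<close>

lemma eigenvalue_list_unique:
  assumes ad: "adapted n v w \<mu>" and ev: "eigenvalue_list \<Phi> \<nu>"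
  shows "\<nu> = mset (map \<mu> [0..<n])"
proof -
  interpret X: hilbert "obj \<Phi> [LX]" by (rule hil)
  interpret Y: hilbert "obj \<Phi> [LXstar]" by (rule hil)
  have v: "X.onb {..<n} v" and w: "Y.onb {..<n} w" and mu: "\<And>i. i < n \<Longrightarrow> \<mu> i > 0"
    and f: "\<And>i j. i < n \<Longrightarrow> j < n \<Longrightarrow> form LXstar (w j) (v i) = (if i = j then of_real (\<mu> i) else 0)"
    using ad by (auto simp: adapted_def)
  obtain n' v' w' P where v'0: "orthonormal_basis (obj \<Phi> [LX]) n' v'" and w'0: "orthonormal_basis (obj \<Phi> [LXstar]) n' w'"
    and P: "psd_sqrt (pairing_matrix \<Phi> n' v' w' * mat_adjoint (pairing_matrix \<Phi> n' v' w')) P"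
    and nu: "image_mset complex_of_real \<nu> = proots (char_poly P)"
    using ev unfolding eigenvalue_list_def by blast
  have "n' = n" using X.onb_card_unique[OF v] v'0 X.orthonormal_basis_iff_onb by force
  note P = P[unfolded \<open>n' = n\<close>]
  have v': "X.onb {..<n} v'" and w': "Y.onb {..<n} w'"
    using v'0 w'0 X.orthonormal_basis_iff_onb Y.orthonormal_basis_iff_onb \<open>n' = n\<close> by auto
  have vv: "v i \<in> vecs (obj \<Phi> [LX])" "v' i \<in> vecs (obj \<Phi> [LX])" if "i < n" for i
    using X.onb_vecs[OF v] X.onb_vecs[OF v'] that by auto
  have ww: "w i \<in> vecs (obj \<Phi> [LXstar])" "w' i \<in> vecs (obj \<Phi> [LXstar])" if "i < n" for i
    using Y.onb_vecs[OF w] Y.onb_vecs[OF w'] that by auto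
  define U where "U j k = ip (obj \<Phi> [LXstar]) (w' j) (w k)" for j k
  define V where "V i k = ip (obj \<Phi> [LX]) (v' i) (v k)" for i k
  let ?B = "pairing_matrix \<Phi> n v' w'"
  have B: "form LXstar (w' j) (v' i) = (\<Sum>k<n. U j k * of_real (\<mu> k) * V i k)" if ij: "i < n" "j < n" for i j
  proof -
    have "form LXstar (w' j) (v' i) = (\<Sum>k<n. U j k * form LXstar (w k) (v' i))"
      using form_lincomb_left[of "{..<n}" w LXstar "v' i" "U j"] ww vv ij Y.onb_expand[OF w ww(2)[OF ij(2)]]
      by (simp add: U_def)
    also have "\<dots> = (\<Sum>k<n. U j k * (\<Sum>l<n. V i l * form LXstar (w k) (v l)))"
      using form_lincomb_right[of "{..<n}" v LXstar _ "V i"] ww vv ij X.onb_expand[OF v vv(2)[OF ij(1)]]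
      by (simp add: V_def)
    also have "\<dots> = (\<Sum>k<n. U j k * (\<Sum>l<n. if l = k then V i k * of_real (\<mu> k) else 0))"
      by (intro sum.cong refl arg_cong[where f = "(*) _"]) (auto simp: f)
    finally show ?thesis by (simp add: mult_ac)
  qed
  \<comment> \<open>Parseval in the basis \<open>v'\<close>: the columns of the change of basis are
    orthonormal.\<close>
  have VV: "(\<Sum>i<n. V i k * cnj (V i l)) = (if k = l then 1 else 0)" if kl: "k < n" "l < n" for k l
  proof -
    have "(\<Sum>i<n. V i k * cnj (V i l)) = (\<Sum>i<n. ip (obj \<Phi> [LX]) (v l) (v' i) * cnj (ip (obj \<Phi> [LX]) (v k) (v' i)))"
    proof (rule sum.cong)
      fix i assume "i \<in> {..<n}"
      then show "V i k * cnj (V i l) = ip (obj \<Phi> [LX]) (v l) (v' i) * cnj (ip (obj \<Phi> [LX]) (v k) (v' i))"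
        using X.ip_commute[of "v' i" "v k"] X.ip_commute[of "v' i" "v l"] vv kl by (simp add: V_def)
    qed simp
    also have "\<dots> = ip (obj \<Phi> [LX]) (v l) (v k)"
      by (rule X.onb_parseval[OF v', symmetric]) (use vv kl in auto)
    finally show ?thesis using X.onb_ip[OF v] kl by auto
  qed
  have UU: "(\<Sum>k<n. U j k * cnj (U l k)) = (if j = l then 1 else 0)" if "j < n" "l < n" for j l
    using Y.onb_parseval[OF w, of "w' j" "w' l"] Y.onb_ip[OF w'] ww that by (simp add: U_def)
  have BB: "(\<Sum>i<n. form LXstar (w' j) (v' i) * cnj (form LXstar (w' l) (v' i))) =
      (\<Sum>k<n. U j k * of_real (\<mu> k * \<mu> k) * cnj (U l k))" if jl: "j < n" "l < n" for j l
  proof -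
    have "(\<Sum>i<n. form LXstar (w' j) (v' i) * cnj (form LXstar (w' l) (v' i))) =
        (\<Sum>i<n. \<Sum>k<n. \<Sum>m<n. (U j k * of_real (\<mu> k) * V i k) * cnj (U l m * of_real (\<mu> m) * V i m))"
      using jl by (simp add: B sum_product)
    also have "\<dots> = (\<Sum>k<n. \<Sum>i<n. \<Sum>m<n. (U j k * of_real (\<mu> k) * V i k) * cnj (U l m * of_real (\<mu> m) * V i m))"
      by (rule sum.swap)
    also have "\<dots> = (\<Sum>k<n. \<Sum>m<n. \<Sum>i<n. (U j k * of_real (\<mu> k) * V i k) * cnj (U l m * of_real (\<mu> m) * V i m))"
      by (intro sum.cong refl sum.swap)
    also have "\<dots> = (\<Sum>k<n. \<Sum>m<n. U j k * of_real (\<mu> k) * cnj (U l m * of_real (\<mu> m)) * (\<Sum>i<n. V i k * cnj (V i m)))"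
      unfolding sum_distrib_left by (intro sum.cong refl) (simp only: complex_cnj_mult mult_ac)
    also have "\<dots> = (\<Sum>k<n. \<Sum>m<n. if m = k then U j k * of_real (\<mu> k) * cnj (U l k * of_real (\<mu> k)) else 0)"
      by (intro sum.cong refl) (auto simp: VV)
    finally show ?thesis by (simp add: mult_ac)
  qed
  define M where "M = mat n n (\<lambda>(j, k). U j k)"
  define M' where "M' = mat n n (\<lambda>(k, j). cnj (U j k))"
  let ?A = "?B * mat_adjoint ?B" and ?D = "diagonal n (\<lambda>i. of_real (\<mu> i * \<mu> i))"
  have A: "?A = M * ?D * M'"
  proof -
    have "?A = mat n n (\<lambda>(j, l). \<Sum>i<n. form LXstar (w' j) (v' i) * cnj (form LXstar (w' l) (v' i)))"
      unfolding pairing_matrix_form mat_adjoint_mat mat_mult_mat by simp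
    also have "\<dots> = mat n n (\<lambda>(j, l). \<Sum>k<n. U j k * of_real (\<mu> k * \<mu> k) * cnj (U l k))"
      by (rule eq_matI) (auto simp: BB)
    also have "\<dots> = mat n n (\<lambda>(j, k). U j k * of_real (\<mu> k * \<mu> k)) * M'"
      unfolding M'_def mat_mult_mat by simp
    also have "mat n n (\<lambda>(j, k). U j k * of_real (\<mu> k * \<mu> k)) = M * ?D"
    proof -
      have "(\<Sum>l<n. U j l * (if l = k then of_real (\<mu> l * \<mu> l) else 0)) = U j k * of_real (\<mu> k * \<mu> k)" if "k < n" for j k
      proof -
        have "(\<Sum>l<n. U j l * (if l = k then of_real (\<mu> l * \<mu> l) else 0)) =
            (\<Sum>l<n. if l = k then U j k * of_real (\<mu> k * \<mu> k) else 0)"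
          by (rule sum.cong) auto
        then show ?thesis using that by simp
      qed
      then show ?thesis unfolding M_def diagonal_def mat_mult_mat by (intro eq_matI) auto
    qed
    finally show ?thesis .
  qed
  have M: "M \<in> carrier_mat n n" "M' \<in> carrier_mat n n" by (simp_all add: M_def M'_def)
  have MM: "M * M' = 1\<^sub>m n"
    unfolding M_def M'_def mat_mult_mat by (rule eq_matI) (auto simp: UU)
  then have "M' * M = 1\<^sub>m n" using mat_mult_left_right_inverse[OF M] by simp
  then have "similar_mat ?A ?D"
    using MM M A unfolding similar_mat_def similar_mat_wit_def Let_def
    by (intro exI[of _ M] exI[of _ M']) (auto simp: pairing_matrix_form)
  then have "proots (char_poly ?A) = mset (map (\<lambda>i. of_real (\<mu> i * \<mu> i)) [0..<n])"
    using char_poly_similar proots_diagonal by metis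
  moreover have Ac: "?A \<in> carrier_mat n n" unfolding pairing_matrix_form mat_adjoint_mat mat_mult_mat by simp
  moreover have Pc: "P \<in> carrier_mat n n" and PP: "P * P = ?A"
    using P Ac by (auto simp: psd_sqrt_def)
  ultimately have "image_mset (\<lambda>z. z * z) (image_mset complex_of_real \<nu>) = mset (map (\<lambda>i. of_real (\<mu> i * \<mu> i)) [0..<n])"
    using proots_char_poly_square[OF Pc] nu by simp
  then have "image_mset complex_of_real (image_mset (\<lambda>x. x * x) \<nu>) =
      image_mset complex_of_real (mset (map (\<lambda>i. \<mu> i * \<mu> i) [0..<n]))"
    by (simp add: multiset.map_comp comp_def)
  then have sq: "image_mset (\<lambda>x. x * x) \<nu> = mset (map (\<lambda>i. \<mu> i * \<mu> i) [0..<n])"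
    by (rule multiset.inj_map_strong[rotated]) simp
  have nonneg: "x \<ge> 0" if "x \<in># \<nu>" for x
  proof -
    have "complex_of_real x \<in># proots (char_poly P)" using that nu by (metis image_eqI set_image_mset)
    then show ?thesis by (rule psd_sqrt_eigenvalue_nonneg[OF P Ac])
  qed
  \<comment> \<open>The squares determine the list, since the entries of \<open>\<nu>\<close> and
    the \<open>\<mu> i\<close> are nonnegative.\<close>
  have "\<nu> = image_mset (\<lambda>x. sqrt (x * x)) \<nu>"
    using nonneg by (intro sym[OF multiset.map_ident_strong]) auto
  also have "\<dots> = image_mset sqrt (image_mset (\<lambda>x. x * x) \<nu>)" by (simp add: multiset.map_comp comp_def)
  also have "\<dots> = mset (map (\<lambda>i. sqrt (\<mu> i * \<mu> i)) [0..<n])" unfolding sq by (simp add: multiset.map_comp comp_def)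
  also have "map (\<lambda>i. sqrt (\<mu> i * \<mu> i)) [0..<n] = map \<mu> [0..<n]" using mu by (auto simp: less_imp_le)
  finally show ?thesis .
qed

lemma adapted_positive_list:
  assumes ad: "adapted n v w \<mu>"
  shows "mset (map \<mu> [0..<n]) \<in> positive_lists d"
proof -
  note s = adapted_sums[OF ad]
  have "n \<noteq> 0" using s(1) d0 by (cases n) auto
  moreover have "\<forall>i<n. \<mu> i > 0" using ad by (simp add: adapted_def)
  moreover have "sum_mset (image_mset f (mset (map \<mu> [0..<n]))) = (\<Sum>i<n. f (\<mu> i))" for f :: "real \<Rightarrow> real"
    by (simp add: comp_def sum_mset_sum_list interv_sum_list_conv_sum_set_nat atLeast0LessThan flip: mset_map)
  moreover have "x > 0" if "x \<in># mset (map \<mu> [0..<n])" for x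
    using that \<open>\<forall>i<n. \<mu> i > 0\<close> by auto
  moreover have "mset (map \<mu> [0..<n]) \<noteq> {#}"
    using \<open>n \<noteq> 0\<close> by (simp only: mset_zero_iff map_is_Nil_conv upt_eq_Nil_conv) simp
  ultimately show ?thesis using s by (simp only: positive_lists_def mem_Collect_eq) simp
qed

end

section \<open>Equivalence of fiber functors\<close>

context fiber_functor
begin

text \<open>Tensors of basis vectors of the letters, bracketed to the right; strict associativity
  makes them compatible with any splitting of the word.\<close>

primrec word_basis :: "(letter \<Rightarrow> nat \<Rightarrow> 'a) \<Rightarrow> word \<Rightarrow> nat list \<Rightarrow> 'a" where
  "word_basis e [] I = vac \<Phi>"
| "word_basis e (a # w) I = ten \<Phi> [a] w (e a (hd I)) (word_basis e w (tl I))"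

context
  fixes e :: "letter \<Rightarrow> nat \<Rightarrow> 'a" and n :: nat
  assumes e: "\<And>a. hilbert.onb (obj \<Phi> [a]) {..<n} (e a)"
begin

lemma word_basis_onb: "hilbert.onb (obj \<Phi> w) (tuples n (length w)) (word_basis e w)"
proof (induction w)
  case Nil
  have "word_basis e [] = (\<lambda>_. vac \<Phi>)" by (simp add: fun_eq_iff)
  then show ?case using vac_onb by simp
next
  case (Cons a w)
  let ?h = "\<lambda>I :: nat list. (hd I, tl I)"
  have "hilbert.onb (obj \<Phi> (a # w)) ({..<n} \<times> tuples n (length w)) (\<lambda>(i, J). ten \<Phi> [a] w (e a i) (word_basis e w J))"
    using onb_tensor[OF hil hil hil is_tensor e Cons, of a] by simp
  moreover have "bij_betw ?h (tuples n (Suc (length w))) ({..<n} \<times> tuples n (length w))"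
    by (rule bij_betw_byWitness[where f' = "\<lambda>(i, J). i # J"]) (auto simp: tuples_def length_Suc_conv)
  ultimately have "hilbert.onb (obj \<Phi> (a # w)) (tuples n (Suc (length w)))
      (\<lambda>I. case ?h I of (i, J) \<Rightarrow> ten \<Phi> [a] w (e a i) (word_basis e w J))"
    by (rule hilbert.onb_reindex[OF hil])
  then show ?case by simp
qed

lemma word_basis_vecs: "I \<in> tuples n (length w) \<Longrightarrow> word_basis e w I \<in> vecs (obj \<Phi> w)"
  by (rule hilbert.onb_vecs[OF hil word_basis_onb])

lemma word_basis_append:
  assumes "I \<in> tuples n (length u)" "J \<in> tuples n (length v)"
  shows "word_basis e (u @ v) (I @ J) = ten \<Phi> u v (word_basis e u I) (word_basis e v J)"
  using assms(1)
proof (induction u arbitrary: I)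
  case Nil
  then show ?case using ten_vac(1)[OF word_basis_vecs[OF assms(2)]] by simp
next
  case (Cons a u)
  then obtain i I' where I: "I = i # I'" "i < n" "I' \<in> tuples n (length u)"
    by (auto simp: tuples_def length_Suc_conv)
  have "e a i \<in> vecs (obj \<Phi> [a])" using hilbert.onb_vecs[OF hil e] I(2) by simp
  then show ?case
    using Cons.IH[OF I(3)] ten_assoc[of "e a i" "[a]" _ u _ v] word_basis_vecs[OF I(3)] word_basis_vecs[OF assms(2)]
    by (simp add: I(1))
qed

lemma word_basis_pair:
  "i < n \<Longrightarrow> j < n \<Longrightarrow> word_basis e [a, b] [i, j] = ten \<Phi> [a] [b] (e a i) (e b j)"
  using ten_vac(2)[of "e b j" "[b]"] hilbert.onb_vecs[OF hil e, of j b] by simp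

end

text \<open>Additivity is available for two morphisms at a time, so \<open>f\<close> is built up
  from its truncations to finite sets of diagrams.\<close>

lemma mor_expand:
  assumes f: "f \<in> Hom u v" and x: "x \<in> vecs (obj \<Phi> u)"
  shows "mor \<Phi> u v f x = (\<Sum>D\<in>kauffman u v. scl (obj \<Phi> v) (f D) (dmor u v D x))"
proof -
  interpret hilbert "obj \<Phi> v" by (rule hil)
  have zero: "(\<lambda>_. 0) \<in> Hom u v" by (simp add: Hom_def)
  have "finite S \<Longrightarrow> S \<subseteq> kauffman u v \<Longrightarrow>
      mor \<Phi> u v (\<lambda>D. if D \<in> S then f D else 0) x = (\<Sum>D\<in>S. scl (obj \<Phi> v) (f D) (dmor u v D x))" for S
  proof (induction S rule: finite_induct)
    case empty
    then show ?case using mor_scale[OF zero x, of 0] by simp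
  next
    case (insert D S)
    have "(\<lambda>E. if E \<in> insert D S then f E else 0) = (\<lambda>E. f D * of_diagram D E + (if E \<in> S then f E else 0))"
      using insert by (auto simp: fun_eq_iff of_diagram_def)
    moreover have "(\<lambda>E. f D * of_diagram D E) \<in> Hom u v" "(\<lambda>E. if E \<in> S then f E else 0) \<in> Hom u v"
      using insert by (auto simp: Hom_def of_diagram_def)
    ultimately show ?case
      using insert mor_add x mor_scale[OF of_diagram_Hom x] by (simp add: dmor_def)
  qed
  from this[OF finite_kauffman[of u v]]
  have "mor \<Phi> u v (\<lambda>D. if D \<in> kauffman u v then f D else 0) x = (\<Sum>D\<in>kauffman u v. scl (obj \<Phi> v) (f D) (dmor u v D x))"
    by simp
  moreover have "(\<lambda>D. if D \<in> kauffman u v then f D else 0) = f" using f by (auto simp: Hom_def fun_eq_iff)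
  ultimately show ?thesis by simp
qed

end

lemma unitary_map_linear: "unitary_map H L T \<Longrightarrow> linear_map H L T"
  by (simp add: unitary_map_def)

lemma unitary_map_vecs: "unitary_map H L T \<Longrightarrow> x \<in> vecs H \<Longrightarrow> T x \<in> vecs L"
  by (simp add: unitary_map_def linear_map_def)

lemma unitary_map_ip: "unitary_map H L T \<Longrightarrow> x \<in> vecs H \<Longrightarrow> y \<in> vecs H \<Longrightarrow> ip L (T x) (T y) = ip H x y"
  by (simp add: unitary_map_def)

lemma onb_unitary:
  assumes "hilbert H" "hilbert L" and T: "unitary_map H L T" and v: "hilbert.onb H A v"
  shows "hilbert.onb L A (\<lambda>i. T (v i))"
proof -
  interpret H: hilbert H by fact
  interpret L: hilbert L by fact
  show ?thesis
  proof (rule L.onbI)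
    fix y assume "y \<in> vecs L"
    then have "y \<in> T ` vecs H" using T by (simp add: unitary_map_def)
    then obtain x where x: "x \<in> vecs H" "y = T x" by blast
    have "y = T (\<Sum>i\<in>A. scl H (ip H x (v i)) (v i))" by (simp add: H.onb_expand[OF v x(1)] x)
    also have "\<dots> = (\<Sum>i\<in>A. scl L (ip H x (v i)) (T (v i)))"
      by (rule linear_map_sum[OF assms(1) unitary_map_linear[OF T] H.onb_vecs[OF v] H.onb_finite[OF v] assms(2)])
    also have "\<dots> \<in> L.span ((\<lambda>i. T (v i)) ` A)" by (intro L.span_sum L.span_scale L.span_base imageI)
    finally show "y \<in> L.span ((\<lambda>i. T (v i)) ` A)" .
  qed (use H.onb_finite[OF v] H.onb_vecs[OF v] H.onb_ip[OF v] T in \<open>auto simp: unitary_map_ip unitary_map_vecs\<close>)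
qed

section \<open>Comparison of two fiber functors\<close>

locale fiber_pair = F: fiber_functor d \<Phi> + G: fiber_functor d \<Psi>
  for d and \<Phi> :: "'a::ab_group_add fiber" and \<Psi> :: "'b::ab_group_add fiber"
begin

text \<open>The equivalence carries \<open>vac \<Phi>\<close> to \<open>vac \<Psi>\<close> and
  respects tensors, so transported bases have the same pairing matrix and the same square root
  \<open>P\<close> serves.\<close>

lemma eigenvalue_list_transport:
  assumes eq: "unitarily_equivalent \<Phi> \<Psi>" and ev: "eigenvalue_list \<Phi> \<mu>"
  shows "eigenvalue_list \<Psi> \<mu>"
proof -
  obtain U :: "word \<Rightarrow> 'a \<Rightarrow> 'b" where
    U: "\<And>w. unitary_map (obj \<Phi> w) (obj \<Psi> w) (U w)" and
    nat: "\<And>u v f x. f \<in> Hom u v \<Longrightarrow> x \<in> vecs (obj \<Phi> u) \<Longrightarrow> U v (mor \<Phi> u v f x) = mor \<Psi> u v f (U u x)" and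
    ten: "\<And>u v x y. x \<in> vecs (obj \<Phi> u) \<Longrightarrow> y \<in> vecs (obj \<Phi> v) \<Longrightarrow>
      U (u @ v) (ten \<Phi> u v x y) = ten \<Psi> u v (U u x) (U v y)" and
    vac: "U [] (vac \<Phi>) = vac \<Psi>"
    using eq unfolding unitarily_equivalent_def by blast
  obtain n v w P where v: "orthonormal_basis (obj \<Phi> [LX]) n v" and w: "orthonormal_basis (obj \<Phi> [LXstar]) n w"
    and P: "psd_sqrt (pairing_matrix \<Phi> n v w * mat_adjoint (pairing_matrix \<Phi> n v w)) P"
      "image_mset complex_of_real \<mu> = proots (char_poly P)"
    using ev unfolding eigenvalue_list_def by blast
  note v' = v[unfolded hilbert.orthonormal_basis_iff_onb[OF F.hil]]
  note w' = w[unfolded hilbert.orthonormal_basis_iff_onb[OF F.hil]]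
  have "G.form LXstar (U [LXstar] y) (U [LX] x) = F.form LXstar y x"
    if x: "x \<in> vecs (obj \<Phi> [LX])" and y: "y \<in> vecs (obj \<Phi> [LXstar])" for x y
  proof -
    have t: "ten \<Phi> [LXstar] [LX] y x \<in> vecs (obj \<Phi> [LXstar, LX])" by (rule F.ten_pair_vecs[OF y x])
    have cap: "cap LXstar \<in> kauffman [LXstar, LX] []" using cap_kauffman[of LXstar] by simp
    have "G.dmor [LXstar, LX] [] (cap LXstar) (ten \<Psi> [LXstar] [LX] (U [LXstar] y) (U [LX] x)) =
        U [] (F.dmor [LXstar, LX] [] (cap LXstar) (ten \<Phi> [LXstar] [LX] y x))"
      using ten[OF y x] nat[OF of_diagram_Hom[OF cap] t] by (simp add: F.dmor_def G.dmor_def)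
    then show ?thesis
      unfolding F.form_def G.form_def
      using unitary_map_ip[OF U F.dmor_vecs[OF cap t] F.vac_vecs] vac by simp
  qed
  then have "pairing_matrix \<Psi> n (\<lambda>i. U [LX] (v i)) (\<lambda>i. U [LXstar] (w i)) = pairing_matrix \<Phi> n v w"
    unfolding F.pairing_matrix_form G.pairing_matrix_form
    using hilbert.onb_vecs[OF F.hil v'] hilbert.onb_vecs[OF F.hil w'] by (intro eq_matI) auto
  moreover have "orthonormal_basis (obj \<Psi> [LX]) n (\<lambda>i. U [LX] (v i))"
    "orthonormal_basis (obj \<Psi> [LXstar]) n (\<lambda>i. U [LXstar] (w i))"
    unfolding hilbert.orthonormal_basis_iff_onb[OF G.hil]
    using onb_unitary[OF F.hil G.hil U] v' w' by auto
  ultimately show ?thesis using P unfolding eigenvalue_list_def by metis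
qed

context
  fixes n :: nat and e :: "letter \<Rightarrow> nat \<Rightarrow> 'a" and e' :: "letter \<Rightarrow> nat \<Rightarrow> 'b"
  assumes e: "\<And>a. hilbert.onb (obj \<Phi> [a]) {..<n} (e a)" and e': "\<And>a. hilbert.onb (obj \<Psi> [a]) {..<n} (e' a)"
    and forms: "\<And>a i j. i < n \<Longrightarrow> j < n \<Longrightarrow> F.form a (e a i) (e (dual a) j) = G.form a (e' a i) (e' (dual a) j)"
begin

text \<open>It carries one word basis to the other; compatibility with tensors forces this once the
  bases of the letters are matched.\<close>

definition intertwiner :: "word \<Rightarrow> 'a \<Rightarrow> 'b" where
  "intertwiner w x = (\<Sum>I\<in>tuples n (length w). scl (obj \<Psi> w) (ip (obj \<Phi> w) x (F.word_basis e w I)) (G.word_basis e' w I))"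

lemma intertwiner_unitary: "unitary_map (obj \<Phi> w) (obj \<Psi> w) (intertwiner w)"
  unfolding intertwiner_def
  by (rule unitary_map_onb(1)[OF F.hil G.hil F.word_basis_onb[OF e] G.word_basis_onb[OF e']])

lemma intertwiner_basis: "I \<in> tuples n (length w) \<Longrightarrow> intertwiner w (F.word_basis e w I) = G.word_basis e' w I"
  unfolding intertwiner_def
  by (rule unitary_map_onb(2)[OF F.hil G.hil F.word_basis_onb[OF e] G.word_basis_onb[OF e']])

lemmas intertwiner_linear = unitary_map_linear[OF intertwiner_unitary]
lemmas intertwiner_vecs = unitary_map_vecs[OF intertwiner_unitary]

lemma intertwiner_vac: "intertwiner [] (vac \<Phi>) = vac \<Psi>"
  using intertwiner_basis[of "[]" "[]"] by simp

text \<open>Linear extension from basis vectors, first in \<open>y\<close> and then in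
  \<open>x\<close>.\<close>

lemma intertwiner_ten:
  assumes x: "x \<in> vecs (obj \<Phi> u)" and y: "y \<in> vecs (obj \<Phi> v)"
  shows "intertwiner (u @ v) (ten \<Phi> u v x y) = ten \<Psi> u v (intertwiner u x) (intertwiner v y)"
proof -
  have 1: "intertwiner (u @ v) (ten \<Phi> u v (F.word_basis e u I) y) = ten \<Psi> u v (intertwiner u (F.word_basis e u I)) (intertwiner v y)"
    if I: "I \<in> tuples n (length u)" for I
  proof (rule linear_map_eq_onb[OF F.hil G.hil F.word_basis_onb[OF e] _ _ _ y])
    note Iv = F.word_basis_vecs[OF e I]
    show "linear_map (obj \<Phi> v) (obj \<Psi> (u @ v)) (\<lambda>y. intertwiner (u @ v) (ten \<Phi> u v (F.word_basis e u I) y))"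
      by (rule linear_map_comp[OF F.ten_linear_right[OF Iv] intertwiner_linear])
    show "linear_map (obj \<Phi> v) (obj \<Psi> (u @ v)) (\<lambda>y. ten \<Psi> u v (intertwiner u (F.word_basis e u I)) (intertwiner v y))"
      by (rule linear_map_comp[OF intertwiner_linear G.ten_linear_right[OF intertwiner_vecs[OF Iv]]])
    fix J assume J: "J \<in> tuples n (length v)"
    then have IJ: "I @ J \<in> tuples n (length (u @ v))" using I by (auto simp: tuples_def)
    show "intertwiner (u @ v) (ten \<Phi> u v (F.word_basis e u I) (F.word_basis e v J)) =
        ten \<Psi> u v (intertwiner u (F.word_basis e u I)) (intertwiner v (F.word_basis e v J))"
      using intertwiner_basis[OF IJ] F.word_basis_append[OF e I J] G.word_basis_append[OF e' I J]
      by (simp add: intertwiner_basis[OF I] intertwiner_basis[OF J])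
  qed
  show ?thesis
    by (rule linear_map_eq_onb[OF F.hil G.hil F.word_basis_onb[OF e]
        linear_map_comp[OF F.ten_linear_left[OF y] intertwiner_linear]
        linear_map_comp[OF intertwiner_linear G.ten_linear_left[OF intertwiner_vecs[OF y]]] 1 x])
qed

definition commutes :: "word \<Rightarrow> word \<Rightarrow> diagram \<Rightarrow> bool" where
  "commutes u v D \<longleftrightarrow> (\<forall>x\<in>vecs (obj \<Phi> u). intertwiner v (F.dmor u v D x) = G.dmor u v D (intertwiner u x))"

lemma commutesD: "commutes u v D \<Longrightarrow> x \<in> vecs (obj \<Phi> u) \<Longrightarrow>
    intertwiner v (F.dmor u v D x) = G.dmor u v D (intertwiner u x)"
  by (simp add: commutes_def)

lemma commutes_onb:
  assumes D: "D \<in> kauffman u v" and b: "hilbert.onb (obj \<Phi> u) A b"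
    and "\<And>i. i \<in> A \<Longrightarrow> intertwiner v (F.dmor u v D (b i)) = G.dmor u v D (intertwiner u (b i))"
  shows "commutes u v D"
  unfolding commutes_def
  using linear_map_eq_onb[OF F.hil G.hil b linear_map_comp[OF F.dmor_linear[OF D] intertwiner_linear]
      linear_map_comp[OF intertwiner_linear G.dmor_linear[OF D]] assms(3)] by blast

lemma commutes_id: "commutes w w (id_diagram w)"
  unfolding commutes_def using F.dmor_id G.dmor_id intertwiner_vecs by simp

text \<open>The equality of the pairings in the chosen bases enters here.\<close>

lemma commutes_cap: "commutes [a, dual a] [] (cap a)"
proof (rule commutes_onb[OF cap_kauffman F.pair_onb[OF e e]])
  fix p assume "p \<in> {..<n} \<times> {..<n}"
  then obtain i j where p: "p = (i, j)" and ij: "i < n" "j < n" by auto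
  have v: "e a i \<in> vecs (obj \<Phi> [a])" "e (dual a) j \<in> vecs (obj \<Phi> [dual a])"
    "e' a i \<in> vecs (obj \<Psi> [a])" "e' (dual a) j \<in> vecs (obj \<Psi> [dual a])"
    using ij hilbert.onb_vecs[OF F.hil e] hilbert.onb_vecs[OF G.hil e'] by auto
  have "[i, j] \<in> tuples n (length [a, dual a])" using ij by (simp add: tuples_def)
  from intertwiner_basis[OF this]
  have U: "intertwiner [a, dual a] (ten \<Phi> [a] [dual a] (e a i) (e (dual a) j)) = ten \<Psi> [a] [dual a] (e' a i) (e' (dual a) j)"
    by (simp only: F.word_basis_pair[OF e ij] G.word_basis_pair[OF e' ij])
  have "intertwiner [] (scl (obj \<Phi> []) c (vac \<Phi>)) = scl (obj \<Psi> []) c (vac \<Psi>)" for c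
    using intertwiner_linear[of "[]"] F.vac_vecs intertwiner_vac by (simp add: linear_map_def)
  then show "intertwiner [] (F.dmor [a, dual a] [] (cap a) (case p of (i, j) \<Rightarrow> ten \<Phi> [a] [dual a] (e a i) (e (dual a) j))) =
      G.dmor [a, dual a] [] (cap a) (intertwiner [a, dual a] (case p of (i, j) \<Rightarrow> ten \<Phi> [a] [dual a] (e a i) (e (dual a) j)))"
    unfolding p prod.case U F.dmor_cap[OF v(1,2)] G.dmor_cap[OF v(3,4)] using forms[OF ij] by simp
qed

text \<open>By \<open>dmor_star\<close> a reflected diagram is the adjoint up to a sign, which is
  the same for both functors, and unitary maps that intertwine two maps intertwine their
  adjoints.\<close>

lemma commutes_reflect:
  assumes D: "D \<in> kauffman u v" and c: "commutes u v D"
  shows "commutes v u (reflect D)"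
  unfolding commutes_def
proof
  fix y assume y: "y \<in> vecs (obj \<Phi> v)"
  interpret H: hilbert "obj \<Psi> u" by (rule G.hil)
  note R = reflect_kauffman[OF D]
  let ?l = "intertwiner u (F.dmor v u (reflect D) y)" and ?r = "G.dmor v u (reflect D) (intertwiner v y)"
  have l: "?l \<in> vecs (obj \<Psi> u)" by (intro intertwiner_vecs F.dmor_vecs[OF R y])
  have r: "?r \<in> vecs (obj \<Psi> u)" by (intro G.dmor_vecs[OF R] intertwiner_vecs y)
  have "F.\<sigma> \<noteq> 0" using F.sigma(1) by auto
  then have s0: "F.\<sigma> powi sharp D \<noteq> 0" by simp
  have "ip (obj \<Psi> u) z ?l = ip (obj \<Psi> u) z ?r" if z: "z \<in> vecs (obj \<Psi> u)" for z
  proof -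
    have "z \<in> intertwiner u ` vecs (obj \<Phi> u)" using z intertwiner_unitary[of u] by (simp add: unitary_map_def)
    then obtain x where x: "x \<in> vecs (obj \<Phi> u)" "z = intertwiner u x" by blast
    have "F.\<sigma> powi sharp D * ip (obj \<Psi> u) z ?l = F.\<sigma> powi sharp D * ip (obj \<Phi> u) x (F.dmor v u (reflect D) y)"
      unfolding x(2) by (simp add: unitary_map_ip[OF intertwiner_unitary x(1) F.dmor_vecs[OF R y]])
    also have "\<dots> = ip (obj \<Phi> v) (F.dmor u v D x) y" by (rule F.dmor_star[OF D x(1) y, symmetric])
    also have "\<dots> = ip (obj \<Psi> v) (intertwiner v (F.dmor u v D x)) (intertwiner v y)"
      by (rule unitary_map_ip[OF intertwiner_unitary F.dmor_vecs[OF D x(1)] y, symmetric])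
    also have "\<dots> = ip (obj \<Psi> v) (G.dmor u v D z) (intertwiner v y)"
      using commutesD[OF c x(1)] x(2) by simp
    also have "\<dots> = F.\<sigma> powi sharp D * ip (obj \<Psi> u) z ?r"
      by (rule G.dmor_star[OF D z intertwiner_vecs[OF y]])
    finally show ?thesis by (simp only: mult_left_cancel[OF s0])
  qed
  note z = H.vecs_closed(3)[OF l r]
  have "ip (obj \<Psi> u) (?l - ?r) (?l - ?r) = ip (obj \<Psi> u) ?l (?l - ?r) - ip (obj \<Psi> u) ?r (?l - ?r)"
    by (rule H.ip_diff[OF l r z])
  also have "\<dots> = cnj (ip (obj \<Psi> u) (?l - ?r) ?l) - cnj (ip (obj \<Psi> u) (?l - ?r) ?r)"
    using H.ip_commute[OF z l] H.ip_commute[OF z r] by (simp only:)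
  also have "\<dots> = 0" unfolding \<open>\<And>z. z \<in> vecs (obj \<Psi> u) \<Longrightarrow> ip (obj \<Psi> u) z ?l = ip (obj \<Psi> u) z ?r\<close>[OF z] by simp
  finally have "ip (obj \<Psi> u) (?l - ?r) (?l - ?r) = 0" .
  then show "?l = ?r" using H.ip_eq_0[OF H.vecs_closed(3)[OF l r]] by simp
qed

lemma commutes_juxtapose:
  assumes D: "D \<in> kauffman u u'" and E: "E \<in> kauffman v v'" and "commutes u u' D" "commutes v v' E"
  shows "commutes (u @ v) (u' @ v') (juxtapose (length u) (length u') D E)"
proof (rule commutes_onb[OF juxtapose_kauffman[OF D E]
      onb_tensor[OF F.hil F.hil F.hil F.is_tensor F.word_basis_onb[OF e] F.word_basis_onb[OF e]]])
  fix p assume "p \<in> tuples n (length u) \<times> tuples n (length v)"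
  then obtain I J where p: "p = (I, J)" and IJ: "I \<in> tuples n (length u)" "J \<in> tuples n (length v)" by auto
  let ?x = "F.word_basis e u I" and ?y = "F.word_basis e v J"
  have x: "?x \<in> vecs (obj \<Phi> u)" and y: "?y \<in> vecs (obj \<Phi> v)" using F.word_basis_vecs[OF e] IJ by auto
  let ?J = "juxtapose (length u) (length u') D E"
  have "intertwiner (u' @ v') (F.dmor (u @ v) (u' @ v') ?J (ten \<Phi> u v ?x ?y)) =
      ten \<Psi> u' v' (G.dmor u u' D (intertwiner u ?x)) (G.dmor v v' E (intertwiner v ?y))"
    by (simp only: F.dmor_tensor[OF D E x y] intertwiner_ten[OF F.dmor_vecs[OF D x] F.dmor_vecs[OF E y]]
        commutesD[OF assms(3) x] commutesD[OF assms(4) y])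
  also have "\<dots> = G.dmor (u @ v) (u' @ v') ?J (intertwiner (u @ v) (ten \<Phi> u v ?x ?y))"
    by (simp only: intertwiner_ten[OF x y] G.dmor_tensor[OF D E intertwiner_vecs[OF x] intertwiner_vecs[OF y]])
  finally show "intertwiner (u' @ v') (F.dmor (u @ v) (u' @ v') ?J
      (case p of (i, j) \<Rightarrow> ten \<Phi> u v (F.word_basis e u i) (F.word_basis e v j))) =
    G.dmor (u @ v) (u' @ v') ?J (intertwiner (u @ v)
      (case p of (i, j) \<Rightarrow> ten \<Phi> u v (F.word_basis e u i) (F.word_basis e v j)))"
    unfolding p prod.case .
qed

text \<open>Without loops the functors turn concatenation into composition with no scalar
  factor.\<close>

lemma commutes_stack:
  assumes D: "D \<in> kauffman u v" and E: "E \<in> kauffman v w" and c: "commutes u v D" "commutes v w E"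
    and l: "loops D E = 0"
  shows "commutes u w (stack D E)"
  unfolding commutes_def
proof
  fix x assume x: "x \<in> vecs (obj \<Phi> u)"
  interpret H: hilbert "obj \<Phi> w" by (rule F.hil)
  interpret K: hilbert "obj \<Psi> w" by (rule G.hil)
  have "F.dmor u w (stack D E) x = F.dmor v w E (F.dmor u v D x)"
    using F.dmor_comp[OF D E x] by (simp add: l)
  moreover have "G.dmor u w (stack D E) (intertwiner u x) = G.dmor v w E (G.dmor u v D (intertwiner u x))"
    using G.dmor_comp[OF D E intertwiner_vecs[OF x]] by (simp add: l)
  ultimately show "intertwiner w (F.dmor u w (stack D E) x) = G.dmor u w (stack D E) (intertwiner u x)"
    using commutesD[OF c(1) x] commutesD[OF c(2) F.dmor_vecs[OF D x]] by simp
qed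

lemma commutes_kauffman: "D \<in> kauffman u v \<Longrightarrow> commutes u v D"
proof (induction rule: kauffman_induct)
  case empty
  then show ?case using commutes_id[of "[]"] by simp
next
  case (cup a u v D)
  have "commutes [] [a, dual a] (cup a)"
    using commutes_reflect[OF cap_kauffman commutes_cap, of a] by (simp add: reflect_cap)
  from commutes_juxtapose[OF cup_kauffman cup(1) this cup(2)] show ?case by (simp add: numeral_2_eq_2)
next
  case (bend a u v D)
  note st = stack_bend[OF bend(1)]
  \<comment> \<open>By \<open>stack_bend\<close> the bent diagram is an identity string beside
    \<open>D\<close>, followed by a cap beside an identity.\<close>
  have "commutes ([dual a] @ u) ([dual a] @ (a # v)) (juxtapose (length [dual a]) (length [dual a]) (id_diagram [dual a]) D)"
    by (rule commutes_juxtapose[OF id_diagram_kauffman bend(1) commutes_id bend(2)])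
  moreover have "commutes ([dual a, dual (dual a)] @ v) ([] @ v)
      (juxtapose (length [dual a, dual (dual a)]) (length ([] :: word)) (cap (dual a)) (id_diagram v))"
    by (rule commutes_juxtapose[OF cap_kauffman id_diagram_kauffman commutes_cap commutes_id])
  ultimately show ?case
    using commutes_stack[OF st(1,2) _ _ st(4)] st(3) by (simp add: numeral_2_eq_2)
next
  case (reflect u v D)
  then show ?case by (rule commutes_reflect)
qed

lemma equivalent: "unitarily_equivalent \<Phi> \<Psi>"
  unfolding unitarily_equivalent_def
proof (intro exI[of _ intertwiner] conjI allI ballI)
  fix u v f x assume f: "f \<in> Hom u v" and x: "x \<in> vecs (obj \<Phi> u)"
  have "intertwiner v (mor \<Phi> u v f x) = (\<Sum>D\<in>kauffman u v. scl (obj \<Psi> v) (f D) (intertwiner v (F.dmor u v D x)))"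
    unfolding F.mor_expand[OF f x]
    by (rule linear_map_sum[OF F.hil intertwiner_linear F.dmor_vecs[OF _ x] finite_kauffman G.hil])
  also have "\<dots> = mor \<Psi> u v f (intertwiner u x)"
    unfolding G.mor_expand[OF f intertwiner_vecs[OF x]]
    by (intro sum.cong refl) (simp add: commutesD[OF commutes_kauffman x])
  finally show "intertwiner v (mor \<Phi> u v f x) = mor \<Psi> u v f (intertwiner u x)" .
qed (fact intertwiner_unitary intertwiner_ten intertwiner_vac)+

end

text \<open>The pairing for the letter X is determined by the one for X* through
  \<open>adapted_form_LX\<close>, so both pairings agree in the adapted bases.\<close>

lemma equivalent_adapted:
  assumes F: "F.adapted n v w \<mu>" and G: "G.adapted n v' w' \<mu>"
  shows "unitarily_equivalent \<Phi> \<Psi>"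
proof (rule equivalent)
  let ?e = "\<lambda>a. if a = LX then v else w" and ?e' = "\<lambda>a. if a = LX then v' else w'"
  show "hilbert.onb (obj \<Phi> [a]) {..<n} (?e a)" for a using F by (cases a) (auto simp: F.adapted_def)
  show "hilbert.onb (obj \<Psi> [a]) {..<n} (?e' a)" for a using G by (cases a) (auto simp: G.adapted_def)
  show "F.form a (?e a i) (?e (dual a) j) = G.form a (?e' a i) (?e' (dual a) j)" if "i < n" "j < n" for a i j
    using that F G
    by (cases a) (auto simp: F.adapted_form_LX G.adapted_form_LX F.adapted_def G.adapted_def)
qed

lemma equivalent_same_list:
  assumes F: "F.adapted n v w \<mu>" and G: "G.adapted m v' w' \<nu>"
    and eq: "mset (map \<mu> [0..<n]) = mset (map \<nu> [0..<m])"
  shows "unitarily_equivalent \<Phi> \<Psi>"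
proof -
  have nm: "n = m" using arg_cong[OF eq, of size] by simp
  obtain h where h: "h permutes {..<m}" "permute_list h (map \<nu> [0..<m]) = map \<mu> [0..<m]"
    using mset_eq_permutation[OF eq] nm by auto
  have hm: "h i < m" if "i < m" for i using h(1) that by (metis lessThan_iff permutes_in_image)
  have "\<mu> i = \<nu> (h i)" if i: "i < m" for i
  proof -
    have "\<mu> i = permute_list h (map \<nu> [0..<m]) ! i" using h(2) i by simp
    also have "\<dots> = \<nu> (h i)" using i hm h(1) by (simp add: permute_list_nth)
    finally show ?thesis .
  qed
  moreover have "G.adapted m (\<lambda>i. v' (h i)) (\<lambda>i. w' (h i)) (\<lambda>i. \<nu> (h i))"
    by (rule G.adapted_reindex[OF G permutes_imp_bij[OF h(1)]])
  ultimately have "G.adapted m (\<lambda>i. v' (h i)) (\<lambda>i. w' (h i)) \<mu>"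
    unfolding G.adapted_def by simp
  then show ?thesis using equivalent_adapted F nm by simp
qed

end

section \<open>The list of the standard functor and the parametrization\<close>

lemma fiber_functor_std:
  assumes d: "d \<noteq> 0" and \<mu>: "mset ms \<in> positive_lists d"
  shows "fiber_functor d (std_fiber d ms)"
proof
  have sums: "(\<Sum>x\<in>#mset ms. f x) = (\<Sum>k<length ms. f (ms ! k))" for f :: "real \<Rightarrow> real"
    by (simp add: sum_mset_sum_list sum_list_sum_nth atLeast0LessThan flip: mset_map)
  have c: "ms ! k > 0" if "k < length ms" for k using \<mu> that by (auto simp: positive_lists_def)
  have "(\<Sum>k<length ms. ms ! k ^ 2) = \<bar>d\<bar>" "(\<Sum>k<length ms. ms ! k powi (- 2)) = \<bar>d\<bar>"
    using \<mu> unfolding positive_lists_def mem_Collect_eq sums by auto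
  then show "unitary_fiber_functor d (std_fiber d ms)"
    unfolding unitary_fiber_functor_def
    using linear_functor_std_fiber[OF c] monoidal_functor_std_fiber[OF d] star_preserving_std_fiber[OF d] d
    by blast
qed (rule d)

lemma std_fiber_eigenvalue_list:
  assumes d: "d \<noteq> 0" and \<mu>: "mset ms \<in> positive_lists d"
  shows "eigenvalue_list (std_fiber d ms) (mset ms)"
proof -
  interpret fiber_functor d "std_fiber d ms" by (rule fiber_functor_std[OF assms])
  let ?n = "length ms"
  have t1: "tuples ?n 1 = (\<lambda>i. [i]) ` {..<?n}"
    by (auto simp: tuples_def length_Suc_conv)
  have onb: "hilbert.onb (obj (std_fiber d ms) [a]) {..<?n} (\<lambda>i. tuple_unit [i])" for a
  proof -
    interpret hilbert "obj (std_fiber d ms) [a]" by (rule hil)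
    have "ip (obj (std_fiber d ms) [a]) (tuple_unit [i]) (tuple_unit [j]) = (if i = j then 1 else 0)"
      if "i < ?n" "j < ?n" for i j
    proof -
      have "ip (obj (std_fiber d ms) [a]) (tuple_unit [i]) (tuple_unit [j]) =
          (\<Sum>I\<in>tuples ?n 1. if I = [i] then (if i = j then 1 else 0) else 0)"
        unfolding std_fiber_simps tuple_space_simps by (intro sum.cong) (auto simp: tuple_unit_def)
      then show ?thesis using that t1 by auto
    qed
    moreover have "span ((\<lambda>i. tuple_unit [i]) ` {..<?n}) = vecs (obj (std_fiber d ms) [a])"
      using span_tuple_unit[of ?n 1] unfolding t1 by (simp add: image_image)
    ultimately show ?thesis by (intro onbI) (auto simp: tuple_unit_def tuples_def)
  qed
  have "form LXstar (tuple_unit [j]) (tuple_unit [i]) = (if i = j then of_real (ms ! i) else 0)"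
    if "i < ?n" "j < ?n" for i j
  proof -
    have "eps_Xstar = of_diagram (cap LXstar)" by (simp add: eps_Xstar_def cap_def)
    then have "form LXstar (tuple_unit [j]) (tuple_unit [i]) =
        ip (obj (std_fiber d ms) []) (fun_scale (if i = j then of_real (ms ! i) else 0) (vac (std_fiber d ms))) (vac (std_fiber d ms))"
      using std_fiber_pairing[OF d that] by (simp add: form_def dmor_def del: std_fiber_simps)
    then show ?thesis by (simp add: fun_scale_def tuple_unit_def)
  qed
  moreover have "ms ! i > 0" if "i < ?n" for i using \<mu> that by (auto simp: positive_lists_def)
  ultimately have "adapted ?n (\<lambda>i. tuple_unit [i]) (\<lambda>i. tuple_unit [i]) (\<lambda>i. ms ! i)"
    using onb unfolding adapted_def by blast
  from adapted_eigenvalue_list[OF this] show ?thesis by (simp add: map_nth)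
qed

theorem theorem5p2:
  fixes d :: real
  assumes "d ^ 2 \<ge> 4"
  shows
    "(\<forall>\<Phi> :: 'a::ab_group_add fiber. unitary_fiber_functor d \<Phi> \<longrightarrow>
        (\<exists>!\<mu>. eigenvalue_list \<Phi> \<mu>) \<and> (\<forall>\<mu>. eigenvalue_list \<Phi> \<mu> \<longrightarrow> \<mu> \<in> positive_lists d)) \<and>
     (\<forall>(\<Phi> :: 'a fiber) (\<Psi> :: 'b::ab_group_add fiber) \<mu> \<nu>.
        unitary_fiber_functor d \<Phi> \<and> unitary_fiber_functor d \<Psi> \<and>
        eigenvalue_list \<Phi> \<mu> \<and> eigenvalue_list \<Psi> \<nu> \<longrightarrow>
        (unitarily_equivalent \<Phi> \<Psi> \<longleftrightarrow> \<mu> = \<nu>)) \<and>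
     (\<forall>\<mu>\<in>positive_lists d. \<exists>\<Phi> :: (nat list \<Rightarrow> complex) fiber.
        unitary_fiber_functor d \<Phi> \<and> eigenvalue_list \<Phi> \<mu>)"
proof (intro conjI allI ballI impI)
  have d: "d \<noteq> 0" using assms by auto
  {
    fix \<Phi> :: "'a fiber" assume "unitary_fiber_functor d \<Phi>"
    then interpret fiber_functor d \<Phi> using d by unfold_locales
    obtain n v w \<mu> where ad: "adapted n v w \<mu>" using adapted_exists by blast
    show "\<exists>!\<mu>. eigenvalue_list \<Phi> \<mu>"
      using adapted_eigenvalue_list[OF ad] eigenvalue_list_unique[OF ad] by blast
    show "\<nu> \<in> positive_lists d" if "eigenvalue_list \<Phi> \<nu>" for \<nu>
      using adapted_positive_list[OF ad] eigenvalue_list_unique[OF ad that] by simp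
  }
  {
    fix \<Phi> :: "'a fiber" and \<Psi> :: "'b fiber" and \<mu> \<nu>
    assume *: "unitary_fiber_functor d \<Phi> \<and> unitary_fiber_functor d \<Psi> \<and>
        eigenvalue_list \<Phi> \<mu> \<and> eigenvalue_list \<Psi> \<nu>"
    then interpret fiber_pair d \<Phi> \<Psi> using d by unfold_locales auto
    obtain n v w m where F: "F.adapted n v w m" using F.adapted_exists by blast
    obtain n' v' w' m' where G: "G.adapted n' v' w' m'" using G.adapted_exists by blast
    have l: "\<mu> = mset (map m [0..<n])" "\<nu> = mset (map m' [0..<n'])"
      using F.eigenvalue_list_unique[OF F] G.eigenvalue_list_unique[OF G] * by auto
    show "unitarily_equivalent \<Phi> \<Psi> \<longleftrightarrow> \<mu> = \<nu>"
    proof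
      assume "unitarily_equivalent \<Phi> \<Psi>"
      then have "eigenvalue_list \<Psi> \<mu>" using eigenvalue_list_transport * by blast
      then show "\<mu> = \<nu>" using G.eigenvalue_list_unique[OF G] l by simp
    next
      assume "\<mu> = \<nu>"
      then show "unitarily_equivalent \<Phi> \<Psi>" using equivalent_same_list[OF F G] l by simp
    qed
  }
  fix \<mu> assume \<mu>: "\<mu> \<in> positive_lists d"
  \<comment> \<open>The standard functor is built from an ordered list; any ordering serves.\<close>
  obtain ms where "mset ms = \<mu>" using ex_mset by blast
  then show "\<exists>\<Phi> :: (nat list \<Rightarrow> complex) fiber. unitary_fiber_functor d \<Phi> \<and> eigenvalue_list \<Phi> \<mu>"
    using fiber_functor_std[OF d] std_fiber_eigenvalue_list[OF d] \<mu> unfolding fiber_functor_def by blast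
qed

end
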